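(* Let $\omega>0$, $v\in\mathbb{R}$ with $|v|<1$, and $1<p<5$. Then there exists a non-trivial solution $Q_{\omega,v}\in X$ of $$-\partial_{xx}Q+|D_y|Q-iv\,\partial_yQ+\omega Q-|Q|^{p-1}Q=0\quad\text{in }\mathbb{R}^2$$ which satisfies $\mathcal{S}_{\omega,v}(Q_{\omega,v})=m_{\omega,v}$, where $$m_{\omega,v}=\inf\{\mathcal{S}_{\omega,v}(u)\mid u\in X\setminus\{0\},\ \mathcal{N}_{\omega,v}(u)=0\}.$$
   Context: Functions are complex-valued on $\mathbb{R}^2$ with variables $(x,y)$; $|D_y|^{a}$ is the Fourier multiplier in $y$ with symbol $|\eta|^a$. $X=H^1_xL^2_y(\mathbb{R}^2)\cap L^2_xH^{1/2}_y(\mathbb{R}^2)$ with norm $\|u\|_X=(\|\partial_xu\|_{L^2}^2+\||D_y|^{1/2}u\|_{L^2}^2+\|u\|_{L^2}^2)^{1/2}$. Define on $X$ $$\mathcal{S}_{\omega,v}(u)=\tfrac12\int_{\mathbb{R}^2}\left\{|\partial_xu|^2+(|D_y|u)\overline{u}-iv(\partial_yu)\overline{u}+\omega|u|^2\right\}dxdy-\tfrac1{p+1}\int_{\mathbb{R}^2}|u|^{p+1}dxdy,$$ $$\mathcal{N}_{\omega,v}(u)=\int_{\mathbb{R}^2}\left\{|\partial_xu|^2+(|D_y|u)\overline{u}-iv(\partial_yu)\overline{u}+\omega|u|^2\right\}dxdy-\int_{\mathbb{R}^2}|u|^{p+1}dxdy,$$ where the terms with $|D_y|$ and $\partial_y$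 are understood as quadratic forms on $X$ via the Fourier transform in $y$ (symbols $|\eta|$ and $v\eta$ respectively for $|D_y|$ and $-iv\partial_y$). A function $u\in X$ is a solution of the equation if and only if it is a critical point of $\mathcal{S}_{\omega,v}$ on $X$. *)

theory Defs
  imports "HOL-Analysis.Analysis"
begin

text \<open>Elements of \<open>L\<^sup>2\<close> are represented by Borel functions; equality of elements is
  equality almost everywhere.\<close>

definition L2 :: "(real \<times> real \<Rightarrow> complex) set" where
  "L2 = {u \<in> borel_measurable lborel. integrable lborel (\<lambda>z. (cmod (u z))\<^sup>2)}"

text \<open>Weak derivative in the first variable, tested against real functions
  \<open>\<phi> \<in> C\<^sup>1\<^sub>c\<close> with partial derivatives \<open>\<phi>x\<close>, \<open>\<phi>y\<close>.\<close>

definition has_weak_dx :: "(real \<times> real \<Rightarrow> complex) \<Rightarrow> (real \<times> real \<Rightarrow> complex) \<Rightarrow> bool" where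
  "has_weak_dx u w \<longleftrightarrow> w \<in> L2 \<and>
     (\<forall>\<phi> \<phi>x \<phi>y :: real \<times> real \<Rightarrow> real.
        (\<forall>z. (\<phi> has_derivative (\<lambda>(a, b). a * \<phi>x z + b * \<phi>y z)) (at z)) \<longrightarrow>
        continuous_on UNIV \<phi>x \<longrightarrow> continuous_on UNIV \<phi>y \<longrightarrow> bounded {z. \<phi> z \<noteq> 0} \<longrightarrow>
        (LINT z|lborel. \<phi>x z *\<^sub>R u z) = - (LINT z|lborel. \<phi> z *\<^sub>R w z))"

definition weak_dx :: "(real \<times> real \<Rightarrow> complex) \<Rightarrow> real \<times> real \<Rightarrow> complex" where
  "weak_dx u = (SOME w. has_weak_dx u w)"

text \<open>The unitary Fourier transform in the second variable of \<open>u \<in> L\<^sup>2\<close>, as the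
  \<open>L\<^sup>2\<close>-limit of the transforms of the truncations of \<open>u\<close> to \<open>\<bar>y\<bar> \<le> R\<close>. The distance is
  a nonnegative Lebesgue integral, so that convergence cannot hold for lack of integrability.\<close>

definition fourier_y_trunc ::
  "real \<Rightarrow> (real \<times> real \<Rightarrow> complex) \<Rightarrow> real \<times> real \<Rightarrow> complex" where
  "fourier_y_trunc R u = (\<lambda>(x, \<eta>).
     (1 / sqrt (2 * pi)) *\<^sub>R (LINT y:{-R..R}|lborel. exp (- \<i> * of_real (y * \<eta>)) * u (x, y)))"

definition has_fourier_y :: "(real \<times> real \<Rightarrow> complex) \<Rightarrow> (real \<times> real \<Rightarrow> complex) \<Rightarrow> bool" where
  "has_fourier_y u F \<longleftrightarrow> F \<in> L2 \<and>
     ((\<lambda>R. \<integral>\<^sup>+z. ennreal ((cmod (F z - fourier_y_trunc R u z))\<^sup>2) \<partial>lborel) \<longlongrightarrow> 0) at_top"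

definition fourier_y :: "(real \<times> real \<Rightarrow> complex) \<Rightarrow> real \<times> real \<Rightarrow> complex" where
  "fourier_y u = (SOME F. has_fourier_y u F)"

definition X :: "(real \<times> real \<Rightarrow> complex) set" where
  "X = {u \<in> L2. (\<exists>w. has_weak_dx u w) \<and>
     (\<exists>F. has_fourier_y u F \<and> integrable lborel (\<lambda>(x, \<eta>). \<bar>\<eta>\<bar> * (cmod (F (x, \<eta>)))\<^sup>2))}"

definition norm_X :: "(real \<times> real \<Rightarrow> complex) \<Rightarrow> real" where
  "norm_X u = sqrt ((LINT z|lborel. (cmod (weak_dx u z))\<^sup>2)
     + (LINT (x, \<eta>)|lborel. \<bar>\<eta>\<bar> * (cmod (fourier_y u (x, \<eta>)))\<^sup>2)
     + (LINT z|lborel. (cmod (u z))\<^sup>2))"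

text \<open>The integral of \<open>\<bar>\<partial>\<^sub>xu\<bar>\<^sup>2 + (\<bar>D\<^sub>y\<bar>u) cnj u - \<i>v(\<partial>\<^sub>yu) cnj u + \<omega>\<bar>u\<bar>\<^sup>2\<close>, with the two terms in
  \<open>y\<close> read on the Fourier side, where \<open>\<bar>D\<^sub>y\<bar>\<close> and \<open>-\<i>v\<partial>\<^sub>y\<close> have the symbols \<open>\<bar>\<eta>\<bar>\<close> and \<open>v\<eta>\<close>.\<close>

definition quad_form :: "real \<Rightarrow> real \<Rightarrow> (real \<times> real \<Rightarrow> complex) \<Rightarrow> real" where
  "quad_form \<omega> v u = (LINT z|lborel. (cmod (weak_dx u z))\<^sup>2)
     + (LINT (x, \<eta>)|lborel. \<bar>\<eta>\<bar> * (cmod (fourier_y u (x, \<eta>)))\<^sup>2)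
     + (LINT (x, \<eta>)|lborel. v * \<eta> * (cmod (fourier_y u (x, \<eta>)))\<^sup>2)
     + \<omega> * (LINT z|lborel. (cmod (u z))\<^sup>2)"

definition action :: "real \<Rightarrow> real \<Rightarrow> real \<Rightarrow> (real \<times> real \<Rightarrow> complex) \<Rightarrow> real" where
  "action \<omega> v p u =
     1 / 2 * quad_form \<omega> v u - 1 / (p + 1) * (LINT z|lborel. cmod (u z) powr (p + 1))"

definition nehari :: "real \<Rightarrow> real \<Rightarrow> real \<Rightarrow> (real \<times> real \<Rightarrow> complex) \<Rightarrow> real" where
  "nehari \<omega> v p u = quad_form \<omega> v u - (LINT z|lborel. cmod (u z) powr (p + 1))"

definition nonzero :: "(real \<times> real \<Rightarrow> complex) \<Rightarrow> bool" where
  "nonzero u \<longleftrightarrow> \<not> (AE z in lborel. u z = 0)"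

definition min_action :: "real \<Rightarrow> real \<Rightarrow> real \<Rightarrow> real" where
  "min_action \<omega> v p = Inf {action \<omega> v p u |u. u \<in> X \<and> nonzero u \<and> nehari \<omega> v p u = 0}"

text \<open>Solutions in \<open>X\<close> of \<open>-\<partial>\<^sub>x\<^sub>xu + \<bar>D\<^sub>y\<bar>u - \<i>v\<partial>\<^sub>yu + \<omega>u - \<bar>u\<bar>\<^bsup>p-1\<^esup>u = 0\<close> are the critical points of
  the action on \<open>X\<close>: its Frechet derivative at \<open>u\<close> with respect to \<open>norm_X\<close> exists and is zero.\<close>

definition is_solution :: "real \<Rightarrow> real \<Rightarrow> real \<Rightarrow> (real \<times> real \<Rightarrow> complex) \<Rightarrow> bool" where
  "is_solution \<omega> v p u \<longleftrightarrow> u \<in> X \<and>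
     (\<forall>\<epsilon>>0. \<exists>\<delta>>0. \<forall>h\<in>X. norm_X h < \<delta> \<longrightarrow>
        \<bar>action \<omega> v p (\<lambda>z. u z + h z) - action \<omega> v p u\<bar> \<le> \<epsilon> * norm_X h)"

end

theory Submission
  imports Defs "HOL-Probability.Probability" "HOL-Complex_Analysis.Great_Picard"
begin

text \<open>Write \<open>A\<close> for the quadratic form, \<open>q = p + 1\<close> and \<open>N u\<close> for the integral of \<open>\<bar>u\<bar>\<close> to the power \<open>q\<close>,
so that the action is \<open>A/2 - N/q\<close> and \<open>2 < q < 6\<close>. The ground state is a rescaled maximizer of
\<open>N\<close> on \<open>{u \<in> X. A u \<le> 1}\<close>. The proof has three parts.

\<^bold>\<open>Why the maximum \<open>S\<close> is finite.\<close> The form \<open>A\<close> controls translations anisotropically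
(lemma \<open>nsq_translate_le_quad_form\<close>): the squared norm of \<open>u(\<cdot> + (s,t)) - u\<close> is at most a constant
times \<open>(s\<^sup>2 + \<bar>t\<bar>) A u\<close>, in \<open>x\<close> because the difference is an integral of the weak derivative, and in
\<open>y\<close> because \<open>\<bar>exp (\<i>\<theta>) - 1\<bar>\<^sup>2 \<le> 2\<bar>\<theta>\<bar>\<close> on the Fourier side. Let \<open>u\<^sub>k\<close> be the average of \<open>u\<close> over
translates of a rectangle of width \<open>2\<^sup>-\<^sup>k\<close> and height \<open>4\<^sup>-\<^sup>k\<close>, so that \<open>s\<^sup>2\<close> and \<open>t\<close> have the same
size on it. If \<open>A u \<le> 1\<close>, then \<open>u - u\<^sub>k\<close> has squared norm \<open>O(4\<^sup>-\<^sup>k)\<close>, while telescoping the scales gives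
\<open>\<bar>u\<^sub>k\<bar> \<le> C \<cdot> sqrt 2 ^ k\<close>. Hence the set where \<open>\<bar>u\<bar>\<close> exceeds twice that bound carries only \<open>O(4\<^sup>-\<^sup>k)\<close> of
the squared norm, and summing \<open>\<bar>u\<bar>\<close> to the power \<open>q\<close> over these level sets gives a geometric series
of ratio \<open>(sqrt 2 powr (q - 2)) / 4\<close>, which is below 1 exactly for \<open>q < 6\<close> (lemma \<open>nn_powr_le\<close>).
Starting the series at a large \<open>k\<close> gives more: if \<open>u\<^sub>k\<close> is uniformly small, then \<open>N u\<close> is small
(lemma \<open>nonvanishing\<close>).

\<^bold>\<open>Why the maximum is attained.\<close> By the last remark the members of a maximizing sequence \<open>U\<^sub>n\<close> can be
translated so that their averages at one fixed scale stay away from 0 at the origin. Weak compactness is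
replaced by convex combinations of the tails of the sequence: nearly minimizing \<open>A\<close> among them gives, by
the parallelogram law and completeness of \<open>X\<close>, a sequence that converges in norm to some \<open>u\<close> (lemma
\<open>convex_combinations_converge\<close>). The averages of \<open>U\<^sub>n\<close> are equicontinuous, so along a subsequence they
converge pointwise, and the limits must be the averages of \<open>u\<close>. So \<open>u\<close> is nonzero, and a further
subsequence converges to \<open>u\<close> almost everywhere. Along it \<open>A (U\<^sub>n - u) \<le> 1 - A u + o(1)\<close> (lemma
\<open>A_gap\<close>), and half of the Brezis-Lieb lemma bounds \<open>N U\<^sub>n\<close> by \<open>N (U\<^sub>n - u) + N u + o(1)\<close>. With the
homogeneous bound \<open>N \<le> S A powr (q/2)\<close> this yields
\<open>S \<le> S (1 - A u) powr (q/2) + N u \<le> S ((1 - A u) powr (q/2) + A u powr (q/2))\<close>, which is impossible for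
\<open>0 < A u < 1\<close> because \<open>q/2 > 1\<close>. Hence \<open>A u = 1\<close> and \<open>N u = S\<close> (lemma \<open>maximizing_sequence_limit\<close>).

\<^bold>\<open>Why a maximizer is a ground state.\<close> The multiple \<open>Q\<close> of \<open>u\<close> with \<open>N Q = A Q = a\<close> satisfies
\<open>N w \<le> a powr (1 - q/2) \<cdot> A w powr (q/2)\<close> on \<open>X\<close>, with equality at \<open>Q\<close>. On the Nehari set, where the action
is \<open>(1/2 - 1/q) A\<close>, this says \<open>A w \<ge> a\<close>, so \<open>Q\<close> has least action. It also makes \<open>Q\<close> critical:
the action at \<open>w\<close> is at least \<open>f (A w)\<close> for the function \<open>f s = s/2 - a powr (1 - q/2) \<cdot> s powr (q/2) / q\<close>,
which is stationary at \<open>a\<close>, so the action at \<open>Q + h\<close> and at \<open>Q - h\<close> is at least that at \<open>Q\<close> up to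
\<open>o(\<parallel>h\<parallel>)\<close>; and the parallelogram law together with convexity of \<open>N\<close> bounds the sum of these two actions
by twice the action at \<open>Q\<close> plus \<open>A h\<close>, so that each is also at most that at \<open>Q\<close> up to \<open>o(\<parallel>h\<parallel>)\<close>
(lemma \<open>ground_state_is_solution\<close>). No derivative of the nonlinear term is computed.\<close>

section \<open>Square-integrable functions\<close>

text \<open>The squared \<open>L\<^sup>2\<close> norm, valued in \<open>[0, \<infinity>]\<close>
  so that limits, Fubini and estimates can be carried out before finiteness is known.\<close>

definition nsq :: "('a::euclidean_space \<Rightarrow> complex) \<Rightarrow> ennreal" where
  "nsq f = (\<integral>\<^sup>+z. ennreal ((cmod (f z))\<^sup>2) \<partial>lborel)"

definition sqint :: "('a::euclidean_space \<Rightarrow> complex) \<Rightarrow> bool" where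
  "sqint f \<longleftrightarrow> f \<in> borel_measurable borel \<and> nsq f < \<infinity>"

lemma sqint_measurable [measurable_dest]: "sqint f \<Longrightarrow> f \<in> borel_measurable borel"
  by (simp add: sqint_def)

lemma sqint_iff_integrable:
  "sqint f \<longleftrightarrow> f \<in> borel_measurable borel \<and> integrable lborel (\<lambda>z. (cmod (f z))\<^sup>2)"
  by (auto simp: sqint_def nsq_def integrable_iff_bounded)

lemma L2_iff_sqint: "u \<in> L2 \<longleftrightarrow> sqint u"
  by (auto simp: L2_def sqint_iff_integrable)

lemma ennreal_tendsto_0I:
  fixes f :: "nat \<Rightarrow> ennreal"
  assumes "\<And>e. e > 0 \<Longrightarrow> \<exists>N. \<forall>n\<ge>N. f n \<le> ennreal e"
  shows "f \<longlonglongrightarrow> 0"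
proof (rule order_tendstoI)
  fix a :: ennreal assume "0 < a"
  then obtain b where b: "0 < b" "b < a" using dense by blast
  then have "ennreal (enn2real b) = b" "enn2real b > 0"
    by (auto simp: enn2real_positive_iff less_top[symmetric] top_unique intro!: ennreal_enn2real)
  with assms[of "enn2real b"] b show "eventually (\<lambda>n. f n < a) sequentially"
    by (auto simp: eventually_sequentially) (metis le_less_trans)
qed auto

lemma ennreal_tendsto_0D:
  fixes f :: "nat \<Rightarrow> ennreal"
  assumes "f \<longlonglongrightarrow> 0" "e > 0"
  shows "\<exists>N. \<forall>n\<ge>N. f n \<le> ennreal e"
  using order_tendstoD(2)[OF assms(1), of "ennreal e"] assms(2)
  by (auto simp: eventually_sequentially intro: less_imp_le)

lemma ennreal_times_2: "e \<ge> 0 \<Longrightarrow> 2 * ennreal e = ennreal (2 * e)"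
  by (simp add: ennreal_mult)

lemma nsq_eq_integral: "sqint f \<Longrightarrow> nsq f = ennreal (LINT z|lborel. (cmod (f z))\<^sup>2)"
  unfolding nsq_def by (subst nn_integral_eq_integral) (auto simp: sqint_iff_integrable)

text \<open>Young's inequality for the mixed term. A small \<open>t\<close> keeps the factor of
  \<open>a\<close> close to 1, which is what perturbation estimates need.\<close>

lemma cmod_add_sq_le:
  fixes a b :: complex
  assumes "t > 0"
  shows "(cmod (a + b))\<^sup>2 \<le> (1 + t) * (cmod a)\<^sup>2 + (1 + 1/t) * (cmod b)\<^sup>2"
proof -
  have "(cmod (a + b))\<^sup>2 \<le> (cmod a + cmod b)\<^sup>2"
    by (intro power_mono norm_triangle_ineq) auto
  also have "\<dots> = (1 + t) * (cmod a)\<^sup>2 + (1 + 1/t) * (cmod b)\<^sup>2 - (sqrt t * cmod a - cmod b / sqrt t)\<^sup>2"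
  proof -
    have "(sqrt t * cmod a - cmod b / sqrt t)\<^sup>2 = t * (cmod a)\<^sup>2 + (cmod b)\<^sup>2 / t - 2 * (cmod a * cmod b)"
      using assms by (simp add: power2_diff power_mult_distrib power_divide)
    then show ?thesis by (simp add: power2_sum algebra_simps)
  qed
  finally show ?thesis
    using zero_le_power2[of "sqrt t * cmod a - cmod b / sqrt t"] by linarith
qed

lemma nsq_add_le_weighted:
  assumes [measurable]: "f \<in> borel_measurable borel" "g \<in> borel_measurable borel" and t: "t > 0"
  shows "nsq (\<lambda>z. f z + g z) \<le> ennreal (1 + t) * nsq f + ennreal (1 + 1/t) * nsq g"
proof -
  have "nsq (\<lambda>z. f z + g z) \<le> (\<integral>\<^sup>+z. ennreal (1 + t) * ennreal ((cmod (f z))\<^sup>2)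
      + ennreal (1 + 1/t) * ennreal ((cmod (g z))\<^sup>2) \<partial>lborel)"
    unfolding nsq_def using t cmod_add_sq_le[OF t]
    by (intro nn_integral_mono) (simp flip: ennreal_mult ennreal_plus)
  then show ?thesis
    unfolding nsq_def using t by (simp add: nn_integral_add nn_integral_cmult)
qed

lemma nsq_add_le:
  assumes "f \<in> borel_measurable borel" "g \<in> borel_measurable borel"
  shows "nsq (\<lambda>z. f z + g z) \<le> 2 * nsq f + 2 * nsq g"
  using nsq_add_le_weighted[OF assms, of 1] by simp

lemma nsq_diff_commute: "nsq (\<lambda>z. f z - g z) = nsq (\<lambda>z. g z - f z)"
  by (simp add: nsq_def norm_minus_commute)

lemma nsq_cmult:
  assumes [measurable]: "f \<in> borel_measurable borel"
  shows "nsq (\<lambda>z. c * f z) = ennreal ((cmod c)\<^sup>2) * nsq f"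
  unfolding nsq_def by (simp add: norm_mult power_mult_distrib ennreal_mult nn_integral_cmult)

lemma nsq_uminus [simp]: "nsq (\<lambda>z. - f z) = nsq f"
  by (simp add: nsq_def)

lemma nsq_diff_le:
  assumes [measurable]: "f \<in> borel_measurable borel" "g \<in> borel_measurable borel"
  shows "nsq (\<lambda>z. f z - g z) \<le> 2 * nsq f + 2 * nsq g"
  using nsq_add_le[of f "\<lambda>z. - g z"] by simp

lemma nsq_triangle:
  assumes [measurable]: "f \<in> borel_measurable borel" "g \<in> borel_measurable borel" "h \<in> borel_measurable borel"
  shows "nsq (\<lambda>z. f z - h z) \<le> 2 * nsq (\<lambda>z. f z - g z) + 2 * nsq (\<lambda>z. g z - h z)"
  using nsq_add_le[of "\<lambda>z. f z - g z" "\<lambda>z. g z - h z"] by simp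

text \<open>The form of the triangle inequality used in epsilon arguments: squared norms add up
  with a factor 2 at each step.\<close>

lemma nsq_triangle_le:
  assumes "f \<in> borel_measurable borel" "g \<in> borel_measurable borel" "h \<in> borel_measurable borel"
    and "nsq (\<lambda>z. f z - g z) \<le> ennreal a" "nsq (\<lambda>z. g z - h z) \<le> ennreal b"
    and "0 \<le> a" "0 \<le> b" "2 * a + 2 * b \<le> e"
  shows "nsq (\<lambda>z. f z - h z) \<le> ennreal e"
proof -
  have "nsq (\<lambda>z. f z - h z) \<le> 2 * ennreal a + 2 * ennreal b"
    using assms(4,5) by (intro order_trans[OF nsq_triangle[OF assms(1-3)]] add_mono mult_left_mono) auto
  also have "\<dots> = ennreal (2 * a + 2 * b)" using assms(6,7) by (simp add: ennreal_times_2 flip: ennreal_plus)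
  also have "\<dots> \<le> ennreal e" by (rule ennreal_leI) fact
  finally show ?thesis .
qed

lemma nsq_cong_AE:
  assumes "AE z in lborel. f z = g z" shows "nsq f = nsq g"
  unfolding nsq_def using assms by (intro nn_integral_cong_AE) auto

lemma nsq_mono_AE:
  assumes "AE z in lborel. cmod (f z) \<le> cmod (g z)" shows "nsq f \<le> nsq g"
  unfolding nsq_def using assms by (intro nn_integral_mono_AE) (auto intro!: power_mono elim: eventually_mono)

lemma nsq_eq_0_iff:
  assumes [measurable]: "f \<in> borel_measurable borel"
  shows "nsq f = 0 \<longleftrightarrow> (AE z in lborel. f z = 0)"
  unfolding nsq_def by (subst nn_integral_0_iff_AE) auto

lemma nsq_zero [simp]: "nsq (\<lambda>z. 0) = 0"
  by (simp add: nsq_def)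

lemma sqint_zero [simp, intro]: "sqint (\<lambda>z. 0)"
  by (simp add: sqint_def)

lemma sqint_add [intro]: "sqint f \<Longrightarrow> sqint g \<Longrightarrow> sqint (\<lambda>z. f z + g z)"
  unfolding sqint_def using nsq_add_le[of f g]
  by (auto simp: ennreal_mult_less_top ennreal_add_eq_top intro!: le_less_trans[OF nsq_add_le])

lemma sqint_cmult [intro]: "sqint f \<Longrightarrow> sqint (\<lambda>z. c * f z)"
  unfolding sqint_def by (auto simp: nsq_cmult ennreal_mult_less_top)

lemma sqint_diff [intro]: "sqint f \<Longrightarrow> sqint g \<Longrightarrow> sqint (\<lambda>z. f z - g z)"
  using sqint_add[of f "\<lambda>z. (-1) * g z"] sqint_cmult[of g "-1"] by simp

lemma sqint_mono:
  assumes "sqint g" "f \<in> borel_measurable borel" "\<And>z. cmod (f z) \<le> cmod (g z)"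
  shows "sqint f"
  using assms nsq_mono_AE[of f g] by (auto simp: sqint_def)

lemma nsq_indicator:
  assumes "K \<in> sets borel"
  shows "nsq (\<lambda>z. indicator K z :: complex) = emeasure lborel K"
proof -
  have "ennreal ((cmod (indicator K z :: complex))\<^sup>2) = indicator K z" for z by (cases "z \<in> K") auto
  then show ?thesis using assms by (simp add: nsq_def)
qed

lemma sqint_indicator:
  fixes K :: "'a::euclidean_space set"
  assumes "bounded K" "K \<in> sets borel"
  shows "sqint (\<lambda>z. indicator K z :: complex)"
  using emeasure_bounded_finite[OF assms(1)] assms(2) by (auto simp: sqint_def nsq_indicator)

lemma CS_nsq:
  assumes [measurable]: "f \<in> borel_measurable borel" "g \<in> borel_measurable borel"
  shows "(\<integral>\<^sup>+z. ennreal (cmod (f z * g z)) \<partial>lborel)\<^sup>2 \<le> nsq f * nsq g"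
  using Cauchy_Schwarz_nn_integral[of "\<lambda>z. ennreal (cmod (f z))" lborel "\<lambda>z. ennreal (cmod (g z))"]
  by (simp add: nsq_def norm_mult ennreal_mult ennreal_power)

lemma sqint_mult_integrable:
  assumes "sqint f" "sqint g"
  shows "integrable lborel (\<lambda>z. f z * g z)"
proof -
  have [measurable]: "f \<in> borel_measurable borel" "g \<in> borel_measurable borel"
    using assms by (auto simp: sqint_def)
  have "(\<integral>\<^sup>+z. ennreal (cmod (f z * g z)) \<partial>lborel)\<^sup>2 < \<infinity>"
    using assms by (intro le_less_trans[OF CS_nsq]) (auto simp: sqint_def ennreal_mult_less_top)
  then show ?thesis
    by (simp add: integrable_iff_bounded power_less_top_ennreal)
qed

lemma CS_integral:
  assumes "sqint f" "sqint g"
  shows "ennreal ((cmod (LINT z|lborel. f z * g z))\<^sup>2) \<le> nsq f * nsq g"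
proof -
  have [measurable]: "f \<in> borel_measurable borel" "g \<in> borel_measurable borel"
    using assms by (auto simp: sqint_def)
  have "ennreal (cmod (LINT z|lborel. f z * g z)) \<le> (\<integral>\<^sup>+z. ennreal (cmod (f z * g z)) \<partial>lborel)"
    using integral_norm_bound_ennreal[OF sqint_mult_integrable[OF assms]] by simp
  then have "(ennreal (cmod (LINT z|lborel. f z * g z)))\<^sup>2 \<le> (\<integral>\<^sup>+z. ennreal (cmod (f z * g z)) \<partial>lborel)\<^sup>2"
    by (rule power_mono) auto
  also have "\<dots> \<le> nsq f * nsq g" by (rule CS_nsq) auto
  finally show ?thesis by (simp add: ennreal_power)
qed

lemma CS_tendsto:
  assumes p: "sqint \<phi>" and u: "\<And>n. sqint (u n)" "sqint v" and lim: "(\<lambda>n. nsq (\<lambda>z. u n z - v z)) \<longlonglongrightarrow> 0"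
  shows "(\<lambda>n. LINT z|lborel. \<phi> z * u n z) \<longlonglongrightarrow> (LINT z|lborel. \<phi> z * v z)"
proof -
  have "(\<lambda>n. ennreal ((cmod ((LINT z|lborel. \<phi> z * u n z) - (LINT z|lborel. \<phi> z * v z)))\<^sup>2)) \<longlonglongrightarrow> 0"
  proof (rule tendsto_sandwich[OF _ _ tendsto_const])
    show "\<forall>\<^sub>F n in sequentially. ennreal ((cmod ((LINT z|lborel. \<phi> z * u n z) - (LINT z|lborel. \<phi> z * v z)))\<^sup>2)
       \<le> nsq \<phi> * nsq (\<lambda>z. u n z - v z)"
    proof (rule always_eventually, rule allI)
      fix n
      have "(LINT z|lborel. \<phi> z * u n z) - (LINT z|lborel. \<phi> z * v z) = (LINT z|lborel. \<phi> z * (u n z - v z))"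
        using sqint_mult_integrable[OF p u(1)[of n]] sqint_mult_integrable[OF p u(2)]
        by (simp add: right_diff_distrib)
      then show "ennreal ((cmod ((LINT z|lborel. \<phi> z * u n z) - (LINT z|lborel. \<phi> z * v z)))\<^sup>2) \<le> nsq \<phi> * nsq (\<lambda>z. u n z - v z)"
        using CS_integral[OF p sqint_diff[OF u(1)[of n] u(2)]] by simp
    qed
    have "(\<lambda>n. nsq \<phi> * nsq (\<lambda>z. u n z - v z)) \<longlonglongrightarrow> nsq \<phi> * 0"
      using p by (intro ennreal_tendsto_cmult lim) (auto simp: sqint_def)
    then show "(\<lambda>n. nsq \<phi> * nsq (\<lambda>z. u n z - v z)) \<longlonglongrightarrow> 0" by simp
  qed auto
  then have "(\<lambda>n. (cmod ((LINT z|lborel. \<phi> z * u n z) - (LINT z|lborel. \<phi> z * v z)))\<^sup>2) \<longlonglongrightarrow> 0"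
    by (subst (asm) ennreal_tendsto_0_iff) auto
  from tendsto_real_sqrt[OF this] show ?thesis by (simp add: tendsto_norm_zero_iff LIM_zero_iff)
qed

lemma nsq_Fatou:
  fixes f :: "nat \<Rightarrow> 'a::euclidean_space \<Rightarrow> complex"
  assumes [measurable]: "\<And>n. f n \<in> borel_measurable borel"
    and lim: "AE z in lborel. (\<lambda>n. f n z) \<longlonglongrightarrow> g z"
  shows "nsq g \<le> liminf (\<lambda>n. nsq (f n))"
proof -
  have "nsq g = (\<integral>\<^sup>+z. liminf (\<lambda>n. ennreal ((cmod (f n z))\<^sup>2)) \<partial>lborel)"
    unfolding nsq_def
  proof (rule nn_integral_cong_AE)
    show "AE z in lborel. ennreal ((cmod (g z))\<^sup>2) = liminf (\<lambda>n. ennreal ((cmod (f n z))\<^sup>2))"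
      using lim
    proof eventually_elim
      case (elim z)
      then have "(\<lambda>n. ennreal ((cmod (f n z))\<^sup>2)) \<longlonglongrightarrow> ennreal ((cmod (g z))\<^sup>2)"
        by (intro tendsto_intros)
      from lim_imp_Liminf[OF _ this] show ?case by simp
    qed
  qed
  also have "\<dots> \<le> liminf (\<lambda>n. nsq (f n))"
    unfolding nsq_def by (rule nn_integral_liminf) auto
  finally show ?thesis .
qed

lemma nsq_le_of_AE_lim:
  fixes f :: "nat \<Rightarrow> 'a::euclidean_space \<Rightarrow> complex"
  assumes "\<And>n. f n \<in> borel_measurable borel"
    and "AE z in lborel. (\<lambda>n. f n z) \<longlonglongrightarrow> g z" and "\<And>n. n \<ge> N \<Longrightarrow> nsq (f n) \<le> C"
  shows "nsq g \<le> C"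
proof -
  have "nsq g \<le> liminf (\<lambda>n. nsq (f n))" by (rule nsq_Fatou) fact+
  also have "\<dots> \<le> C"
    using assms(3) by (intro Liminf_le) (auto simp: eventually_sequentially)
  finally show ?thesis .
qed

lemma nsq_tendsto_0_AE_subseq:
  fixes f :: "nat \<Rightarrow> 'a::euclidean_space \<Rightarrow> complex"
  assumes m: "\<And>n. sqint (f n)" and lim: "(\<lambda>n. nsq (f n)) \<longlonglongrightarrow> 0"
  shows "\<exists>r::nat\<Rightarrow>nat. strict_mono r \<and> (AE z in lborel. (\<lambda>n. f (r n) z) \<longlonglongrightarrow> 0)"
proof -
  have "(\<lambda>n. ennreal (LINT z|lborel. (cmod (f n z))\<^sup>2)) \<longlonglongrightarrow> ennreal 0"
    using lim by (simp add: nsq_eq_integral[OF m])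
  then have "(\<lambda>n. LINT z|lborel. norm ((cmod (f n z))\<^sup>2)) \<longlonglongrightarrow> 0"
    by (subst (asm) tendsto_ennreal_iff) auto
  from tendsto_L1_AE_subseq[OF _ this] obtain r where "strict_mono r"
    "AE z in lborel. (\<lambda>n. (cmod (f (r n) z))\<^sup>2) \<longlonglongrightarrow> 0"
    using m by (auto simp: sqint_iff_integrable)
  moreover have "(\<lambda>n. f (r n) z) \<longlonglongrightarrow> 0" if "(\<lambda>n. (cmod (f (r n) z))\<^sup>2) \<longlonglongrightarrow> 0" for z
    using tendsto_real_sqrt[OF that] by (simp add: tendsto_norm_zero_iff)
  ultimately show ?thesis by (auto elim!: eventually_mono)
qed

text \<open>Multiplying by such a weight turns statements about \<open>L\<^sup>2\<close>
  functions on a space of infinite measure into statements about integrable functions, and loses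
  no information about almost everywhere convergence because the weight does not vanish.\<close>

lemma positive_sqint_weight:
  "\<exists>k :: 'a::euclidean_space \<Rightarrow> real. (\<forall>z. 0 < k z \<and> k z \<le> 1) \<and> sqint (\<lambda>z. complex_of_real (k z))"
proof -
  obtain h :: "'a \<Rightarrow> ennreal" where h [measurable]: "h \<in> borel_measurable lborel"
    "integral\<^sup>N lborel h \<noteq> \<infinity>" and hp: "\<And>x. 0 < h x" "\<And>x. h x < \<infinity>"
    using sigma_finite_measure.Ex_finite_integrable_function[OF sigma_finite_lborel] by auto
  \<comment> \<open>An integrable positive function exists by sigma-finiteness; its square root
    is square-integrable.\<close>
  define k where "k z = min 1 (sqrt (enn2real (h z)))" for z
  have "0 < k z" for z using hp[of z] by (auto simp: k_def enn2real_positive_iff)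
  moreover have "sqint (\<lambda>z. complex_of_real (k z))"
  proof -
    have "nsq (\<lambda>z. complex_of_real (k z)) \<le> integral\<^sup>N lborel h"
      unfolding nsq_def
    proof (rule nn_integral_mono)
      fix z
      have "(k z)\<^sup>2 \<le> (sqrt (enn2real (h z)))\<^sup>2" by (intro power_mono) (auto simp: k_def)
      then have "ennreal ((cmod (complex_of_real (k z)))\<^sup>2) \<le> ennreal (enn2real (h z))" by (intro ennreal_leI) simp
      also have "\<dots> = h z" by (rule ennreal_enn2real) (use hp(2)[of z] in simp)
      finally show "ennreal ((cmod (complex_of_real (k z)))\<^sup>2) \<le> h z" .
    qed
    moreover have "(\<lambda>z. complex_of_real (k z)) \<in> borel_measurable borel" using h(1) unfolding k_def by measurable
    ultimately show ?thesis using h(2) by (auto simp: sqint_def less_top intro: le_less_trans)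
  qed
  ultimately show ?thesis by (intro exI[of _ k]) (auto simp: k_def)
qed

text \<open>Completeness of \<open>L\<^sup>2\<close>. Multiplication by a square-integrable
  weight \<open>k > 0\<close> makes the sequence Cauchy in \<open>L\<^sup>1\<close>, where a
  subsequence converges almost everywhere; Fatou's lemma then upgrades the pointwise limit to a
  limit in norm.\<close>

lemma sqint_complete:
  fixes f :: "nat \<Rightarrow> 'a::euclidean_space \<Rightarrow> complex"
  assumes m: "\<And>n. sqint (f n)"
    and cau: "\<And>e. e > 0 \<Longrightarrow> \<exists>N. \<forall>i\<ge>N. \<forall>j\<ge>N. nsq (\<lambda>z. f i z - f j z) \<le> ennreal e"
  shows "\<exists>g. sqint g \<and> (\<lambda>n. nsq (\<lambda>z. f n z - g z)) \<longlonglongrightarrow> 0"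
proof -
  have [measurable]: "f n \<in> borel_measurable borel" for n using m by (auto simp: sqint_def)
  obtain \<rho> :: "'a \<Rightarrow> real" where \<rho>: "\<And>z. 0 < \<rho> z" "sqint (\<lambda>z. complex_of_real (\<rho> z))"
    using positive_sqint_weight by blast
  define k where "k z = complex_of_real (\<rho> z)" for z
  have kp: "k z \<noteq> 0" for z using \<rho>(1)[of z] by (simp add: k_def)
  have sk: "sqint k" unfolding k_def[abs_def] by (rule \<rho>(2))
  note km [measurable] = sqint_measurable[OF sk]
  define K where "K = 1 + enn2real (nsq k)"
  have K: "K > 0" "nsq k \<le> ennreal K"
    using sk by (auto simp: K_def sqint_def less_top add_pos_nonneg intro!: ennreal_leI)
  have int: "integrable lborel (\<lambda>z. f n z * k z)" for n
    by (rule sqint_mult_integrable[OF m sk])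
  have "\<exists>N. \<forall>i\<ge>N. \<forall>j\<ge>N. LINT x|lborel. norm (f i x * k x - f j x * k x) < e" if e: "e > 0" for e :: real
  proof -
    obtain N where N: "\<And>i j. i \<ge> N \<Longrightarrow> j \<ge> N \<Longrightarrow> nsq (\<lambda>z. f i z - f j z) \<le> ennreal (e\<^sup>2 / (4 * K))"
      using cau[of "e\<^sup>2 / (4 * K)"] e K by auto
    have "(LINT x|lborel. norm (f i x * k x - f j x * k x)) < e" if ij: "i \<ge> N" "j \<ge> N" for i j
    proof -
      let ?I = "LINT x|lborel. norm (f i x * k x - f j x * k x)"
      have "ennreal ?I = (\<integral>\<^sup>+x. ennreal (cmod ((f i x - f j x) * k x)) \<partial>lborel)"
        using int by (subst nn_integral_eq_integral) (auto simp: algebra_simps)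
      then have "ennreal (?I\<^sup>2) = (\<integral>\<^sup>+x. ennreal (cmod ((f i x - f j x) * k x)) \<partial>lborel)\<^sup>2"
        by (simp flip: ennreal_power)
      also have "\<dots> \<le> nsq (\<lambda>x. f i x - f j x) * nsq k" by (rule CS_nsq) auto
      also have "\<dots> \<le> ennreal (e\<^sup>2 / (4 * K)) * ennreal K"
        using N[OF ij] K by (intro mult_mono) auto
      also have "\<dots> = ennreal ((e/2)\<^sup>2)"
        using K by (simp flip: ennreal_mult add: power2_eq_square)
      finally have "?I\<^sup>2 \<le> (e/2)\<^sup>2" by simp
      then have "?I \<le> e/2" using e by (simp add: power2_le_iff_abs_le)
      then show ?thesis using e by simp
    qed
    then show ?thesis by blast
  qed
  from cauchy_L1_AE_cauchy_subseq[OF int this]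
  obtain r where r: "strict_mono r" "AE x in lborel. Cauchy (\<lambda>i. f (r i) x * k x)"
    by blast
  define g where "g z = lim (\<lambda>i. f (r i) z)" for z
  have [measurable]: "g \<in> borel_measurable borel" unfolding g_def by measurable
  have lim: "AE x in lborel. (\<lambda>i. f (r i) x) \<longlonglongrightarrow> g x"
    using r(2)
  proof eventually_elim
    case (elim x)
    then obtain l where "(\<lambda>i. f (r i) x * k x) \<longlonglongrightarrow> l"
      using Cauchy_convergent convergent_def by blast
    then have "(\<lambda>i. f (r i) x * k x / k x) \<longlonglongrightarrow> l / k x" by (intro tendsto_intros kp)
    then have "(\<lambda>i. f (r i) x) \<longlonglongrightarrow> l / k x" using kp by simp
    then show ?case unfolding g_def using convergent_LIMSEQ_iff convergent_def by blast
  qed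
  have est: "\<exists>N. \<forall>n\<ge>N. nsq (\<lambda>z. f n z - g z) \<le> ennreal e" if e: "e > 0" for e
  proof -
    obtain N where N: "\<forall>i\<ge>N. \<forall>j\<ge>N. nsq (\<lambda>z. f i z - f j z) \<le> ennreal e" using cau[OF e] by auto
    have "nsq (\<lambda>z. f n z - g z) \<le> ennreal e" if "n \<ge> N" for n
    proof (rule nsq_le_of_AE_lim[where f="\<lambda>i z. f n z - f (r i) z" and N=N])
      show "AE z in lborel. (\<lambda>i. f n z - f (r i) z) \<longlonglongrightarrow> f n z - g z"
        using lim by eventually_elim (intro tendsto_intros)
      show "nsq (\<lambda>z. f n z - f (r i) z) \<le> ennreal e" if "i \<ge> N" for i
        using N \<open>n \<ge> N\<close> that seq_suble[OF r(1), of i] by auto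
    qed auto
    then show ?thesis by blast
  qed
  have "(\<lambda>n. nsq (\<lambda>z. f n z - g z)) \<longlonglongrightarrow> 0"
    by (rule ennreal_tendsto_0I) (use est in auto)
  moreover have "sqint g"
  proof -
    obtain N where "nsq (\<lambda>z. f N z - g z) \<le> ennreal 1" using est[of 1] by auto
    then have "sqint (\<lambda>z. f N z - g z)" by (auto simp: sqint_def intro: le_less_trans)
    from sqint_diff[OF m[of N] this] show ?thesis by simp
  qed
  ultimately show ?thesis by blast
qed

section \<open>Continuity of translations in the mean\<close>

lemma nn_integral_lborel_translate:
  fixes f :: "'a::euclidean_space \<Rightarrow> ennreal"
  assumes [measurable]: "f \<in> borel_measurable borel"
  shows "(\<integral>\<^sup>+z. f (z + c) \<partial>lborel) = (\<integral>\<^sup>+z. f z \<partial>lborel)"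
proof -
  have "(\<integral>\<^sup>+z. f z \<partial>lborel) = (\<integral>\<^sup>+z. f z \<partial>distr lborel borel ((+) c))"
    by (simp add: lborel_distr_plus)
  also have "\<dots> = (\<integral>\<^sup>+z. f (c + z) \<partial>lborel)" by (subst nn_integral_distr) auto
  finally show ?thesis by (simp add: add.commute)
qed

lemma lebesgue_integral_lborel_translate:
  fixes f :: "'a::euclidean_space \<Rightarrow> complex"
  assumes [measurable]: "f \<in> borel_measurable borel"
  shows "(LINT z|lborel. f (z + c)) = (LINT z|lborel. f z)"
proof -
  have "(LINT z|lborel. f z) = (LINT z|distr lborel borel ((+) c). f z)"
    by (simp add: lborel_distr_plus)
  also have "\<dots> = (LINT z|lborel. f (c + z))" by (subst integral_distr) auto
  finally show ?thesis by (simp add: add.commute)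
qed

lemma nsq_translate:
  assumes "f \<in> borel_measurable borel"
  shows "nsq (\<lambda>z. f (z + c)) = nsq f"
  unfolding nsq_def using assms by (intro nn_integral_lborel_translate[where f="\<lambda>z. ennreal ((cmod (f z))\<^sup>2)"]) auto

lemma sqint_translate [intro]: "sqint f \<Longrightarrow> sqint (\<lambda>z. f (z + c))"
  by (auto simp: sqint_def nsq_translate)

lemma nsq_tendsto_0_dominated:
  fixes f :: "nat \<Rightarrow> 'a::euclidean_space \<Rightarrow> complex"
  assumes [measurable]: "\<And>n. f n \<in> borel_measurable borel" and g: "sqint g"
    and le: "\<And>n. AE z in lborel. cmod (f n z) \<le> cmod (g z)"
    and lim: "AE z in lborel. (\<lambda>n. f n z) \<longlonglongrightarrow> 0"
  shows "(\<lambda>n. nsq (f n)) \<longlonglongrightarrow> 0"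
proof -
  have [measurable]: "g \<in> borel_measurable borel" using g by (auto simp: sqint_def)
  have "(\<lambda>n. \<integral>\<^sup>+z. ennreal ((cmod (f n z))\<^sup>2) \<partial>lborel) \<longlonglongrightarrow> (\<integral>\<^sup>+z. ennreal 0 \<partial>(lborel::'a measure))"
  proof (rule nn_integral_dominated_convergence[where w="\<lambda>z. ennreal ((cmod (g z))\<^sup>2)"])
    show "(\<integral>\<^sup>+z. ennreal ((cmod (g z))\<^sup>2) \<partial>lborel) < \<infinity>" using g by (simp add: sqint_def nsq_def)
    show "AE x in lborel. ennreal ((cmod (f n x))\<^sup>2) \<le> ennreal ((cmod (g x))\<^sup>2)" for n
      using le[of n] by eventually_elim (auto intro!: ennreal_leI power_mono)
    show "AE x in lborel. (\<lambda>n. ennreal ((cmod (f n x))\<^sup>2)) \<longlonglongrightarrow> ennreal 0"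
      using lim
    proof eventually_elim
      case (elim x)
      have "(\<lambda>n. (cmod (f n x))\<^sup>2) \<longlonglongrightarrow> (cmod 0)\<^sup>2" by (intro tendsto_intros elim)
      then show ?case by (intro tendsto_ennrealI) simp
    qed
  qed auto
  then show ?thesis by (simp add: nsq_def)
qed

lemma sqint_bounded_support:
  fixes f :: "real \<Rightarrow> complex"
  assumes [measurable]: "f \<in> borel_measurable borel"
    and b: "\<And>y. cmod (f y) \<le> B" and s: "\<And>y. \<bar>y\<bar> > R \<Longrightarrow> f y = 0"
  shows "sqint f"
proof -
  have "nsq f \<le> (\<integral>\<^sup>+y. ennreal (B\<^sup>2) * indicator {-R..R} y \<partial>lborel)"
    unfolding nsq_def
  proof (intro nn_integral_mono)
    fix y show "ennreal ((cmod (f y))\<^sup>2) \<le> ennreal (B\<^sup>2) * indicator {-R..R} y"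
      using b[of y] s[of y] by (cases "\<bar>y\<bar> > R") (auto simp: indicator_def intro!: ennreal_leI power_mono)
  qed
  also have "\<dots> < \<infinity>"
    by (simp add: nn_integral_cmult_indicator ennreal_mult_less_top) (simp add: emeasure_lborel_Icc_eq)
  finally show ?thesis by (simp add: sqint_def)
qed

text \<open>A square-integrable function is truncated in size and support; the truncation is an
  almost everywhere limit of continuous functions, which a cutoff factor makes uniformly bounded
  with common bounded support, so that dominated convergence applies.\<close>

lemma continuous_dense_sqint:
  fixes g :: "real \<Rightarrow> complex"
  assumes g: "sqint g" and e: "e > 0"
  shows "\<exists>h B R. continuous_on UNIV h \<and> (\<forall>y. cmod (h y) \<le> B) \<and> (\<forall>y. \<bar>y\<bar> > R \<longrightarrow> h y = 0) \<and>
     nsq (\<lambda>y. g y - h y) \<le> ennreal e"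
proof -
  have gm [measurable]: "g \<in> borel_measurable borel" using g by (auto simp: sqint_def)
  define f where "f n y = (if \<bar>y\<bar> \<le> real n \<and> cmod (g y) \<le> real n then g y else 0)" for n y
  have fm [measurable]: "f n \<in> borel_measurable borel" for n unfolding f_def by measurable
  have "(\<lambda>n. nsq (\<lambda>y. g y - f n y)) \<longlonglongrightarrow> 0"
  proof (rule nsq_tendsto_0_dominated[OF _ g])
    show "AE z in lborel. (\<lambda>n. g z - f n z) \<longlonglongrightarrow> 0"
    proof (rule AE_I2)
      fix z
      obtain N :: nat where N: "max \<bar>z\<bar> (cmod (g z)) \<le> real N" using real_arch_simple by blast
      have "eventually (\<lambda>n. g z - f n z = 0) sequentially"
        using N by (auto simp: eventually_sequentially f_def intro!: exI[of _ N])
      then show "(\<lambda>n. g z - f n z) \<longlonglongrightarrow> 0" by (rule tendsto_eventually)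
    qed
  qed (auto simp: f_def)
  from ennreal_tendsto_0D[OF this, of "e/4"] e
  obtain n where n: "nsq (\<lambda>y. g y - f n y) \<le> ennreal (e/4)" by (meson order_refl zero_less_divide_iff zero_less_numeral)
  define K where "K = real n + 1"
  have K: "K > 0" "\<And>y. cmod (f n y) \<le> K" "\<And>y. \<bar>y\<bar> > K \<Longrightarrow> f n y = 0" by (auto simp: K_def f_def)
  have "f n measurable_on UNIV"
    using fm[of n] by (intro lebesgue_measurable_imp_measurable_on measurable_completion) auto
  then obtain N and F where N: "negligible N" "\<And>k::nat. continuous_on UNIV (F k)"
    "\<And>y. y \<notin> N \<Longrightarrow> (\<lambda>k. F k y) \<longlonglongrightarrow> f n y"
    unfolding measurable_on_def by auto
  \<comment> \<open>The first factor cuts off in space beyond distance \<open>K\<close>, the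
    second retracts the values to the disc of radius \<open>K\<close>. Both are 1 at the values
    and on the support of \<open>f n\<close>.\<close>
  define H where "H k y = complex_of_real (max 0 (min 1 (K + 1 - \<bar>y\<bar>)) * (K / max K (cmod (F k y)))) * F k y" for k y
  have Hc: "continuous_on UNIV (H k)" for k
    unfolding H_def using K(1) by (intro continuous_intros N(2)) auto
  have HB: "cmod (H k y) \<le> K" for k y
  proof -
    have "K / max K (cmod (F k y)) * cmod (F k y) \<le> K"
      using K(1) by (auto simp: field_simps max_def mult_left_mono)
    moreover have "0 \<le> K / max K (cmod (F k y)) * cmod (F k y)" using K(1) by simp
    ultimately have "max 0 (min 1 (K + 1 - \<bar>y\<bar>)) * (K / max K (cmod (F k y)) * cmod (F k y)) \<le> 1 * K"
      using K(1) by (intro mult_mono) auto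
    then show ?thesis using K(1) by (simp add: H_def norm_mult abs_mult mult.assoc norm_divide)
  qed
  have Hs: "H k y = 0" if "\<bar>y\<bar> > K + 1" for k y using that by (simp add: H_def)
  have [measurable]: "H k \<in> borel_measurable borel" for k using Hc by (rule borel_measurable_continuous_onI)
  have AEN: "AE y in lborel. y \<notin> N"
    using N(1) by (metis AE_completion_iff AE_not_in completion.complete_sets_sandwich negligible_iff_null_sets completion.AE_iff_null_sets)
  have "(\<lambda>k. nsq (\<lambda>y. f n y - H k y)) \<longlonglongrightarrow> 0"
  proof (rule nsq_tendsto_0_dominated)
    show "sqint (\<lambda>y. complex_of_real (2 * K * indicator {-(K+1)..K+1} y))"
      by (rule sqint_bounded_support[where B="2*K" and R="K+1"]) (use K in \<open>auto simp: indicator_def\<close>)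
    show "AE z in lborel. cmod (f n z - H k z) \<le> cmod (complex_of_real (2 * K * indicator {-(K+1)..K+1} z))" for k
    proof (rule AE_I2)
      fix z
      show "cmod (f n z - H k z) \<le> cmod (complex_of_real (2 * K * indicator {-(K+1)..K+1} z))"
      proof (cases "\<bar>z\<bar> > K + 1")
        case True then show ?thesis using Hs K(3)[of z] by simp
      next
        case False
        have "cmod (f n z - H k z) \<le> 2 * K"
          using norm_triangle_ineq4[of "f n z" "H k z"] K(2)[of z] HB[of k z] by linarith
        with False K(1) show ?thesis by (auto simp: indicator_def)
      qed
    qed
    show "AE z in lborel. (\<lambda>k. f n z - H k z) \<longlonglongrightarrow> 0"
      using AEN
    proof eventually_elim
      case (elim z)
      have mx: "max K (cmod (f n z)) = K" using K(2)[of z] by simp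
      have "(\<lambda>k. H k z) \<longlonglongrightarrow> complex_of_real (max 0 (min 1 (K + 1 - \<bar>z\<bar>)) * (K / max K (cmod (f n z)))) * f n z"
        unfolding H_def using K(1) by (intro tendsto_intros N(3) elim) auto
      also have "complex_of_real (max 0 (min 1 (K + 1 - \<bar>z\<bar>)) * (K / max K (cmod (f n z)))) * f n z = f n z"
        using K(1) K(3)[of z] unfolding mx by (cases "\<bar>z\<bar> > K") auto
      finally have "(\<lambda>k. f n z - H k z) \<longlonglongrightarrow> f n z - f n z" by (intro tendsto_intros)
      then show ?case by simp
    qed
  qed auto
  from ennreal_tendsto_0D[OF this, of "e/4"] e
  obtain k where k: "nsq (\<lambda>y. f n y - H k y) \<le> ennreal (e/4)" by (meson order_refl zero_less_divide_iff zero_less_numeral)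
  have "nsq (\<lambda>y. g y - H k y) \<le> ennreal e"
    by (rule nsq_triangle_le[OF _ _ _ n k]) (use e in simp_all)
  then show ?thesis using Hc HB Hs by blast
qed

lemma nsq_translation_continuous:
  fixes g :: "real \<Rightarrow> complex"
  assumes g: "sqint g" and s: "s \<longlonglongrightarrow> 0"
  shows "(\<lambda>n. nsq (\<lambda>y. g (y + s n) - g y)) \<longlonglongrightarrow> 0"
proof (rule ennreal_tendsto_0I)
  fix e :: real assume e: "e > 0"
  have gm [measurable]: "g \<in> borel_measurable borel" using g by (auto simp: sqint_def)
  obtain h B R where h: "continuous_on UNIV h" "\<And>y. cmod (h y) \<le> B" "\<And>y. \<bar>y\<bar> > R \<Longrightarrow> h y = 0"
    "nsq (\<lambda>y. g y - h y) \<le> ennreal (e/12)"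
    using continuous_dense_sqint[OF g, of "e/12"] e by auto
  have hm [measurable]: "h \<in> borel_measurable borel" using h(1) by (rule borel_measurable_continuous_onI)
  obtain K where K: "\<And>n. \<bar>s n\<bar> \<le> K"
    using convergent_imp_Bseq[OF convergentI[OF s]] by (auto simp: Bseq_def)
  have B: "B \<ge> 0" using h(2)[of 0] norm_ge_zero order_trans by blast
  have "(\<lambda>n. nsq (\<lambda>y. h (y + s n) - h y)) \<longlonglongrightarrow> 0"
  proof (rule nsq_tendsto_0_dominated)
    show "sqint (\<lambda>y. complex_of_real (2 * B * indicator {-(R+K)..R+K} y))"
      by (rule sqint_bounded_support[where B="2*B" and R="R+K"]) (use B in \<open>auto simp: indicator_def\<close>)
    show "AE z in lborel. cmod (h (z + s n) - h z) \<le> cmod (complex_of_real (2 * B * indicator {-(R+K)..R+K} z))" for n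
    proof (rule AE_I2)
      fix z
      show "cmod (h (z + s n) - h z) \<le> cmod (complex_of_real (2 * B * indicator {-(R+K)..R+K} z))"
      proof (cases "\<bar>z\<bar> > R + K")
        case True then show ?thesis using h(3)[of z] h(3)[of "z + s n"] K[of n] by simp
      next
        case False
        have "cmod (h (z + s n) - h z) \<le> 2 * B"
          using norm_triangle_ineq4[of "h (z + s n)" "h z"] h(2)[of z] h(2)[of "z + s n"] by linarith
        with False B show ?thesis by (auto simp: indicator_def)
      qed
    qed
    show "AE z in lborel. (\<lambda>n. h (z + s n) - h z) \<longlonglongrightarrow> 0"
    proof (rule AE_I2)
      fix z
      have "(\<lambda>n. z + s n) \<longlonglongrightarrow> z + 0" by (intro tendsto_intros s)
      then have "(\<lambda>n. h (z + s n)) \<longlonglongrightarrow> h z"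
        using h(1) by (auto simp: continuous_on_eq_continuous_at isCont_def intro: isCont_tendsto_compose[of z h])
      then show "(\<lambda>n. h (z + s n) - h z) \<longlonglongrightarrow> 0" by (simp add: LIM_zero)
    qed
  qed auto
  from ennreal_tendsto_0D[OF this, of "e/12"] e
  obtain N where N: "\<And>n. n \<ge> N \<Longrightarrow> nsq (\<lambda>y. h (y + s n) - h y) \<le> ennreal (e/12)" by auto
  have "nsq (\<lambda>y. g (y + s n) - g y) \<le> ennreal e" if "n \<ge> N" for n
  proof -
    have 1: "nsq (\<lambda>y. g (y + s n) - h (y + s n)) \<le> ennreal (e/12)"
      using h(4) nsq_translate[of "\<lambda>y. g y - h y" "s n"] by simp
    have 2: "nsq (\<lambda>y. h y - g y) \<le> ennreal (e/12)" using h(4) by (subst nsq_diff_commute)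
    have 3: "nsq (\<lambda>y. h (y + s n) - g y) \<le> ennreal (e/3)"
      by (rule nsq_triangle_le[OF _ _ _ N[OF that] 2]) (use e in simp_all)
    show ?thesis by (rule nsq_triangle_le[OF _ _ _ 1 3]) (use e in simp_all)
  qed
  then show "\<exists>N. \<forall>n\<ge>N. nsq (\<lambda>y. g (y + s n) - g y) \<le> ennreal e" by blast
qed

lemma borel_measurable_cnj [measurable (raw)]:
  "f \<in> borel_measurable M \<Longrightarrow> (\<lambda>x. cnj (f x)) \<in> borel_measurable M"
  by (rule borel_measurable_continuous_on[where f=cnj]) (intro continuous_intros)

section \<open>Plancherel's theorem on the line\<close>

definition fourier_int :: "(real \<Rightarrow> complex) \<Rightarrow> real \<Rightarrow> complex" where
  "fourier_int g \<eta> = (1 / sqrt (2 * pi)) *\<^sub>R (LINT y|lborel. exp (- \<i> * of_real (y * \<eta>)) * g y)"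

lemma integrable_of_sqint_bounded_support:
  fixes g :: "real \<Rightarrow> complex"
  assumes g: "sqint g" and s: "\<And>y. \<bar>y\<bar> > R \<Longrightarrow> g y = 0"
  shows "integrable lborel g"
proof -
  have "sqint (\<lambda>y. indicator {-R..R} y :: complex)"
    by (rule sqint_bounded_support[where B=1 and R=R]) (auto simp: indicator_def)
  from sqint_mult_integrable[OF g this]
  have "integrable lborel (\<lambda>y. g y * indicator {-R..R} y)" .
  also have "(\<lambda>y. g y * indicator {-R..R} y) = g"
    using s by (force simp: indicator_def abs_le_iff not_le)
  finally show ?thesis .
qed

lemma integrable_prod_mult:
  fixes a b :: "real \<Rightarrow> complex"
  assumes a: "integrable lborel a" and b: "integrable lborel b"
  shows "integrable (lborel \<Otimes>\<^sub>M lborel) (\<lambda>z. a (fst z) * b (snd z))"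
    and "(LINT z|(lborel \<Otimes>\<^sub>M lborel). a (fst z) * b (snd z)) = (LINT y|lborel. a y) * (LINT y|lborel. b y)"
proof -
  have [measurable]: "a \<in> borel_measurable borel" "b \<in> borel_measurable borel"
    using a b by auto
  show 1: "integrable (lborel \<Otimes>\<^sub>M lborel) (\<lambda>z. a (fst z) * b (snd z))"
  proof (rule lborel_pair.Fubini_integrable)
    show "integrable lborel (\<lambda>x. LINT y|lborel. norm (a (fst (x, y)) * b (snd (x, y))))"
      using a by (simp add: norm_mult integrable_norm)
    show "AE x in lborel. integrable lborel (\<lambda>y. a (fst (x, y)) * b (snd (x, y)))"
      using b by simp
  qed measurable
  have "(LINT z|(lborel \<Otimes>\<^sub>M lborel). a (fst z) * b (snd z)) = (LINT x|lborel. LINT y|lborel. a x * b y)"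
    using lborel_pair.integral_fst'[OF 1] by simp
  then show "(LINT z|(lborel \<Otimes>\<^sub>M lborel). a (fst z) * b (snd z)) = (LINT y|lborel. a y) * (LINT y|lborel. b y)"
    by simp
qed

lemma fourier_int_measurable [measurable]:
  assumes [measurable]: "g \<in> borel_measurable borel"
  shows "fourier_int g \<in> borel_measurable borel"
  unfolding fourier_int_def by measurable

lemma integrable_exp_mult:
  fixes g :: "real \<Rightarrow> complex"
  assumes "integrable lborel g"
  shows "integrable lborel (\<lambda>y. exp (- \<i> * of_real (y * \<eta>)) * g y)"
proof (rule Bochner_Integration.integrable_bound[OF assms])
  have [measurable]: "g \<in> borel_measurable borel" using assms by auto
  show "(\<lambda>y. exp (- \<i> * of_real (y * \<eta>)) * g y) \<in> borel_measurable lborel" by measurable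
qed (simp add: norm_mult)

lemma gaussian_integral_exp:
  "(LINT \<xi>|std_normal_distribution. exp (\<i> * of_real (t * \<xi>))) = of_real (exp (- t\<^sup>2 / 2))"
  using char_std_normal_distribution by (simp add: char_def fun_eq_iff)

text \<open>The squared modulus of a Fourier integral is the double integral of \<open>g
  \<otimes> cnj g\<close> against a character of the difference of the two variables; a Gaussian
  average over the frequency can then be evaluated explicitly.\<close>

lemma fourier_int_cmod_sq:
  fixes g :: "real \<Rightarrow> complex"
  assumes g: "integrable lborel g"
  shows "of_real ((cmod (fourier_int g \<eta>))\<^sup>2) = (LINT z|(lborel \<Otimes>\<^sub>M lborel).
     exp (\<i> * of_real ((snd z - fst z) * \<eta>)) * (g (fst z) * cnj (g (snd z)))) / of_real (2 * pi)"
proof -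
  let ?a = "\<lambda>y. exp (- \<i> * of_real (y * \<eta>)) * g y"
  have i: "integrable lborel ?a" by (rule integrable_exp_mult[OF g])
  have j: "integrable lborel (\<lambda>y. cnj (?a y))" using i by (simp only: integrable_cnj)
  have c: "cnj (LINT y|lborel. ?a y) = (LINT y|lborel. cnj (?a y))"
    by (rule Bochner_Integration.integral_cnj[symmetric])
  have "of_real ((cmod (fourier_int g \<eta>))\<^sup>2) = fourier_int g \<eta> * cnj (fourier_int g \<eta>)"
    by (rule complex_norm_square)
  also have "\<dots> = (LINT y|lborel. ?a y) * cnj (LINT y|lborel. ?a y) / of_real (2 * pi)"
  proof -
    define s where "s = sqrt (2 * pi)"
    have s: "complex_of_real s * complex_of_real s = of_real (2 * pi)"
      unfolding s_def of_real_mult[symmetric] by simp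
    show ?thesis
      unfolding fourier_int_def s_def[symmetric] s[symmetric] by (simp add: scaleR_conv_of_real)
  qed
  also have "\<dots> = (LINT z|(lborel \<Otimes>\<^sub>M lborel). ?a (fst z) * cnj (?a (snd z))) / of_real (2 * pi)"
    unfolding c by (subst integrable_prod_mult(2)[OF i j]) simp
  also have "(\<lambda>z. ?a (fst z) * cnj (?a (snd z))) =
    (\<lambda>z. exp (\<i> * of_real ((snd z - fst z) * \<eta>)) * (g (fst z) * cnj (g (snd z))))"
  proof
    fix z :: "real \<times> real"
    have "exp (- \<i> * of_real (fst z * \<eta>)) * cnj (exp (- \<i> * of_real (snd z * \<eta>)))
      = exp (\<i> * of_real ((snd z - fst z) * \<eta>))"
      unfolding exp_cnj mult_exp_exp by (simp add: algebra_simps)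
    moreover have "(a * b) * cnj (c * d) = (a * cnj c) * (b * cnj d)" for a b c d :: complex
      by (simp add: ac_simps)
    ultimately show "?a (fst z) * cnj (?a (snd z)) = exp (\<i> * of_real ((snd z - fst z) * \<eta>)) * (g (fst z) * cnj (g (snd z)))"
      by presburger
  qed
  finally show ?thesis .
qed

lemma fourier_int_bounded:
  assumes g: "integrable lborel g"
  shows "cmod (fourier_int g \<eta>) \<le> (1 / sqrt (2 * pi)) * (LINT y|lborel. cmod (g y))"
  unfolding fourier_int_def using integral_norm_bound[of lborel "\<lambda>y. exp (- \<i> * of_real (y * \<eta>)) * g y"]
  by (simp add: norm_mult divide_right_mono)

lemma integrable_gaussian_fourier_int:
  assumes g: "integrable lborel g"
  shows "integrable std_normal_distribution (\<lambda>\<xi>. (cmod (fourier_int g (\<xi> / \<epsilon>)))\<^sup>2)"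
proof -
  have [measurable]: "g \<in> borel_measurable borel" using g by auto
  interpret N: prob_space std_normal_distribution by (rule prob_space_normal_density) simp
  show ?thesis
    by (rule N.integrable_const_bound[where B="((1 / sqrt (2 * pi)) * (LINT y|lborel. cmod (g y)))\<^sup>2"])
      (auto intro!: power_mono fourier_int_bounded[OF g, THEN order_trans] simp: abs_power2)
qed

text \<open>The identity behind Plancherel: averaging \<open>\<bar>fourier_int
  g\<bar>\<^sup>2\<close> over frequencies with a Gaussian of width \<open>1/\<epsilon>\<close>
  equals, up to normalization, averaging the autocorrelation of \<open>g\<close> with a Gaussian
  of width \<open>\<epsilon>\<close>. It follows from Fubini, since the Gaussian is its own
  characteristic function.\<close>

lemma gaussian_average_fourier_int:
  fixes g :: "real \<Rightarrow> complex"
  assumes g: "sqint g" and gi: "integrable lborel g" and e: "\<epsilon> > 0"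
  shows "of_real (LINT \<xi>|std_normal_distribution. (cmod (fourier_int g (\<xi> / \<epsilon>)))\<^sup>2)
    = of_real (\<epsilon> / sqrt (2 * pi)) * (LINT t|std_normal_distribution. LINT y|lborel. g y * cnj (g (y + \<epsilon> * t)))"
proof -
  have [measurable]: "g \<in> borel_measurable borel" using gi by auto
  interpret N: prob_space std_normal_distribution by (rule prob_space_normal_density) simp
  interpret P: sigma_finite_measure "lborel \<Otimes>\<^sub>M lborel :: (real \<times> real) measure"
    by (simp add: lborel_prod sigma_finite_lborel)
  interpret NP: pair_sigma_finite std_normal_distribution "lborel \<Otimes>\<^sub>M lborel :: (real \<times> real) measure"
    by (intro pair_sigma_finite.intro) unfold_locales
  let ?p = "\<lambda>z. g (fst z) * cnj (g (snd z))"
  have gc: "integrable lborel (\<lambda>y. cnj (g y))" using gi by (simp only: integrable_cnj)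
  note pint = integrable_prod_mult(1)[OF gi gc]
  let ?e = "\<lambda>\<xi> z. exp (\<i> * of_real ((snd z - fst z) * (\<xi> / \<epsilon>))) * ?p z :: complex"
  have ei: "integrable (std_normal_distribution \<Otimes>\<^sub>M (lborel \<Otimes>\<^sub>M lborel)) (\<lambda>(\<xi>, z). ?e \<xi> z)"
  proof (rule NP.Fubini_integrable)
    show "integrable std_normal_distribution (\<lambda>\<xi>. LINT z|(lborel \<Otimes>\<^sub>M lborel). norm (case (\<xi>, z) of (\<xi>, z) \<Rightarrow> ?e \<xi> z))"
      by (simp add: norm_mult)
    show "AE \<xi> in std_normal_distribution. integrable (lborel \<Otimes>\<^sub>M lborel) (\<lambda>z. case (\<xi>, z) of (\<xi>, z) \<Rightarrow> ?e \<xi> z)"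
    proof (rule AE_I2)
      fix \<xi>
      have "integrable (lborel \<Otimes>\<^sub>M lborel) (?e \<xi>)"
      proof (rule Bochner_Integration.integrable_bound[OF pint])
        show "?e \<xi> \<in> borel_measurable (lborel \<Otimes>\<^sub>M lborel)" by measurable
      qed (simp add: norm_mult)
      then show "integrable (lborel \<Otimes>\<^sub>M lborel) (\<lambda>z. case (\<xi>, z) of (\<xi>, z) \<Rightarrow> ?e \<xi> z)" by simp
    qed
  qed measurable
  have "of_real (LINT \<xi>|std_normal_distribution. (cmod (fourier_int g (\<xi> / \<epsilon>)))\<^sup>2)
    = (LINT \<xi>|std_normal_distribution. complex_of_real ((cmod (fourier_int g (\<xi> / \<epsilon>)))\<^sup>2))"
    by (rule integral_of_real[OF integrable_gaussian_fourier_int[OF gi], symmetric])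
  also have "\<dots> = (LINT \<xi>|std_normal_distribution. (LINT z|(lborel \<Otimes>\<^sub>M lborel). ?e \<xi> z)) / of_real (2 * pi)"
    by (simp only: fourier_int_cmod_sq[OF gi] integral_divide_zero)
  also have "(LINT \<xi>|std_normal_distribution. (LINT z|(lborel \<Otimes>\<^sub>M lborel). ?e \<xi> z))
    = (LINT z|(lborel \<Otimes>\<^sub>M lborel). (LINT \<xi>|std_normal_distribution. ?e \<xi> z))"
    by (rule NP.Fubini_integral[symmetric, OF ei])
  \<comment> \<open>The inner integral is the characteristic function of the standard normal
    distribution at \<open>(snd z - fst z) / \<epsilon>\<close>.\<close>
  also have "\<dots> = (LINT z|(lborel \<Otimes>\<^sub>M lborel). of_real (exp (- ((snd z - fst z) / \<epsilon>)\<^sup>2 / 2)) * ?p z)"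
  proof (rule Bochner_Integration.integral_cong[OF refl])
    fix z :: "real \<times> real"
    have "(LINT \<xi>|std_normal_distribution. ?e \<xi> z)
      = (LINT \<xi>|std_normal_distribution. exp (\<i> * of_real ((snd z - fst z) / \<epsilon> * \<xi>))) * ?p z"
      by (subst integral_mult_left_zero[symmetric]) (simp add: field_simps)
    then show "(LINT \<xi>|std_normal_distribution. ?e \<xi> z) = of_real (exp (- ((snd z - fst z) / \<epsilon>)\<^sup>2 / 2)) * ?p z"
      by (simp only: gaussian_integral_exp)
  qed
  also have "\<dots> = (LINT y|lborel. LINT y'|lborel. of_real (exp (- ((y' - y) / \<epsilon>)\<^sup>2 / 2)) * (g y * cnj (g y')))"
  proof -
    have "integrable (lborel \<Otimes>\<^sub>M lborel) (\<lambda>z. of_real (exp (- ((snd z - fst z) / \<epsilon>)\<^sup>2 / 2)) * ?p z)"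
      by (rule Bochner_Integration.integrable_bound[OF pint])
        (auto simp: norm_mult intro!: mult_left_le_one_le)
    from lborel_pair.integral_fst'[OF this] show ?thesis by simp
  qed
  \<comment> \<open>Substitution \<open>y' = y + \<epsilon> t\<close>.\<close>
  also have "\<dots> = (LINT y|lborel. LINT t|lborel. \<epsilon> *\<^sub>R (of_real (exp (- t\<^sup>2 / 2)) * (g y * cnj (g (y + \<epsilon> * t)))))"
  proof (rule Bochner_Integration.integral_cong[OF refl])
    fix y
    show "(LINT y'|lborel. of_real (exp (- ((y' - y) / \<epsilon>)\<^sup>2 / 2)) * (g y * cnj (g y')))
      = (LINT t|lborel. \<epsilon> *\<^sub>R (of_real (exp (- t\<^sup>2 / 2)) * (g y * cnj (g (y + \<epsilon> * t)))))"
      using e by (subst lborel_integral_real_affine[where c=\<epsilon> and t=y]) auto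
  qed
  also have "\<dots> = (LINT t|lborel. LINT y|lborel. \<epsilon> *\<^sub>R (of_real (exp (- t\<^sup>2 / 2)) * (g y * cnj (g (y + \<epsilon> * t)))))"
  proof (rule lborel_pair.Fubini_integral)
    show "integrable (lborel \<Otimes>\<^sub>M lborel) (\<lambda>(t, y). \<epsilon> *\<^sub>R (of_real (exp (- t\<^sup>2 / 2)) * (g y * cnj (g (y + \<epsilon> * t)))))"
    proof (rule integrableI_bounded)
      have "(\<integral>\<^sup>+z. ennreal (norm (case z of (t, y) \<Rightarrow> \<epsilon> *\<^sub>R (of_real (exp (- t\<^sup>2 / 2)) * (g y * cnj (g (y + \<epsilon> * t)))))) \<partial>(lborel \<Otimes>\<^sub>M lborel))
        = (\<integral>\<^sup>+y. \<integral>\<^sup>+t. ennreal (cmod (g y)) * (ennreal \<epsilon> * ennreal (exp (- t\<^sup>2 / 2) * cmod (g (y + \<epsilon> * t)))) \<partial>lborel \<partial>lborel)"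
        using e by (subst lborel_pair.nn_integral_snd[symmetric])
          (auto simp: norm_mult ennreal_mult mult_ac intro!: nn_integral_cong)
      also have "\<dots> \<le> (\<integral>\<^sup>+y. \<integral>\<^sup>+t. ennreal (cmod (g y)) * (ennreal \<epsilon> * ennreal (cmod (g (y + \<epsilon> * t)))) \<partial>lborel \<partial>lborel)"
        by (intro nn_integral_mono mult_left_mono ennreal_leI mult_left_le_one_le) auto
      also have "\<dots> = (\<integral>\<^sup>+y. ennreal (cmod (g y)) * (\<integral>\<^sup>+t. ennreal (cmod (g t)) \<partial>lborel) \<partial>lborel)"
      proof (rule nn_integral_cong)
        fix y
        show "(\<integral>\<^sup>+t. ennreal (cmod (g y)) * (ennreal \<epsilon> * ennreal (cmod (g (y + \<epsilon> * t)))) \<partial>lborel)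
          = ennreal (cmod (g y)) * (\<integral>\<^sup>+t. ennreal (cmod (g t)) \<partial>lborel)"
          using e by (subst (2) nn_integral_real_affine[where c=\<epsilon> and t=y]) (auto simp: nn_integral_cmult)
      qed
      also have "\<dots> < \<infinity>"
        using gi by (simp add: nn_integral_multc integrable_iff_bounded ennreal_mult_less_top)
      finally show "(\<integral>\<^sup>+z. ennreal (norm (case z of (t, y) \<Rightarrow> \<epsilon> *\<^sub>R (of_real (exp (- t\<^sup>2 / 2)) * (g y * cnj (g (y + \<epsilon> * t)))))) \<partial>(lborel \<Otimes>\<^sub>M lborel)) < \<infinity>" .
    qed measurable
  qed
  also have "\<dots> = (LINT t|lborel. std_normal_density t *\<^sub>R (of_real (\<epsilon> * sqrt (2 * pi)) * (LINT y|lborel. g y * cnj (g (y + \<epsilon> * t)))))"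
  proof (rule Bochner_Integration.integral_cong[OF refl])
    fix t
    have d: "exp (- t\<^sup>2 / 2) = std_normal_density t * sqrt (2 * pi)"
      by (simp add: std_normal_density_def)
    show "(LINT y|lborel. \<epsilon> *\<^sub>R (of_real (exp (- t\<^sup>2 / 2)) * (g y * cnj (g (y + \<epsilon> * t)))))
      = std_normal_density t *\<^sub>R (of_real (\<epsilon> * sqrt (2 * pi)) * (LINT y|lborel. g y * cnj (g (y + \<epsilon> * t))))"
    proof -
      have "(LINT y|lborel. \<epsilon> *\<^sub>R (of_real (exp (- t\<^sup>2 / 2)) * (g y * cnj (g (y + \<epsilon> * t)))))
        = (LINT y|lborel. of_real (\<epsilon> * exp (- t\<^sup>2 / 2)) * (g y * cnj (g (y + \<epsilon> * t))))"
        by (simp only: scaleR_conv_of_real of_real_mult mult.assoc)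
      also have "\<dots> = of_real (\<epsilon> * exp (- t\<^sup>2 / 2)) * (LINT y|lborel. g y * cnj (g (y + \<epsilon> * t)))"
        by (rule integral_mult_right_zero)
      also have "\<epsilon> * exp (- t\<^sup>2 / 2) = std_normal_density t * (\<epsilon> * sqrt (2 * pi))"
        by (simp only: d mult.left_commute)
      finally show ?thesis by (simp only: scaleR_conv_of_real of_real_mult mult.assoc)
    qed
  qed
  also have "\<dots> = (LINT t|std_normal_distribution. of_real (\<epsilon> * sqrt (2 * pi)) * (LINT y|lborel. g y * cnj (g (y + \<epsilon> * t))))"
  proof (rule integral_density[symmetric])
    show "(\<lambda>t. of_real (\<epsilon> * sqrt (2 * pi)) * (LINT y|lborel. g y * cnj (g (y + \<epsilon> * t)))) \<in> borel_measurable lborel"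
      by measurable
    show "(\<lambda>t. std_normal_density t) \<in> borel_measurable lborel" by measurable
    show "AE t in lborel. 0 \<le> std_normal_density t" by (rule AE_I2) (rule normal_density_nonneg)
  qed
  also have "\<dots> = of_real (\<epsilon> * sqrt (2 * pi)) * (LINT t|std_normal_distribution. LINT y|lborel. g y * cnj (g (y + \<epsilon> * t)))"
    by simp
  finally have "of_real (LINT \<xi>|std_normal_distribution. (cmod (fourier_int g (\<xi> / \<epsilon>)))\<^sup>2)
    = of_real (\<epsilon> * sqrt (2 * pi) / (2 * pi)) * (LINT t|std_normal_distribution. LINT y|lborel. g y * cnj (g (y + \<epsilon> * t)))"
    by (simp only: of_real_divide times_divide_eq_left)
  moreover have "\<epsilon> * sqrt (2 * pi) / (2 * pi) = \<epsilon> / sqrt (2 * pi)"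
    by (simp add: divide_eq_eq eq_divide_eq)
  ultimately show ?thesis by simp
qed

lemma autocorrelation_continuous:
  fixes g :: "real \<Rightarrow> complex"
  assumes g: "sqint g" and s: "s \<longlonglongrightarrow> 0"
  shows "(\<lambda>n. LINT y|lborel. g y * cnj (g (y + s n))) \<longlonglongrightarrow> (LINT y|lborel. g y * cnj (g y))"
proof (rule CS_tendsto[OF g])
  note [measurable] = sqint_measurable[OF g]
  have cn: "sqint (\<lambda>y. cnj (f y))" if "sqint f" for f :: "real \<Rightarrow> complex"
    using that by (auto simp: sqint_iff_integrable)
  show "sqint (\<lambda>y. cnj (g (y + s n)))" "sqint (\<lambda>y. cnj (g y))" for n using g by (auto intro: cn)
  have "nsq (\<lambda>y. cnj (g (y + s n)) - cnj (g y)) = nsq (\<lambda>y. g (y + s n) - g y)" for n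
    unfolding nsq_def complex_cnj_diff[symmetric] complex_mod_cnj ..
  then show "(\<lambda>n. nsq (\<lambda>y. cnj (g (y + s n)) - cnj (g y))) \<longlonglongrightarrow> 0"
    using nsq_translation_continuous[OF g s] by simp
qed

text \<open>As the width \<open>\<epsilon>\<close> of the Gaussian tends to 0, the frequency side
  of \<open>gaussian_average_fourier_int\<close> increases to the squared norm of the transform,
  and the space side tends to the autocorrelation at 0, which is the squared norm of
  \<open>g\<close>.\<close>

lemma plancherel_1d:
  fixes g :: "real \<Rightarrow> complex"
  assumes g: "sqint g" and gi: "integrable lborel g"
  shows "nsq (fourier_int g) = nsq g"
proof -
  have [measurable]: "g \<in> borel_measurable borel" using g by (auto simp: sqint_def)
  interpret N: prob_space std_normal_distribution by (rule prob_space_normal_density) simp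
  define e where "e n = 1 / real (Suc n)" for n
  have e: "e n > 0" "e \<longlonglongrightarrow> 0" for n
    unfolding e_def using LIMSEQ_inverse_real_of_nat by (auto simp: inverse_eq_divide)
  define H where "H n t = (LINT y|lborel. g y * cnj (g (y + e n * t)))" for n t
  have Hm [measurable]: "H n \<in> borel_measurable borel" for n unfolding H_def by measurable
  define G where "G = (LINT y|lborel. (cmod (g y))\<^sup>2)"
  have G: "nsq g = ennreal G" "G \<ge> 0" unfolding G_def using nsq_eq_integral[OF g] by auto
  have Hb: "cmod (H n t) \<le> G" for n t
  proof -
    have "sqint (\<lambda>y. cnj (g (y + e n * t)))"
      using sqint_translate[OF g, of "e n * t"] by (auto simp: sqint_iff_integrable)
    from CS_integral[OF g this] have "ennreal ((cmod (H n t))\<^sup>2) \<le> nsq g * nsq (\<lambda>y. cnj (g (y + e n * t)))"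
      by (simp add: H_def)
    also have "nsq (\<lambda>y. cnj (g (y + e n * t))) = nsq (\<lambda>y. g (y + e n * t))"
      unfolding nsq_def by (simp only: complex_mod_cnj)
    also have "\<dots> = nsq g" by (rule nsq_translate) auto
    also have "nsq g * nsq g = ennreal (G\<^sup>2)" using G by (simp add: ennreal_mult power2_eq_square)
    finally have "(cmod (H n t))\<^sup>2 \<le> G\<^sup>2" using G by simp
    then show ?thesis using G(2) by (rule power2_le_imp_le)
  qed
  have lim: "(\<lambda>n. LINT t|std_normal_distribution. H n t) \<longlonglongrightarrow> (LINT t|std_normal_distribution. complex_of_real G)"
  proof (rule integral_dominated_convergence[where w="\<lambda>_. G"])
    show "AE t in std_normal_distribution. (\<lambda>n. H n t) \<longlonglongrightarrow> complex_of_real G"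
    proof (rule AE_I2)
      fix t
      have "(\<lambda>n. H n t) \<longlonglongrightarrow> (LINT y|lborel. g y * cnj (g y))"
        unfolding H_def using tendsto_mult_right[OF e(2), of t]
        by (intro autocorrelation_continuous g) simp
      also have "(LINT y|lborel. g y * cnj (g y)) = complex_of_real G"
        unfolding G_def using g
        by (simp only: complex_norm_square[symmetric] integral_of_real sqint_iff_integrable)
      finally show "(\<lambda>n. H n t) \<longlonglongrightarrow> complex_of_real G" .
    qed
  qed (use Hb in auto)
  \<comment> \<open>\<open>L n\<close> is the regularized frequency side; it is computed from the
    Gaussian average and converges by monotone convergence.\<close>
  define L where "L n = (\<integral>\<^sup>+\<eta>. ennreal ((cmod (fourier_int g \<eta>))\<^sup>2 * exp (- (e n * \<eta>)\<^sup>2 / 2)) \<partial>lborel)" for n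
  have L: "L n = ennreal (Re (LINT t|std_normal_distribution. H n t))" for n
  proof -
    let ?F = "\<lambda>\<xi>. (cmod (fourier_int g (\<xi> / e n)))\<^sup>2"
    note int = integrable_gaussian_fourier_int[OF gi, of "e n"]
    have "L n = ennreal (inverse (e n)) * (\<integral>\<^sup>+\<xi>. ennreal (?F \<xi> * exp (- \<xi>\<^sup>2 / 2)) \<partial>lborel)"
      unfolding L_def using e(1)[of n]
      by (subst nn_integral_real_affine[where c="inverse (e n)" and t=0]) (auto simp: field_simps)
    also have "(\<integral>\<^sup>+\<xi>. ennreal (?F \<xi> * exp (- \<xi>\<^sup>2 / 2)) \<partial>lborel)
      = (\<integral>\<^sup>+\<xi>. ennreal (sqrt (2 * pi)) * (ennreal (std_normal_density \<xi>) * ennreal (?F \<xi>)) \<partial>lborel)"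
      by (intro nn_integral_cong) (simp add: std_normal_density_def mult.commute flip: ennreal_mult)
    also have "\<dots> = ennreal (sqrt (2 * pi)) * (\<integral>\<^sup>+\<xi>. ennreal (?F \<xi>) \<partial>std_normal_distribution)"
      by (simp add: nn_integral_cmult nn_integral_density)
    also have "(\<integral>\<^sup>+\<xi>. ennreal (?F \<xi>) \<partial>std_normal_distribution) = ennreal (LINT \<xi>|std_normal_distribution. ?F \<xi>)"
      by (rule nn_integral_eq_integral[OF int]) simp
    also have "(LINT \<xi>|std_normal_distribution. ?F \<xi>) = e n / sqrt (2 * pi) * Re (LINT t|std_normal_distribution. H n t)"
    proof -
      have "(LINT \<xi>|std_normal_distribution. ?F \<xi>)
        = Re (of_real (e n / sqrt (2 * pi)) * (LINT t|std_normal_distribution. H n t))"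
        unfolding H_def gaussian_average_fourier_int[OF g gi e(1)[of n], symmetric] by (simp only: Re_complex_of_real)
      then show ?thesis by simp
    qed
    finally have "L n = ennreal (inverse (e n)) * (ennreal (sqrt (2 * pi)) * ennreal (e n / sqrt (2 * pi) * Re (LINT t|std_normal_distribution. H n t)))" .
    also have "\<dots> = ennreal (inverse (e n) * (sqrt (2 * pi) * (e n / sqrt (2 * pi) * Re (LINT t|std_normal_distribution. H n t))))"
      using e(1)[of n] by (simp only: ennreal_mult' real_sqrt_ge_zero pi_ge_zero inverse_nonnegative_iff_nonnegative less_imp_le mult_nonneg_nonneg zero_le_numeral)
    also have "inverse (e n) * (sqrt (2 * pi) * (e n / sqrt (2 * pi) * Re (LINT t|std_normal_distribution. H n t))) = Re (LINT t|std_normal_distribution. H n t)"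
      using e(1)[of n] by (simp add: field_simps)
    finally show ?thesis .
  qed
  have "(\<lambda>n. Re (LINT t|std_normal_distribution. H n t)) \<longlonglongrightarrow> Re (LINT t|std_normal_distribution. complex_of_real G)"
    by (intro tendsto_intros lim)
  then have "L \<longlonglongrightarrow> ennreal G"
    unfolding L using N.prob_space by (intro tendsto_ennrealI) simp
  moreover have "L \<longlonglongrightarrow> nsq (fourier_int g)"
    unfolding L_def nsq_def
  proof (rule nn_integral_LIMSEQ)
    show "incseq (\<lambda>n \<eta>. ennreal ((cmod (fourier_int g \<eta>))\<^sup>2 * exp (- (e n * \<eta>)\<^sup>2 / 2)))"
    proof (intro incseq_SucI le_funI ennreal_leI mult_left_mono)
      fix n \<eta>
      have "e (Suc n) \<le> e n" unfolding e_def by (intro divide_left_mono) auto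
      then have "\<bar>e (Suc n) * \<eta>\<bar> \<le> \<bar>e n * \<eta>\<bar>"
        using e(1)[of n] e(1)[of "Suc n"] by (simp add: abs_mult mult_right_mono)
      then have "(e (Suc n) * \<eta>)\<^sup>2 \<le> (e n * \<eta>)\<^sup>2" by (rule abs_le_square_iff[THEN iffD1])
      then show "exp (- (e n * \<eta>)\<^sup>2 / 2) \<le> exp (- (e (Suc n) * \<eta>)\<^sup>2 / 2)" by simp
    qed auto
    show "(\<lambda>n. ennreal ((cmod (fourier_int g \<eta>))\<^sup>2 * exp (- (e n * \<eta>)\<^sup>2 / 2))) \<longlonglongrightarrow> ennreal ((cmod (fourier_int g \<eta>))\<^sup>2)" for \<eta>
    proof -
      have "(\<lambda>n. (cmod (fourier_int g \<eta>))\<^sup>2 * exp (- (e n * \<eta>)\<^sup>2 / 2)) \<longlonglongrightarrow> (cmod (fourier_int g \<eta>))\<^sup>2 * exp (- (0 * \<eta>)\<^sup>2 / 2)"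
        by (intro tendsto_intros e(2)) auto
      then show ?thesis by (intro tendsto_ennrealI) simp
    qed
  qed measurable
  ultimately show ?thesis using LIMSEQ_unique G(1) by metis
qed

section \<open>The Fourier transform in the second variable\<close>

lemma fst_snd_borel_measurable [measurable]:
  "(\<lambda>z. fst z) \<in> borel_measurable (borel :: (real \<times> real) measure)"
  "(\<lambda>z. snd z) \<in> borel_measurable (borel :: (real \<times> real) measure)"
  by (intro borel_measurable_continuous_onI continuous_intros)+

definition fourier_int_y :: "(real \<times> real \<Rightarrow> complex) \<Rightarrow> real \<times> real \<Rightarrow> complex" where
  "fourier_int_y u = (\<lambda>(x, \<eta>). fourier_int (\<lambda>y. u (x, y)) \<eta>)"

text \<open>Windows \<open>{a..b}\<close> that are not symmetric about 0 occur because a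
  translation in \<open>y\<close> moves the symmetric windows of the definition of the transform.\<close>

definition cut_y :: "real set \<Rightarrow> (real \<times> real \<Rightarrow> complex) \<Rightarrow> real \<times> real \<Rightarrow> complex" where
  "cut_y W u z = indicator W (snd z) * u z"

lemma cut_y_measurable [measurable]:
  assumes [measurable]: "W \<in> sets borel" "u \<in> borel_measurable borel"
  shows "cut_y W u \<in> borel_measurable borel"
  unfolding cut_y_def by measurable

lemma fourier_y_trunc_eq: "fourier_y_trunc R u = fourier_int_y (cut_y {-R..R} u)"
proof -
  have "indicator {-R..R} y *\<^sub>R (exp (- \<i> * of_real (y * \<eta>)) * u (x, y))
    = exp (- \<i> * of_real (y * \<eta>)) * (indicator {-R..R} y * u (x, y))" for x y \<eta>
    by (simp add: indicator_def)
  then show ?thesis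
    unfolding fourier_y_trunc_def fourier_int_y_def fourier_int_def cut_y_def set_lebesgue_integral_def by simp
qed

lemma fourier_int_y_measurable [measurable]:
  assumes [measurable]: "u \<in> borel_measurable borel"
  shows "fourier_int_y u \<in> borel_measurable borel"
proof -
  have [measurable]: "u \<in> borel_measurable (borel \<Otimes>\<^sub>M borel)" using assms by (simp add: borel_prod)
  have "fourier_int_y u \<in> borel_measurable (borel \<Otimes>\<^sub>M borel)"
    unfolding fourier_int_y_def fourier_int_def by measurable
  then show ?thesis by (simp add: borel_prod)
qed

lemma nsq_slices:
  fixes u :: "real \<times> real \<Rightarrow> complex"
  assumes "u \<in> borel_measurable borel"
  shows "nsq u = (\<integral>\<^sup>+x. nsq (\<lambda>y. u (x, y)) \<partial>lborel)"
proof -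
  have [measurable]: "u \<in> borel_measurable (borel \<Otimes>\<^sub>M borel)" using assms by (simp add: borel_prod)
  show ?thesis unfolding nsq_def lborel_prod[symmetric]
    by (subst lborel.nn_integral_fst[symmetric]) auto
qed

lemma slice_measurable [measurable]:
  fixes u :: "real \<times> real \<Rightarrow> complex"
  assumes "u \<in> borel_measurable borel"
  shows "(\<lambda>y. u (x, y)) \<in> borel_measurable borel"
proof -
  have [measurable]: "u \<in> borel_measurable (borel \<Otimes>\<^sub>M borel)" using assms by (simp add: borel_prod)
  show ?thesis by measurable
qed

lemma AE_sqint_slice:
  fixes u :: "real \<times> real \<Rightarrow> complex"
  assumes "sqint u"
  shows "AE x in lborel. sqint (\<lambda>y. u (x, y))"
proof -
  have um [measurable]: "u \<in> borel_measurable (borel \<Otimes>\<^sub>M borel)" "u \<in> borel_measurable borel"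
    using assms by (auto simp: sqint_def borel_prod)
  have [measurable]: "(\<lambda>x. nsq (\<lambda>y. u (x, y))) \<in> borel_measurable lborel" unfolding nsq_def by measurable
  have "AE x in lborel. nsq (\<lambda>y. u (x, y)) \<noteq> \<infinity>"
    using assms by (intro nn_integral_PInf_AE) (auto simp: sqint_def nsq_slices)
  then show ?thesis by eventually_elim (auto simp: sqint_def less_top)
qed

lemma AE_fst_lborel:
  assumes "AE x in lborel. P x"
  shows "AE z in (lborel :: (real \<times> real) measure). P (fst z)"
proof -
  obtain N where N: "{x \<in> space lborel. \<not> P x} \<subseteq> N" "N \<in> null_sets lborel"
    using assms by (auto elim!: AE_E3 simp: eventually_ae_filter)
  have "emeasure (lborel \<Otimes>\<^sub>M lborel) (N \<times> (UNIV :: real set)) = emeasure lborel N * emeasure lborel (UNIV :: real set)"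
    using N by (intro lborel.emeasure_pair_measure_Times) auto
  also have "\<dots> = 0" using N by auto
  finally have "N \<times> UNIV \<in> null_sets (lborel :: (real \<times> real) measure)"
    using N by (auto simp: null_sets_def lborel_prod borel_Times)
  from AE_not_in[OF this] show ?thesis using N by (auto elim!: eventually_mono)
qed

text \<open>Plancherel's theorem on almost every line parallel to the \<open>y\<close> axis.\<close>

lemma nsq_fourier_int_y:
  assumes u: "sqint u" and s: "\<And>z. \<bar>snd z\<bar> > R \<Longrightarrow> u z = 0"
  shows "nsq (fourier_int_y u) = nsq u"
proof -
  have [measurable]: "u \<in> borel_measurable borel" using u by (auto simp: sqint_def)
  have "nsq (fourier_int_y u) = (\<integral>\<^sup>+x. nsq (fourier_int (\<lambda>y. u (x, y))) \<partial>lborel)"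
  proof -
    have "(\<lambda>\<eta>. fourier_int_y u (x, \<eta>)) = fourier_int (\<lambda>y. u (x, y))" for x by (simp add: fourier_int_y_def fun_eq_iff)
    then show ?thesis using nsq_slices[of "fourier_int_y u"] by simp
  qed
  also have "\<dots> = (\<integral>\<^sup>+x. nsq (\<lambda>y. u (x, y)) \<partial>lborel)"
  proof (rule nn_integral_cong_AE)
    show "AE x in lborel. nsq (fourier_int (\<lambda>y. u (x, y))) = nsq (\<lambda>y. u (x, y))"
      using AE_sqint_slice[OF u]
    proof eventually_elim
      case (elim x)
      show ?case
        by (rule plancherel_1d[OF elim integrable_of_sqint_bounded_support[OF elim]]) (use s in auto)
    qed
  qed
  also have "\<dots> = nsq u" by (simp add: nsq_slices)
  finally show ?thesis .
qed

lemma sqint_fourier_int_y: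
  assumes u: "sqint u" and s: "\<And>z. \<bar>snd z\<bar> > R \<Longrightarrow> u z = 0"
  shows "sqint (fourier_int_y u)"
  using u nsq_fourier_int_y[OF u s] by (auto simp: sqint_def)

lemma fourier_int_y_lincomb_AE:
  assumes u: "sqint u" "\<And>z. \<bar>snd z\<bar> > R \<Longrightarrow> u z = 0"
    and v: "sqint v" "\<And>z. \<bar>snd z\<bar> > R \<Longrightarrow> v z = 0"
  shows "AE z in lborel. fourier_int_y (\<lambda>z. a * u z + b * v z) z = a * fourier_int_y u z + b * fourier_int_y v z"
proof -
  have "AE x in lborel. \<forall>\<eta>. fourier_int_y (\<lambda>z. a * u z + b * v z) (x, \<eta>) = a * fourier_int_y u (x, \<eta>) + b * fourier_int_y v (x, \<eta>)"
    using AE_sqint_slice[OF u(1)] AE_sqint_slice[OF v(1)]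
  proof eventually_elim
    case (elim x)
    have iu: "integrable lborel (\<lambda>y. u (x, y))"
      by (rule integrable_of_sqint_bounded_support[OF elim(1)]) (use u in auto)
    have iv: "integrable lborel (\<lambda>y. v (x, y))"
      by (rule integrable_of_sqint_bounded_support[OF elim(2)]) (use v in auto)
    show ?case
    proof
      fix \<eta>
      let ?E = "\<lambda>y. exp (- \<i> * of_real (y * \<eta>))"
      have "(LINT y|lborel. ?E y * (a * u (x, y) + b * v (x, y)))
        = (LINT y|lborel. a * (?E y * u (x, y)) + b * (?E y * v (x, y)))"
        by (simp only: distrib_left mult.left_commute)
      also have "\<dots> = a * (LINT y|lborel. ?E y * u (x, y)) + b * (LINT y|lborel. ?E y * v (x, y))"
        using integrable_exp_mult[OF iu, of \<eta>] integrable_exp_mult[OF iv, of \<eta>] by simp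
      finally show "fourier_int_y (\<lambda>z. a * u z + b * v z) (x, \<eta>) = a * fourier_int_y u (x, \<eta>) + b * fourier_int_y v (x, \<eta>)"
        unfolding fourier_int_y_def fourier_int_def by (simp only: prod.case scaleR_add_right mult_scaleR_right)
    qed
  qed
  from AE_fst_lborel[OF this] show ?thesis by (auto elim!: eventually_mono)
qed

lemma sqint_cut_y:
  assumes "sqint u" "W \<in> sets borel" shows "sqint (cut_y W u)"
  using assms by (intro sqint_mono[OF assms(1)]) (auto simp: cut_y_def indicator_def sqint_def)

lemma nsq_cut_y_diff:
  assumes u: "sqint u" and W: "W \<in> sets borel" "W \<subseteq> {-R..R}" "V \<in> sets borel" "V \<subseteq> {-R..R}"
  shows "nsq (\<lambda>z. fourier_int_y (cut_y W u) z - fourier_int_y (cut_y V u) z) = nsq (\<lambda>z. cut_y W u z - cut_y V u z)"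
proof -
  have z: "\<And>z. \<bar>snd z\<bar> > R \<Longrightarrow> cut_y W u z = 0" "\<And>z. \<bar>snd z\<bar> > R \<Longrightarrow> cut_y V u z = 0"
    using W by (auto simp: cut_y_def indicator_def dest!: subsetD)
  have "AE z in lborel. fourier_int_y (cut_y W u) z - fourier_int_y (cut_y V u) z = fourier_int_y (\<lambda>z. 1 * cut_y W u z + (-1) * cut_y V u z) z"
    using fourier_int_y_lincomb_AE[OF sqint_cut_y[OF u W(1)] z(1) sqint_cut_y[OF u W(3)] z(2), where a=1 and b="-1" and R=R]
    by (auto elim!: eventually_mono)
  then have "nsq (\<lambda>z. fourier_int_y (cut_y W u) z - fourier_int_y (cut_y V u) z) = nsq (fourier_int_y (\<lambda>z. 1 * cut_y W u z + (-1) * cut_y V u z))"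
    by (rule nsq_cong_AE)
  also have "\<dots> = nsq (\<lambda>z. 1 * cut_y W u z + (-1) * cut_y V u z)"
    by (rule nsq_fourier_int_y[where R=R]) (use z in \<open>auto intro!: sqint_add sqint_cmult sqint_cut_y u W\<close>)
  finally show ?thesis by simp
qed

lemma cut_y_tail:
  assumes u: "sqint u" and e: "e > 0"
  shows "\<exists>r\<ge>0. nsq (\<lambda>z. u z - cut_y {-r..r} u z) \<le> ennreal e"
proof -
  have [measurable]: "u \<in> borel_measurable borel" using u by (auto simp: sqint_def)
  have "(\<lambda>n. nsq (\<lambda>z. u z - cut_y {-real n..real n} u z)) \<longlonglongrightarrow> 0"
  proof (rule nsq_tendsto_0_dominated[OF _ u])
    show "AE z in lborel. (\<lambda>n. u z - cut_y {-real n..real n} u z) \<longlonglongrightarrow> 0"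
    proof (rule AE_I2)
      fix z :: "real \<times> real"
      obtain N :: nat where N: "\<bar>snd z\<bar> \<le> real N" using real_arch_simple by blast
      have "eventually (\<lambda>n. u z - cut_y {-real n..real n} u z = 0) sequentially"
        using N by (auto simp: eventually_sequentially cut_y_def indicator_def intro!: exI[of _ N])
      then show "(\<lambda>n. u z - cut_y {-real n..real n} u z) \<longlonglongrightarrow> 0" by (rule tendsto_eventually)
    qed
  qed (auto simp: cut_y_def indicator_def)
  then have "eventually (\<lambda>n. nsq (\<lambda>z. u z - cut_y {-real n..real n} u z) < ennreal e) sequentially"
    using e by (intro order_tendstoD(2)) auto
  then obtain n where "nsq (\<lambda>z. u z - cut_y {-real n..real n} u z) < ennreal e"
    using eventually_happens'[OF sequentially_bot] by blast
  then show ?thesis by (intro exI[of _ "real n"]) auto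
qed

text \<open>Two windows that contain the same large interval give nearly the same transform,
  because the truncations differ only on the tail of \<open>u\<close>.\<close>

lemma cut_y_tail_windows:
  assumes u: "sqint u" and r: "nsq (\<lambda>z. u z - cut_y {-r..r} u z) \<le> e" and ab: "a \<le> -r" "r \<le> b" "c \<le> -r" "r \<le> d"
  shows "nsq (\<lambda>z. fourier_int_y (cut_y {a..b} u) z - fourier_int_y (cut_y {c..d} u) z) \<le> e"
proof -
  let ?R = "max (max \<bar>a\<bar> \<bar>b\<bar>) (max \<bar>c\<bar> \<bar>d\<bar>)"
  have "nsq (\<lambda>z. fourier_int_y (cut_y {a..b} u) z - fourier_int_y (cut_y {c..d} u) z) = nsq (\<lambda>z. cut_y {a..b} u z - cut_y {c..d} u z)"
    by (rule nsq_cut_y_diff[where R="?R", OF u]) auto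
  also have "\<dots> \<le> nsq (\<lambda>z. u z - cut_y {-r..r} u z)"
    using ab by (intro nsq_mono_AE AE_I2) (auto simp: cut_y_def indicator_def)
  finally show ?thesis using r by simp
qed

text \<open>The transform is the limit along all large windows, not only along the symmetric
  ones; this is what makes it compatible with translations.\<close>

lemma has_fourier_y_windows:
  assumes u: "sqint u" and F: "has_fourier_y u F" and e: "e > 0"
  shows "\<exists>r\<ge>0. \<forall>a b. a \<le> -r \<longrightarrow> r \<le> b \<longrightarrow> nsq (\<lambda>z. F z - fourier_int_y (cut_y {a..b} u) z) \<le> ennreal e"
proof -
  have um [measurable]: "u \<in> borel_measurable borel" using u by (auto simp: sqint_def)
  have Fm [measurable]: "F \<in> borel_measurable borel" using F by (auto simp: has_fourier_y_def L2_iff_sqint sqint_def)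
  have "((\<lambda>R. nsq (\<lambda>z. F z - fourier_int_y (cut_y {-R..R} u) z)) \<longlongrightarrow> 0) at_top"
    using F by (simp add: has_fourier_y_def nsq_def fourier_y_trunc_eq)
  then have "eventually (\<lambda>R. nsq (\<lambda>z. F z - fourier_int_y (cut_y {-R..R} u) z) < ennreal (e/4)) at_top"
    using e by (intro order_tendstoD(2)) auto
  then obtain r1 where r1: "\<And>R. R \<ge> r1 \<Longrightarrow> nsq (\<lambda>z. F z - fourier_int_y (cut_y {-R..R} u) z) \<le> ennreal (e/4)"
    by (auto simp: eventually_at_top_linorder intro: less_imp_le)
  obtain r2 where r2: "r2 \<ge> 0" "nsq (\<lambda>z. u z - cut_y {-r2..r2} u z) \<le> ennreal (e/4)"
    using cut_y_tail[OF u, of "e/4"] e by auto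
  define r where "r = max r1 r2"
  have "nsq (\<lambda>z. F z - fourier_int_y (cut_y {a..b} u) z) \<le> ennreal e" if ab: "a \<le> -r" "r \<le> b" for a b
    by (rule nsq_triangle_le[OF _ _ _ r1[of r] cut_y_tail_windows[OF u r2(2)]]) (use ab e in \<open>auto simp: r_def\<close>)
  then show ?thesis using r2 by (intro exI[of _ r]) (auto simp: r_def)
qed

lemma has_fourier_yI:
  assumes F: "sqint F"
    and "\<And>e. e > 0 \<Longrightarrow> \<exists>r. \<forall>R\<ge>r. nsq (\<lambda>z. F z - fourier_int_y (cut_y {-R..R} u) z) \<le> ennreal e"
  shows "has_fourier_y u F"
proof -
  have "((\<lambda>R. nsq (\<lambda>z. F z - fourier_int_y (cut_y {-R..R} u) z)) \<longlongrightarrow> 0) at_top"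
  proof (rule order_tendstoI)
    fix a :: ennreal assume "0 < a"
    then obtain b where b: "0 < b" "b < a" using dense by blast
    then have "ennreal (enn2real b) = b" "enn2real b > 0"
      by (auto simp: enn2real_positive_iff less_top[symmetric] top_unique intro!: ennreal_enn2real)
    with assms(2)[of "enn2real b"] b show "eventually (\<lambda>R. nsq (\<lambda>z. F z - fourier_int_y (cut_y {-R..R} u) z) < a) at_top"
      by (auto simp: eventually_at_top_linorder) (metis le_less_trans)
  qed auto
  then show ?thesis using F by (simp add: has_fourier_y_def nsq_def fourier_y_trunc_eq L2_iff_sqint)
qed

lemma has_fourier_y_exists:
  assumes u: "sqint u"
  shows "\<exists>F. has_fourier_y u F"
proof -
  have um [measurable]: "u \<in> borel_measurable borel" using u by (auto simp: sqint_def)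
  define f where "f n = fourier_int_y (cut_y {-real n..real n} u)" for n :: nat
  have fs: "sqint (f n)" for n
    unfolding f_def by (rule sqint_fourier_int_y[where R="real n"]) (auto intro!: sqint_cut_y u simp: cut_y_def indicator_def)
  have "\<exists>N. \<forall>i\<ge>N. \<forall>j\<ge>N. nsq (\<lambda>z. f i z - f j z) \<le> ennreal e" if e: "e > 0" for e
  proof -
    obtain r where r: "r \<ge> 0" "nsq (\<lambda>z. u z - cut_y {-r..r} u z) \<le> ennreal e"
      using cut_y_tail[OF u e] by auto
    obtain N :: nat where "r \<le> real N" using real_arch_simple by blast
    then show ?thesis unfolding f_def
      by (intro exI[of _ N] allI impI cut_y_tail_windows[OF u r(2)]) auto
  qed
  from sqint_complete[OF fs this] obtain F where F: "sqint F" "(\<lambda>n. nsq (\<lambda>z. f n z - F z)) \<longlonglongrightarrow> 0"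
    by blast
  have [measurable]: "F \<in> borel_measurable borel" using F by (auto simp: sqint_def)
  have "has_fourier_y u F"
  proof (rule has_fourier_yI[OF F(1)])
    fix e :: real assume e: "e > 0"
    obtain r where r: "r \<ge> 0" "nsq (\<lambda>z. u z - cut_y {-r..r} u z) \<le> ennreal (e/4)"
      using cut_y_tail[OF u, of "e/4"] e by auto
    from ennreal_tendsto_0D[OF F(2), of "e/4"] e
    obtain N where N: "\<And>n. n \<ge> N \<Longrightarrow> nsq (\<lambda>z. f n z - F z) \<le> ennreal (e/4)" by auto
    define n where "n = max N (nat \<lceil>r\<rceil>)"
    have n: "nsq (\<lambda>z. F z - f n z) \<le> ennreal (e/4)" "real n \<ge> r"
      using N[of n] by (subst nsq_diff_commute) (auto simp: n_def, linarith)
    have "nsq (\<lambda>z. F z - fourier_int_y (cut_y {-R..R} u) z) \<le> ennreal e" if "R \<ge> r" for R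
    proof (rule nsq_triangle_le[OF _ _ _ n(1)])
      show "nsq (\<lambda>z. f n z - fourier_int_y (cut_y {-R..R} u) z) \<le> ennreal (e/4)"
        unfolding f_def using n that by (intro cut_y_tail_windows[OF u r(2)]) auto
    qed (use fs[of n] e in \<open>auto simp: sqint_def\<close>)
    then show "\<exists>r. \<forall>R\<ge>r. nsq (\<lambda>z. F z - fourier_int_y (cut_y {-R..R} u) z) \<le> ennreal e" by blast
  qed
  then show ?thesis by blast
qed

lemma has_fourier_y_lincomb:
  assumes u: "sqint u" "has_fourier_y u F" and v: "sqint v" "has_fourier_y v G"
  shows "has_fourier_y (\<lambda>z. a * u z + b * v z) (\<lambda>z. a * F z + b * G z)"
proof (rule has_fourier_yI)
  have FG: "sqint F" "sqint G" using u v by (auto simp: has_fourier_y_def L2_iff_sqint)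
  then show "sqint (\<lambda>z. a * F z + b * G z)" by (intro sqint_add sqint_cmult)
  have [measurable]: "u \<in> borel_measurable borel" "v \<in> borel_measurable borel"
    "F \<in> borel_measurable borel" "G \<in> borel_measurable borel" using u v FG by (auto simp: sqint_def)
  fix e :: real assume e: "e > 0"
  \<comment> \<open>The summand 1 keeps \<open>k\<close> positive when both coefficients vanish.\<close>
  define k where "k = 2 * (cmod a)\<^sup>2 + 2 * (cmod b)\<^sup>2 + 1"
  have k: "k > 0" unfolding k_def by (simp add: add_nonneg_pos)
  obtain r1 where r1: "\<And>a b. a \<le> -r1 \<Longrightarrow> r1 \<le> b \<Longrightarrow> nsq (\<lambda>z. F z - fourier_int_y (cut_y {a..b} u) z) \<le> ennreal (e/k)"
    using has_fourier_y_windows[OF u, of "e/k"] e k by auto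
  obtain r2 where r2: "\<And>a b. a \<le> -r2 \<Longrightarrow> r2 \<le> b \<Longrightarrow> nsq (\<lambda>z. G z - fourier_int_y (cut_y {a..b} v) z) \<le> ennreal (e/k)"
    using has_fourier_y_windows[OF v, of "e/k"] e k by auto
  have "nsq (\<lambda>z. a * F z + b * G z - fourier_int_y (cut_y {-R..R} (\<lambda>z. a * u z + b * v z)) z) \<le> ennreal e"
    if R: "R \<ge> max r1 r2" for R
  proof -
    let ?u = "cut_y {-R..R} u" and ?v = "cut_y {-R..R} v"
    have eq: "cut_y {-R..R} (\<lambda>z. a * u z + b * v z) = (\<lambda>z. a * ?u z + b * ?v z)"
      by (auto simp: cut_y_def fun_eq_iff algebra_simps)
    have "AE z in lborel. fourier_int_y (\<lambda>z. a * ?u z + b * ?v z) z = a * fourier_int_y ?u z + b * fourier_int_y ?v z"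
    proof (rule fourier_int_y_lincomb_AE[where R=R])
      show "sqint ?u" "sqint ?v" using u v by (auto intro: sqint_cut_y)
    qed (auto simp: cut_y_def indicator_def)
    then have "nsq (\<lambda>z. a * F z + b * G z - fourier_int_y (cut_y {-R..R} (\<lambda>z. a * u z + b * v z)) z)
      = nsq (\<lambda>z. a * (F z - fourier_int_y ?u z) + b * (G z - fourier_int_y ?v z))"
      unfolding eq by (intro nsq_cong_AE) (auto elim!: eventually_mono simp: algebra_simps)
    also have "\<dots> \<le> 2 * nsq (\<lambda>z. a * (F z - fourier_int_y ?u z)) + 2 * nsq (\<lambda>z. b * (G z - fourier_int_y ?v z))"
      by (rule nsq_add_le) auto
    also have "\<dots> = 2 * (ennreal ((cmod a)\<^sup>2) * nsq (\<lambda>z. F z - fourier_int_y ?u z))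
       + 2 * (ennreal ((cmod b)\<^sup>2) * nsq (\<lambda>z. G z - fourier_int_y ?v z))"
      by (simp add: nsq_cmult)
    also have "\<dots> \<le> 2 * (ennreal ((cmod a)\<^sup>2) * ennreal (e/k)) + 2 * (ennreal ((cmod b)\<^sup>2) * ennreal (e/k))"
      using R by (intro add_mono mult_left_mono r1 r2) auto
    also have "\<dots> = ennreal ((2 * (cmod a)\<^sup>2 + 2 * (cmod b)\<^sup>2) * (e/k))"
      using e k by (simp add: ennreal_times_2 distrib_right add_divide_distrib flip: ennreal_mult ennreal_plus)
    also have "\<dots> \<le> ennreal e"
    proof (rule ennreal_leI)
      have "(2 * (cmod a)\<^sup>2 + 2 * (cmod b)\<^sup>2) * (e/k) \<le> k * (e/k)"
        using e k by (intro mult_right_mono) (auto simp: k_def)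
      then show "(2 * (cmod a)\<^sup>2 + 2 * (cmod b)\<^sup>2) * (e/k) \<le> e" using k by simp
    qed
    finally show ?thesis .
  qed
  then show "\<exists>r. \<forall>R\<ge>r. nsq (\<lambda>z. a * F z + b * G z - fourier_int_y (cut_y {-R..R} (\<lambda>z. a * u z + b * v z)) z) \<le> ennreal e"
    by blast
qed

text \<open>Parseval's identity up to a factor 2, which is enough for uniqueness and for passing
  to limits. The factor comes from \<open>nsq_add_le\<close>.\<close>

lemma has_fourier_y_nsq_le:
  assumes u: "sqint u" and F: "has_fourier_y u F"
  shows "nsq F \<le> 2 * nsq u" and "nsq u \<le> 2 * nsq F"
proof -
  have Fs: "sqint F" using F by (auto simp: has_fourier_y_def L2_iff_sqint)
  have [measurable]: "u \<in> borel_measurable borel" "F \<in> borel_measurable borel" using u Fs by (auto simp: sqint_def)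
  have cutn: "nsq (fourier_int_y (cut_y {-R..R} u)) = nsq (cut_y {-R..R} u)" for R
    by (rule nsq_fourier_int_y[where R=R]) (auto intro!: sqint_cut_y u simp: cut_y_def indicator_def)
  show "nsq F \<le> 2 * nsq u"
  proof (rule ennreal_le_epsilon)
    fix e :: real assume e: "0 < e"
    obtain r where r: "nsq (\<lambda>z. F z - fourier_int_y (cut_y {-r..r} u) z) \<le> ennreal (e/2)"
      using has_fourier_y_windows[OF u F, of "e/2"] e by auto
    have "nsq F \<le> 2 * nsq (\<lambda>z. F z - fourier_int_y (cut_y {-r..r} u) z) + 2 * nsq (fourier_int_y (cut_y {-r..r} u))"
      using nsq_add_le[of "\<lambda>z. F z - fourier_int_y (cut_y {-r..r} u) z" "fourier_int_y (cut_y {-r..r} u)"] by simp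
    also have "\<dots> \<le> 2 * ennreal (e/2) + 2 * nsq u"
      unfolding cutn using r by (intro add_mono mult_left_mono nsq_mono_AE AE_I2) (auto simp: cut_y_def indicator_def)
    also have "2 * ennreal (e/2) = ennreal e" using e by (simp add: ennreal_times_2)
    finally show "nsq F \<le> 2 * nsq u + ennreal e" by (simp add: add.commute)
  qed
  show "nsq u \<le> 2 * nsq F"
  proof (rule ennreal_le_epsilon)
    fix e :: real assume e: "0 < e"
    obtain r where r: "\<And>a b. a \<le> -r \<Longrightarrow> r \<le> b \<Longrightarrow> nsq (\<lambda>z. F z - fourier_int_y (cut_y {a..b} u) z) \<le> ennreal (e/2)"
      using has_fourier_y_windows[OF u F, of "e/2"] e by auto
    obtain N :: nat where N: "r \<le> real N" using real_arch_simple by blast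
    show "nsq u \<le> 2 * nsq F + ennreal e"
    proof (rule nsq_le_of_AE_lim[where f="\<lambda>n. cut_y {-real n..real n} u" and N=N])
      show "AE z in lborel. (\<lambda>n. cut_y {- real n..real n} u z) \<longlonglongrightarrow> u z"
      proof (rule AE_I2)
        fix z :: "real \<times> real"
        obtain N :: nat where N: "\<bar>snd z\<bar> \<le> real N" using real_arch_simple by blast
        have "eventually (\<lambda>n. cut_y {-real n..real n} u z = u z) sequentially"
          using N by (auto simp: eventually_sequentially cut_y_def indicator_def intro!: exI[of _ N])
        then show "(\<lambda>n. cut_y {-real n..real n} u z) \<longlonglongrightarrow> u z" by (rule tendsto_eventually)
      qed
      fix n assume n: "N \<le> n"
      have "nsq (cut_y {-real n..real n} u) \<le> 2 * nsq F + 2 * nsq (\<lambda>z. F z - fourier_int_y (cut_y {-real n..real n} u) z)"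
        using nsq_diff_le[of F "\<lambda>z. F z - fourier_int_y (cut_y {-real n..real n} u) z"] by (simp flip: cutn)
      also have "\<dots> \<le> 2 * nsq F + 2 * ennreal (e/2)"
        using N n by (intro add_mono mult_left_mono r) auto
      also have "2 * ennreal (e/2) = ennreal e" using e by (simp add: ennreal_times_2)
      finally show "nsq (cut_y {- real n..real n} u) \<le> 2 * nsq F + ennreal e" .
    qed auto
  qed
qed

lemma has_fourier_y_unique:
  assumes u: "sqint u" "has_fourier_y u F" "has_fourier_y u G"
  shows "AE z in lborel. F z = G z"
proof -
  have FG: "sqint F" "sqint G" using u by (auto simp: has_fourier_y_def L2_iff_sqint)
  have [measurable]: "F \<in> borel_measurable borel" "G \<in> borel_measurable borel" using FG by (auto simp: sqint_def)
  have "has_fourier_y (\<lambda>z. 1 * u z + (-1) * u z) (\<lambda>z. 1 * F z + (-1) * G z)"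
    by (rule has_fourier_y_lincomb) fact+
  then have "has_fourier_y (\<lambda>z. 0) (\<lambda>z. F z - G z)" by simp
  from has_fourier_y_nsq_le(1)[OF _ this] have "nsq (\<lambda>z. F z - G z) = 0" by simp
  then show ?thesis by (simp add: nsq_eq_0_iff)
qed

lemma fourier_int_y_translate:
  assumes [measurable]: "u \<in> borel_measurable borel"
  shows "fourier_int_y (cut_y {-R..R} (\<lambda>z. u (z + (s, t)))) (x, \<eta>)
    = exp (\<i> * of_real (t * \<eta>)) * fourier_int_y (cut_y {-R+t..R+t} u) (x + s, \<eta>)"
proof -
  let ?f = "\<lambda>y. exp (- \<i> * of_real (y * \<eta>)) * (indicator {-R+t..R+t} y * u (x + s, y))"
  have [measurable]: "?f \<in> borel_measurable borel" by measurable
  have "(LINT y|lborel. ?f y) = (LINT y|lborel. ?f (y + t))"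
    by (rule lebesgue_integral_lborel_translate[symmetric]) measurable
  also have "\<dots> = (LINT y|lborel. exp (- \<i> * of_real (t * \<eta>)) * (exp (- \<i> * of_real (y * \<eta>)) * (indicator {-R..R} y * u ((x, y) + (s, t)))))"
  proof (rule Bochner_Integration.integral_cong[OF refl])
    fix y
    have "exp (- \<i> * of_real ((y + t) * \<eta>)) = exp (- \<i> * of_real (t * \<eta>)) * exp (- \<i> * of_real (y * \<eta>))"
      unfolding mult_exp_exp by (simp add: algebra_simps)
    moreover have "indicator {-R+t..R+t} (y + t) = (indicator {-R..R} y :: complex)" by (auto simp: indicator_def)
    ultimately show "?f (y + t) = exp (- \<i> * of_real (t * \<eta>)) * (exp (- \<i> * of_real (y * \<eta>)) * (indicator {-R..R} y * u ((x, y) + (s, t))))"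
      by (simp only: mult.assoc add_Pair)
  qed
  also have "\<dots> = exp (- \<i> * of_real (t * \<eta>)) * (LINT y|lborel. exp (- \<i> * of_real (y * \<eta>)) * (indicator {-R..R} y * u ((x, y) + (s, t))))"
    by (rule integral_mult_right_zero)
  finally have eq: "(LINT y|lborel. ?f y) = exp (- \<i> * of_real (t * \<eta>)) * (LINT y|lborel. exp (- \<i> * of_real (y * \<eta>)) * (indicator {-R..R} y * u ((x, y) + (s, t))))" .
  have "exp (\<i> * of_real (t * \<eta>)) * exp (- \<i> * of_real (t * \<eta>)) = (1::complex)"
    unfolding mult_exp_exp by simp
  then have "exp (\<i> * of_real (t * \<eta>)) * (LINT y|lborel. ?f y) = (LINT y|lborel. exp (- \<i> * of_real (y * \<eta>)) * (indicator {-R..R} y * u ((x, y) + (s, t))))"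
    unfolding eq by (simp only: mult.assoc[symmetric] mult_1_left)
  then show ?thesis
    unfolding fourier_int_y_def fourier_int_def cut_y_def by (simp only: prod.case snd_conv mult_scaleR_right)
qed

text \<open>A translation in \<open>y\<close> becomes a modulation of the transform, a
  translation in \<open>x\<close> acts on it as such.\<close>

lemma has_fourier_y_translate:
  assumes u: "sqint u" "has_fourier_y u F"
  shows "has_fourier_y (\<lambda>z. u (z + (s, t))) (\<lambda>(x, \<eta>). exp (\<i> * of_real (t * \<eta>)) * F (x + s, \<eta>))"
proof (rule has_fourier_yI)
  have Fs: "sqint F" using u by (auto simp: has_fourier_y_def L2_iff_sqint)
  have [measurable]: "u \<in> borel_measurable borel" "F \<in> borel_measurable borel" using u Fs by (auto simp: sqint_def)
  have e1: "cmod (exp (\<i> * of_real (t * \<eta>))) = 1" for \<eta> by simp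
  have em: "(\<lambda>z::real\<times>real. exp (\<i> * complex_of_real (t * snd z))) \<in> borel_measurable borel"
    by (intro borel_measurable_continuous_onI continuous_intros)
  show "sqint (\<lambda>(x, \<eta>). exp (\<i> * of_real (t * \<eta>)) * F (x + s, \<eta>))"
  proof (rule sqint_mono[OF sqint_translate[OF Fs, of "(s, 0)"]])
    have "(\<lambda>z. exp (\<i> * complex_of_real (t * snd z)) * F (z + (s, 0))) \<in> borel_measurable borel"
      using em by measurable
    then show "(\<lambda>(x, \<eta>). exp (\<i> * of_real (t * \<eta>)) * F (x + s, \<eta>)) \<in> borel_measurable borel"
      by (simp add: case_prod_beta' plus_prod_def)
  qed (auto simp: norm_mult)
  fix e :: real assume e: "e > 0"
  obtain r where r: "\<And>a b. a \<le> -r \<Longrightarrow> r \<le> b \<Longrightarrow> nsq (\<lambda>z. F z - fourier_int_y (cut_y {a..b} u) z) \<le> ennreal e"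
    using has_fourier_y_windows[OF u e] by auto
  have "nsq (\<lambda>z. (case z of (x, \<eta>) \<Rightarrow> exp (\<i> * of_real (t * \<eta>)) * F (x + s, \<eta>)) - fourier_int_y (cut_y {-R..R} (\<lambda>z. u (z + (s, t)))) z) \<le> ennreal e"
    if "R \<ge> r + \<bar>t\<bar>" for R
  proof -
    have "nsq (\<lambda>z. (case z of (x, \<eta>) \<Rightarrow> exp (\<i> * of_real (t * \<eta>)) * F (x + s, \<eta>)) - fourier_int_y (cut_y {-R..R} (\<lambda>z. u (z + (s, t)))) z)
      = nsq (\<lambda>z. F (z + (s, 0)) - fourier_int_y (cut_y {-R+t..R+t} u) (z + (s, 0)))"
      unfolding nsq_def
    proof (rule nn_integral_cong)
      fix z :: "real \<times> real"
      obtain x \<eta> where z: "z = (x, \<eta>)" by (cases z)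
      have "cmod (exp (\<i> * of_real (t * \<eta>)) * F (x + s, \<eta>) - exp (\<i> * of_real (t * \<eta>)) * fourier_int_y (cut_y {-R+t..R+t} u) (x + s, \<eta>))
        = cmod (F (x + s, \<eta>) - fourier_int_y (cut_y {-R+t..R+t} u) (x + s, \<eta>))"
        by (simp only: right_diff_distrib[symmetric] norm_mult e1 mult_1_left)
      then show "ennreal ((cmod ((case z of (x, \<eta>) \<Rightarrow> exp (\<i> * of_real (t * \<eta>)) * F (x + s, \<eta>)) - fourier_int_y (cut_y {-R..R} (\<lambda>z. u (z + (s, t)))) z))\<^sup>2)
        = ennreal ((cmod (F (z + (s, 0)) - fourier_int_y (cut_y {-R+t..R+t} u) (z + (s, 0))))\<^sup>2)"
        by (simp only: z prod.case fourier_int_y_translate[OF \<open>u \<in> borel_measurable borel\<close>] add_Pair add_0_right)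
    qed
    also have "\<dots> = nsq (\<lambda>z. F z - fourier_int_y (cut_y {-R+t..R+t} u) z)"
      by (rule nsq_translate) auto
    also have "\<dots> \<le> ennreal e" using that by (intro r) auto
    finally show ?thesis .
  qed
  then show "\<exists>r. \<forall>R\<ge>r. nsq (\<lambda>z. (case z of (x, \<eta>) \<Rightarrow> exp (\<i> * of_real (t * \<eta>)) * F (x + s, \<eta>)) - fourier_int_y (cut_y {-R..R} (\<lambda>z. u (z + (s, t)))) z) \<le> ennreal e"
    by blast
qed

text \<open>The squared norm of the half derivative \<open>\<bar>D\<^sub>y\<bar>\<close> to the
  power \<open>1/2\<close>, on the Fourier side.\<close>

definition half_energy :: "(real \<times> real \<Rightarrow> complex) \<Rightarrow> ennreal" where
  "half_energy F = (\<integral>\<^sup>+z. ennreal (\<bar>snd z\<bar> * (cmod (F z))\<^sup>2) \<partial>lborel)"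

text \<open>The linear bound, rather than the quadratic one, is the one that matches half a
  derivative.\<close>

lemma cmod_exp_i_minus_1_sq: "(cmod (exp (\<i> * of_real \<theta>) - 1))\<^sup>2 \<le> 2 * \<bar>\<theta>\<bar>"
proof -
  have "(cmod (exp (\<i> * of_real \<theta>) - 1))\<^sup>2 = (cos \<theta> - 1)\<^sup>2 + (sin \<theta>)\<^sup>2"
    by (simp add: cmod_power2 flip: cis_conv_exp)
  also have "\<dots> = 2 - 2 * cos \<theta>" using sin_cos_squared_add[of \<theta>] by (simp add: power2_diff)
  also have "cos \<theta> = 1 - 2 * (sin (\<theta>/2))\<^sup>2" using cos_double_sin[of "\<theta>/2"] by simp
  also have "2 - 2 * (1 - 2 * (sin (\<theta>/2))\<^sup>2) = 4 * (\<bar>sin (\<theta>/2)\<bar> * \<bar>sin (\<theta>/2)\<bar>)"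
    by (simp add: power2_eq_square)
  also have "\<bar>sin (\<theta>/2)\<bar> * \<bar>sin (\<theta>/2)\<bar> \<le> 1 * \<bar>\<theta>/2\<bar>"
    by (intro mult_mono abs_sin_x_le_abs_x) auto
  finally show ?thesis by simp
qed

text \<open>On the Fourier side the difference is multiplied by \<open>exp (\<i>t\<eta>) -
  1\<close>, whose square is at most \<open>2\<bar>t\<bar>\<bar>\<eta>\<bar>\<close>. The
  remaining factor 2 is that of \<open>has_fourier_y_nsq_le\<close>.\<close>

lemma nsq_translate_y:
  assumes u: "sqint u" "has_fourier_y u F"
  shows "nsq (\<lambda>z. u (z + (0, t)) - u z) \<le> ennreal (4 * \<bar>t\<bar>) * half_energy F"
proof -
  have Fs: "sqint F" using u by (auto simp: has_fourier_y_def L2_iff_sqint)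
  have [measurable]: "u \<in> borel_measurable borel" "F \<in> borel_measurable borel" using u Fs by (auto simp: sqint_def)
  let ?G = "\<lambda>(x, \<eta>). exp (\<i> * of_real (t * \<eta>)) * F (x, \<eta>)"
  have "has_fourier_y (\<lambda>z. 1 * u (z + (0, t)) + (-1) * u z) (\<lambda>z. 1 * ?G z + (-1) * F z)"
    using has_fourier_y_translate[OF u, of 0 t] by (intro has_fourier_y_lincomb sqint_translate u) simp
  then have "nsq (\<lambda>z. u (z + (0, t)) - u z) \<le> 2 * nsq (\<lambda>z. ?G z - F z)"
    using has_fourier_y_nsq_le(2)[of "\<lambda>z. u (z + (0, t)) - u z"] u by (simp add: sqint_diff sqint_translate)
  moreover have "nsq (\<lambda>z. ?G z - F z) \<le> ennreal (2 * \<bar>t\<bar>) * half_energy F"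
  proof -
  have "nsq (\<lambda>z. ?G z - F z) \<le> (\<integral>\<^sup>+z. ennreal (2 * \<bar>t\<bar>) * ennreal (\<bar>snd z\<bar> * (cmod (F z))\<^sup>2) \<partial>lborel)"
    unfolding nsq_def
  proof (rule nn_integral_mono)
    fix z :: "real \<times> real"
    obtain x \<eta> where z: "z = (x, \<eta>)" by (cases z)
    have "(cmod (exp (\<i> * of_real (t * \<eta>)) * F (x, \<eta>) - F (x, \<eta>)))\<^sup>2 = (cmod (exp (\<i> * of_real (t * \<eta>)) - 1))\<^sup>2 * (cmod (F (x, \<eta>)))\<^sup>2"
      by (simp only: power_mult_distrib[symmetric] norm_mult[symmetric] left_diff_distrib mult_1_left)
    also have "\<dots> \<le> 2 * \<bar>t * \<eta>\<bar> * (cmod (F (x, \<eta>)))\<^sup>2"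
      by (intro mult_right_mono cmod_exp_i_minus_1_sq) auto
    finally show "ennreal ((cmod (?G z - F z))\<^sup>2) \<le> ennreal (2 * \<bar>t\<bar>) * ennreal (\<bar>snd z\<bar> * (cmod (F z))\<^sup>2)"
      unfolding z by (simp add: abs_mult mult.assoc flip: ennreal_mult)
  qed
  also have "\<dots> = ennreal (2 * \<bar>t\<bar>) * half_energy F"
    unfolding half_energy_def by (subst nn_integral_cmult) auto
  finally show ?thesis .
  qed
  ultimately have "nsq (\<lambda>z. u (z + (0, t)) - u z) \<le> 2 * (ennreal (2 * \<bar>t\<bar>) * half_energy F)"
    by (meson mult_left_mono order_trans zero_le)
  also have "\<dots> = ennreal (4 * \<bar>t\<bar>) * half_energy F"
    by (simp add: mult.assoc[symmetric] ennreal_times_2)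
  finally show ?thesis .
qed

section \<open>Weak derivatives in the first variable\<close>

definition test_fun :: "(real \<times> real \<Rightarrow> real) \<Rightarrow> (real \<times> real \<Rightarrow> real) \<Rightarrow> (real \<times> real \<Rightarrow> real) \<Rightarrow> bool" where
  "test_fun \<phi> \<phi>x \<phi>y \<longleftrightarrow> (\<forall>z. (\<phi> has_derivative (\<lambda>(a, b). a * \<phi>x z + b * \<phi>y z)) (at z)) \<and>
     continuous_on UNIV \<phi>x \<and> continuous_on UNIV \<phi>y \<and> bounded {z. \<phi> z \<noteq> 0}"

lemma has_weak_dx_iff:
  "has_weak_dx u w \<longleftrightarrow> w \<in> L2 \<and> (\<forall>\<phi> \<phi>x \<phi>y. test_fun \<phi> \<phi>x \<phi>y \<longrightarrow>
     (LINT z|lborel. \<phi>x z *\<^sub>R u z) = - (LINT z|lborel. \<phi> z *\<^sub>R w z))"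
  unfolding has_weak_dx_def test_fun_def by meson

lemma has_weak_dxD:
  "has_weak_dx u w \<Longrightarrow> test_fun \<phi> \<phi>x \<phi>y \<Longrightarrow> (LINT z|lborel. \<phi>x z *\<^sub>R u z) = - (LINT z|lborel. \<phi> z *\<^sub>R w z)"
  unfolding has_weak_dx_iff by blast

lemma has_weak_dx_sqint: "has_weak_dx u w \<Longrightarrow> sqint w"
  unfolding has_weak_dx_iff L2_iff_sqint by blast

lemma test_funD:
  assumes "test_fun \<phi> \<phi>x \<phi>y"
  shows "(\<phi> has_derivative (\<lambda>(a, b). a * \<phi>x z + b * \<phi>y z)) (at z)"
    "continuous_on UNIV \<phi>x" "continuous_on UNIV \<phi>y" "bounded {z. \<phi> z \<noteq> 0}"
  using assms unfolding test_fun_def by blast+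

lemma sqint_continuous_bounded_support:
  fixes \<phi> :: "'a::euclidean_space \<Rightarrow> real"
  assumes c: "continuous_on UNIV \<phi>" and b: "bounded {z. \<phi> z \<noteq> 0}"
  shows "sqint (\<lambda>z. complex_of_real (\<phi> z))"
proof -
  have [measurable]: "\<phi> \<in> borel_measurable borel" using c by (rule borel_measurable_continuous_onI)
  obtain R where "\<forall>z\<in>{z. \<phi> z \<noteq> 0}. norm z \<le> R" using b unfolding bounded_iff by blast
  then have R: "{z. \<phi> z \<noteq> 0} \<subseteq> cball 0 R" by auto
  have "compact (\<phi> ` cball 0 R)" using c by (intro compact_continuous_image) (auto intro: continuous_on_subset)
  then obtain B where B: "\<And>z. z \<in> cball 0 R \<Longrightarrow> \<bar>\<phi> z\<bar> \<le> B"
    using compact_imp_bounded by (fastforce simp: bounded_iff)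
  have "nsq (\<lambda>z. complex_of_real (\<phi> z)) \<le> (\<integral>\<^sup>+(z::'a). ennreal (B\<^sup>2) * indicator (cball 0 R) z \<partial>lborel)"
    unfolding nsq_def
  proof (intro nn_integral_mono)
    fix z :: 'a
    show "ennreal ((cmod (complex_of_real (\<phi> z)))\<^sup>2) \<le> ennreal (B\<^sup>2) * indicator (cball 0 R) z"
    proof (cases "z \<in> cball 0 R")
      case True
      then have "\<bar>\<phi> z\<bar>\<^sup>2 \<le> B\<^sup>2" using B by (intro power_mono) auto
      then show ?thesis using True by (auto intro!: ennreal_leI)
    next
      case False
      then show ?thesis using R by auto
    qed
  qed
  also have "\<dots> < \<infinity>"
    using emeasure_bounded_finite[OF bounded_cball, of "0::'a" R]
    by (simp add: nn_integral_cmult_indicator ennreal_mult_less_top)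
  finally show ?thesis by (simp add: sqint_def)
qed

lemma test_fun_continuous: "test_fun \<phi> \<phi>x \<phi>y \<Longrightarrow> continuous_on UNIV \<phi>"
  unfolding test_fun_def by (meson continuous_at_imp_continuous_on has_derivative_continuous)

lemma test_fun_bounded_dx:
  assumes t: "test_fun \<phi> \<phi>x \<phi>y"
  shows "bounded {z. \<phi>x z \<noteq> 0}"
proof -
  have b: "bounded (closure {z. \<phi> z \<noteq> 0})" using bounded_closure[OF test_funD(4)[OF t]] .
  have "\<phi>x z = 0" if z: "z \<notin> closure {z. \<phi> z \<noteq> 0}" for z
  proof -
    have d: "(\<phi> has_derivative (\<lambda>(a, b). a * \<phi>x z + b * \<phi>y z)) (at z)" by (rule test_funD(1)[OF t])
    have "((\<lambda>_. 0::real) has_derivative (\<lambda>_. 0)) (at z)" by simp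
    then have "(\<phi> has_derivative (\<lambda>_. 0)) (at z)"
      by (rule has_derivative_transform_within_open[of _ _ _ _ "- closure {z. \<phi> z \<noteq> 0}"])
        (use z closure_subset[of "{z. \<phi> z \<noteq> 0}"] in auto)
    from has_derivative_unique[OF d this] have "(\<lambda>(a, b). a * \<phi>x z + b * \<phi>y z) (1, 0) = 0" by (simp add: fun_eq_iff)
    then show ?thesis by simp
  qed
  then show ?thesis by (intro bounded_subset[OF b]) auto
qed

lemma test_fun_sqint:
  assumes t: "test_fun \<phi> \<phi>x \<phi>y"
  shows "sqint (\<lambda>z. complex_of_real (\<phi> z))" "sqint (\<lambda>z. complex_of_real (\<phi>x z))"
  by (rule sqint_continuous_bounded_support[OF test_fun_continuous[OF t] test_funD(4)[OF t]])
    (rule sqint_continuous_bounded_support[OF test_funD(2)[OF t] test_fun_bounded_dx[OF t]])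

lemma has_weak_dx_lincomb:
  assumes u: "sqint u" "has_weak_dx u w" and v: "sqint v" "has_weak_dx v y"
  shows "has_weak_dx (\<lambda>z. a * u z + b * v z) (\<lambda>z. a * w z + b * y z)"
  unfolding has_weak_dx_iff
proof (intro conjI allI impI)
  have wy: "sqint w" "sqint y" using u v has_weak_dx_sqint by blast+
  then show "(\<lambda>z. a * w z + b * y z) \<in> L2" by (auto simp: L2_iff_sqint intro!: sqint_add sqint_cmult)
  fix \<phi> \<phi>x \<phi>y assume t: "test_fun \<phi> \<phi>x \<phi>y"
  have lin: "(LINT z|lborel. complex_of_real (\<psi> z) * (a * f z + b * g z))
     = a * (LINT z|lborel. complex_of_real (\<psi> z) * f z) + b * (LINT z|lborel. complex_of_real (\<psi> z) * g z)"
    if "sqint (\<lambda>z. complex_of_real (\<psi> z))" "sqint f" "sqint g" for \<psi> :: "real \<times> real \<Rightarrow> real" and f g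
  proof -
    have "(LINT z|lborel. complex_of_real (\<psi> z) * (a * f z + b * g z))
      = (LINT z|lborel. a * (complex_of_real (\<psi> z) * f z) + b * (complex_of_real (\<psi> z) * g z))"
      by (simp only: distrib_left mult.left_commute)
    then show ?thesis
      using sqint_mult_integrable[OF that(1,2)] sqint_mult_integrable[OF that(1,3)] by simp
  qed
  show "(LINT z|lborel. \<phi>x z *\<^sub>R (a * u z + b * v z)) = - (LINT z|lborel. \<phi> z *\<^sub>R (a * w z + b * y z))"
    unfolding scaleR_conv_of_real lin[OF test_fun_sqint(2)[OF t] u(1) v(1)] lin[OF test_fun_sqint(1)[OF t] wy]
    using has_weak_dxD[OF u(2) t] has_weak_dxD[OF v(2) t] by (simp add: scaleR_conv_of_real)
qed

text \<open>Both sides of the defining identity are continuous in \<open>L\<^sup>2\<close> for a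
  fixed test function.\<close>

lemma has_weak_dx_closed:
  assumes u: "\<And>n. sqint (u n)" "sqint v" "(\<lambda>n. nsq (\<lambda>z. u n z - v z)) \<longlonglongrightarrow> 0"
    and w: "\<And>n. has_weak_dx (u n) (w n)" "sqint y" "(\<lambda>n. nsq (\<lambda>z. w n z - y z)) \<longlonglongrightarrow> 0"
  shows "has_weak_dx v y"
  unfolding has_weak_dx_iff
proof (intro conjI allI impI)
  show "y \<in> L2" using w by (simp add: L2_iff_sqint)
  have ws: "sqint (w n)" for n by (rule has_weak_dx_sqint[OF w(1)])
  fix \<phi> \<phi>x \<phi>y assume t: "test_fun \<phi> \<phi>x \<phi>y"
  have "(\<lambda>n. LINT z|lborel. complex_of_real (\<phi>x z) * u n z) \<longlonglongrightarrow> (LINT z|lborel. complex_of_real (\<phi>x z) * v z)"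
    by (intro CS_tendsto test_fun_sqint[OF t] u)
  moreover have "(\<lambda>n. - (LINT z|lborel. complex_of_real (\<phi> z) * w n z)) \<longlonglongrightarrow> - (LINT z|lborel. complex_of_real (\<phi> z) * y z)"
    by (intro tendsto_minus CS_tendsto test_fun_sqint[OF t] w ws)
  moreover have "(LINT z|lborel. complex_of_real (\<phi>x z) * u n z) = - (LINT z|lborel. complex_of_real (\<phi> z) * w n z)" for n
    using has_weak_dxD[OF w(1) t, of n] by (simp add: scaleR_conv_of_real)
  ultimately show "(LINT z|lborel. \<phi>x z *\<^sub>R v z) = - (LINT z|lborel. \<phi> z *\<^sub>R y z)"
    using LIMSEQ_unique by (simp add: scaleR_conv_of_real)
qed

lemma has_weak_dx_translate:
  assumes u: "sqint u" "has_weak_dx u w"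
  shows "has_weak_dx (\<lambda>z. u (z + c)) (\<lambda>z. w (z + c))"
  unfolding has_weak_dx_iff
proof (intro conjI allI impI)
  have w: "sqint w" using u has_weak_dx_sqint by blast+
  then show "(\<lambda>z. w (z + c)) \<in> L2" by (auto simp: L2_iff_sqint)
  have [measurable]: "u \<in> borel_measurable borel" "w \<in> borel_measurable borel" using u w by (auto simp: sqint_def)
  fix \<phi> \<phi>x \<phi>y assume t: "test_fun \<phi> \<phi>x \<phi>y"
  have tt: "test_fun (\<lambda>z. \<phi> (z - c)) (\<lambda>z. \<phi>x (z - c)) (\<lambda>z. \<phi>y (z - c))"
    unfolding test_fun_def
  proof (intro conjI allI)
    fix z
    have d: "(\<phi> has_derivative (\<lambda>(a, b). a * \<phi>x (z - c) + b * \<phi>y (z - c))) (at (z - c))"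
      by (rule test_funD(1)[OF t])
    have s: "((\<lambda>z. z - c) has_derivative (\<lambda>h. h)) (at z)" by (auto intro!: derivative_eq_intros)
    show "((\<lambda>z. \<phi> (z - c)) has_derivative (\<lambda>(a, b). a * \<phi>x (z - c) + b * \<phi>y (z - c))) (at z)"
      using has_derivative_compose[OF s d] by simp
    show "continuous_on UNIV (\<lambda>z. \<phi>x (z - c))" "continuous_on UNIV (\<lambda>z. \<phi>y (z - c))"
      by (intro continuous_on_compose2[OF test_funD(2)[OF t]] continuous_on_compose2[OF test_funD(3)[OF t]] continuous_intros; simp)+
    have "{z. \<phi> (z - c) \<noteq> 0} = (\<lambda>z. c + z) ` {z. \<phi> z \<noteq> 0}"
      by (force simp: image_iff)
    then show "bounded {z. \<phi> (z - c) \<noteq> 0}"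
      using bounded_translation[OF test_funD(4)[OF t], of c] by simp
  qed
  have [measurable]: "\<phi> \<in> borel_measurable borel" "\<phi>x \<in> borel_measurable borel"
    using test_funD(2)[OF t] test_fun_continuous[OF t] by (auto intro: borel_measurable_continuous_onI)
  have 1: "(LINT z|lborel. \<phi>x z *\<^sub>R u (z + c)) = (LINT z|lborel. \<phi>x (z - c) *\<^sub>R u z)"
    using lebesgue_integral_lborel_translate[of "\<lambda>z. \<phi>x (z - c) *\<^sub>R u z" c] by simp
  have 2: "(LINT z|lborel. \<phi> z *\<^sub>R w (z + c)) = (LINT z|lborel. \<phi> (z - c) *\<^sub>R w z)"
    using lebesgue_integral_lborel_translate[of "\<lambda>z. \<phi> (z - c) *\<^sub>R w z" c] by simp
  show "(LINT z|lborel. \<phi>x z *\<^sub>R u (z + c)) = - (LINT z|lborel. \<phi> z *\<^sub>R w (z + c))"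
    unfolding 1 2 by (rule has_weak_dxD[OF u(2) tt])
qed

text \<open>The factors of the tensor products that serve as test functions.\<close>

definition C1c :: "(real \<Rightarrow> real) \<Rightarrow> (real \<Rightarrow> real) \<Rightarrow> bool" where
  "C1c a a' \<longleftrightarrow> (\<forall>x. (a has_real_derivative a' x) (at x)) \<and> continuous_on UNIV a' \<and> bounded {x. a x \<noteq> 0}"

lemma C1c_continuous: "C1c a a' \<Longrightarrow> continuous_on UNIV a"
  unfolding C1c_def by (meson DERIV_continuous continuous_at_imp_continuous_on)

lemma test_fun_product:
  assumes a: "C1c a a'" and b: "C1c b b'"
  shows "test_fun (\<lambda>z. a (fst z) * b (snd z)) (\<lambda>z. a' (fst z) * b (snd z)) (\<lambda>z. a (fst z) * b' (snd z))"
  unfolding test_fun_def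
proof (intro conjI allI)
  fix z :: "real \<times> real"
  have da: "((\<lambda>z. a (fst z)) has_derivative (\<lambda>h. a' (fst z) * fst h)) (at z)"
  proof -
    have "(a has_derivative (*) (a' (fst z))) (at (fst z))"
      using a unfolding C1c_def has_field_derivative_def by blast
    from has_derivative_compose[OF has_derivative_fst[OF has_derivative_ident] this] show ?thesis .
  qed
  have db: "((\<lambda>z. b (snd z)) has_derivative (\<lambda>h. b' (snd z) * snd h)) (at z)"
  proof -
    have "(b has_derivative (*) (b' (snd z))) (at (snd z))"
      using b unfolding C1c_def has_field_derivative_def by blast
    from has_derivative_compose[OF has_derivative_snd[OF has_derivative_ident] this] show ?thesis .
  qed
  show "((\<lambda>z. a (fst z) * b (snd z)) has_derivative (\<lambda>(h, k). h * (a' (fst z) * b (snd z)) + k * (a (fst z) * b' (snd z)))) (at z)"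
    by (rule has_derivative_eq_rhs[OF has_derivative_mult[OF da db]]) (auto simp: fun_eq_iff)
  have c: "continuous_on UNIV a" "continuous_on UNIV b" "continuous_on UNIV a'" "continuous_on UNIV b'"
    using a b C1c_continuous by (auto simp: C1c_def)
  show "continuous_on UNIV (\<lambda>z. a' (fst z) * b (snd z))" "continuous_on UNIV (\<lambda>z. a (fst z) * b' (snd z))"
    by (intro continuous_on_mult continuous_on_compose2[OF c(1)] continuous_on_compose2[OF c(2)]
      continuous_on_compose2[OF c(3)] continuous_on_compose2[OF c(4)] continuous_intros; simp)+
  have "bounded ({x. a x \<noteq> 0} \<times> {x. b x \<noteq> 0})" using a b by (intro bounded_Times) (auto simp: C1c_def)
  then show "bounded {z. a (fst z) * b (snd z) \<noteq> 0}" by (rule bounded_subset) auto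
qed

text \<open>A continuously differentiable function that vanishes outside \<open>{l<..<r}\<close>
  and increases to its indicator as \<open>n\<close> grows: with \<open>P x = max 0 ((x - l)(r -
  x))\<close> it is \<open>nP\<^sup>2 / (1 + nP\<^sup>2)\<close>.\<close>

definition bump :: "nat \<Rightarrow> real \<Rightarrow> real \<Rightarrow> real \<Rightarrow> real" where
  "bump n l r x = real n * (max 0 ((x - l) * (r - x)))\<^sup>2 / (1 + real n * (max 0 ((x - l) * (r - x)))\<^sup>2)"

lemma has_real_derivative_max_0_sq: "((\<lambda>t. (max 0 t)\<^sup>2) has_real_derivative 2 * max 0 t) (at t)"
proof (cases "t = 0")
  case True
  have "((\<lambda>h. ((max 0 (0 + h))\<^sup>2 - (max 0 0)\<^sup>2) / h) \<longlongrightarrow> (0::real)) (at 0)"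
  proof (rule tendsto_rabs_zero_cancel, rule tendsto_sandwich[OF _ _ tendsto_const])
    show "\<forall>\<^sub>F h::real in at 0. \<bar>((max 0 (0 + h))\<^sup>2 - (max 0 0)\<^sup>2) / h\<bar> \<le> \<bar>h\<bar>"
      by (intro always_eventually allI) (auto simp: max_def power2_eq_square abs_mult)
    show "((\<lambda>h::real. \<bar>h\<bar>) \<longlongrightarrow> 0) (at 0)" by (rule tendsto_rabs_zero) (rule tendsto_ident_at)
  qed auto
  then show ?thesis using True by (simp add: DERIV_def)
next
  case False
  show ?thesis
  proof (cases "t > 0")
    case True
    have "((\<lambda>t. t\<^sup>2) has_real_derivative 2 * t) (at t)" by (auto intro!: derivative_eq_intros)
    from has_field_derivative_transform_within_open[OF this, of "{0<..}" "\<lambda>t. (max 0 t)\<^sup>2"] show ?thesis using True by simp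
  next
    case f: False
    have "((\<lambda>t. 0::real) has_real_derivative 0) (at t)" by simp
    from has_field_derivative_transform_within_open[OF this, of "{..<0}" "\<lambda>t. (max 0 t)\<^sup>2"] f False show ?thesis by simp
  qed
qed

lemma bump_bounds: "0 \<le> bump n l r x" "bump n l r x \<le> 1"
proof -
  have p: "0 \<le> real n * (max 0 ((x - l) * (r - x)))\<^sup>2" by simp
  show "0 \<le> bump n l r x" unfolding bump_def using p by (intro divide_nonneg_nonneg) auto
  show "bump n l r x \<le> 1" unfolding bump_def using p by (subst divide_le_eq_1_pos) (auto simp: add_pos_nonneg)
qed

lemma bump_outside: "x \<notin> {l<..<r} \<Longrightarrow> l \<le> r \<Longrightarrow> bump n l r x = 0"
proof -
  assume "x \<notin> {l<..<r}" "l \<le> r"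
  then have "(x - l) * (r - x) \<le> 0" by (auto simp: mult_le_0_iff)
  then show ?thesis by (simp add: bump_def max_def)
qed

lemma bump_tendsto: "l \<le> r \<Longrightarrow> (\<lambda>n. bump n l r x) \<longlonglongrightarrow> indicator {l<..<r} x"
proof (cases "x \<in> {l<..<r}")
  case True
  define c where "c = (max 0 ((x - l) * (r - x)))\<^sup>2"
  have c: "c > 0" using True by (simp add: c_def)
  have "(\<lambda>n. real n * c / (1 + real n * c)) \<longlonglongrightarrow> 1" using c by real_asymp
  then show ?thesis using True by (simp add: bump_def c_def)
qed (simp add: bump_outside)

lemma C1c_bump:
  assumes "l \<le> r" shows "\<exists>b'. C1c (bump n l r) b'"
proof -
  define p where "p x = (max 0 ((x - l) * (r - x)))\<^sup>2" for x
  define p' where "p' x = 2 * max 0 ((x - l) * (r - x)) * (l + r - 2 * x)" for x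
  have p0: "0 \<le> real n * p x" for x by (simp add: p_def)
  have dp: "(p has_real_derivative p' x) (at x)" for x
  proof -
    have "((\<lambda>x. (x - l) * (r - x)) has_real_derivative (l + r - 2 * x)) (at x)"
      by (auto intro!: derivative_eq_intros simp: algebra_simps)
    from DERIV_chain2[OF has_real_derivative_max_0_sq this] show ?thesis unfolding p_def p'_def .
  qed
  have "C1c (bump n l r) (\<lambda>x. real n * p' x / (1 + real n * p x)\<^sup>2)"
    unfolding C1c_def
  proof (intro conjI allI)
    fix x
    have "((\<lambda>x. real n * p x / (1 + real n * p x)) has_real_derivative real n * p' x / (1 + real n * p x)\<^sup>2) (at x)"
      using p0[of x] by (auto intro!: derivative_eq_intros dp simp: power2_eq_square algebra_simps divide_simps)
    then show "(bump n l r has_real_derivative real n * p' x / (1 + real n * p x)\<^sup>2) (at x)"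
      by (simp add: bump_def[abs_def] p_def)
    have nz: "1 + real n * p x \<noteq> 0" for x using p0[of x] by linarith
    show "continuous_on UNIV (\<lambda>x. real n * p' x / (1 + real n * p x)\<^sup>2)"
      using nz unfolding p'_def p_def by (intro continuous_intros) auto
    show "bounded {x. bump n l r x \<noteq> 0}"
    proof (rule bounded_subset[of "{l<..<r}"])
      show "{x. bump n l r x \<noteq> 0} \<subseteq> {l<..<r}" using bump_outside[OF _ assms] by blast
    qed simp
  qed
  then show ?thesis by blast
qed

text \<open>Boxes generate the Borel sets and are stable under intersection, so inside a fixed
  large box all set integrals of \<open>f\<close> vanish by Dynkin's theorem, and
  \<open>f\<close> vanishes there.\<close>

lemma AE_zero_of_box_integrals:
  fixes f :: "real \<times> real \<Rightarrow> complex"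
  assumes f: "sqint f"
    and z: "\<And>l r c d. l \<le> r \<Longrightarrow> c \<le> d \<Longrightarrow> (LINT z|lborel. indicator ({l<..<r} \<times> {c<..<d}) z * f z) = 0"
  shows "AE z in lborel. f z = 0"
proof -
  have [measurable]: "f \<in> borel_measurable borel" using f by (auto simp: sqint_def)
  have boxes: "(LINT z|lborel. indicator (box p q) z * f z) = 0" for p q :: "real \<times> real"
  proof (cases "box p q = {}")
    case False
    then have "fst p \<le> fst q" "snd p \<le> snd q"
      by (cases p, cases q, auto simp: box_ne_empty Basis_prod_def)+
    moreover have "box p q = {fst p<..<fst q} \<times> {snd p<..<snd q}"
      by (cases p, cases q) (auto simp: box_def Basis_prod_def)
    ultimately show ?thesis using z by simp
  qed simp
  have main: "AE z in lborel. indicator (box p q) z * f z = 0" for p q :: "real \<times> real"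
  proof -
    define g where "g z = indicator (box p q) z * f z" for z
    have gi: "integrable lborel g"
      unfolding g_def by (rule sqint_mult_integrable[OF sqint_indicator f]) auto
    have gs: "set_integrable lborel A g" if "A \<in> sets lborel" for A
      unfolding set_integrable_def using that gi by (rule integrable_mult_indicator)
    show ?thesis
    proof (rule sigma_finite_measure.density_zero[OF sigma_finite_lborel gi[unfolded g_def]])
      fix A :: "(real \<times> real) set" assume "A \<in> sets lborel"
      then have A: "A \<in> sigma_sets UNIV (range (\<lambda>(a, b). box a b))" unfolding borel_eq_box by (simp add: borel_eq_box)
      have pw: "range (\<lambda>(a, b). box a b :: (real \<times> real) set) \<subseteq> Pow UNIV" by simp
      have "Int_stable (range (\<lambda>(a, b). box a b :: (real \<times> real) set))"
        by (auto simp: Int_stable_def box_Int_box)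
      then have "(LINT z:A|lborel. g z) = 0" using pw A
      proof (induction rule: sigma_sets_induct_disjoint)
        case (basic A)
        then obtain a b where A: "A = box a b" by auto
        obtain a' b' where ab: "box a b \<inter> box p q = box a' b'" by (simp add: box_Int_box)
        have "(LINT z:A|lborel. g z) = (LINT z|lborel. indicator (box a' b') z * f z)"
          unfolding set_lebesgue_integral_def A ab[symmetric] g_def
          by (intro Bochner_Integration.integral_cong) (auto simp: indicator_def)
        then show ?case using boxes by simp
      next
        case empty show ?case by (simp add: set_lebesgue_integral_def)
      next
        case (compl A)
        then have A: "A \<in> sets lborel" by (simp add: borel_eq_box)
        have "(LINT z:(A \<union> (UNIV - A))|lborel. g z) = (LINT z:A|lborel. g z) + (LINT z:(UNIV - A)|lborel. g z)"
          using A by (intro set_integral_Un gs) auto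
        moreover have "(LINT z:(A \<union> (UNIV - A))|lborel. g z) = 0"
          using boxes[of p q] by (simp add: set_lebesgue_integral_def g_def)
        ultimately show ?case using compl by simp
      next
        case (union F)
        then have F: "F i \<in> sets lborel" for i by (auto simp: borel_eq_box)
        have "(LINT z:(\<Union>i. F i)|lborel. g z) = (\<Sum>i. (LINT z:(F i)|lborel. g z))"
          using union F by (intro lebesgue_integral_countable_add gs) (auto simp: disjoint_family_on_def)
        then show ?case using union by simp
      qed
      then show "(LINT z:A|lborel. indicator (box p q) z * f z) = 0" by (simp add: g_def)
    qed
  qed
  have "AE z in lborel. \<forall>n::nat. indicator (box (- real n, - real n) (real n, real n)) z * f z = 0"
    unfolding AE_all_countable using main by blast
  then show ?thesis
  proof eventually_elim
    case (elim z)
    obtain x y where xy: "z = (x, y)" by (cases z)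
    obtain n :: nat where "max \<bar>x\<bar> \<bar>y\<bar> < real n" using reals_Archimedean2 by blast
    then have "z \<in> box (- real n, - real n) (real n, real n)" by (auto simp: xy box_def Basis_prod_def abs_less_iff)
    then show ?case using elim[rule_format, of n] by simp
  qed
qed

text \<open>Fundamental lemma of the calculus of variations, tested with tensor products of bumps
  only.\<close>

lemma AE_zero_of_bump_integrals:
  fixes f :: "real \<times> real \<Rightarrow> complex"
  assumes f: "sqint f"
    and z: "\<And>l r c d n. l \<le> r \<Longrightarrow> c \<le> d \<Longrightarrow> (LINT z|lborel. complex_of_real (bump n l r (fst z) * bump n c d (snd z)) * f z) = 0"
  shows "AE z in lborel. f z = 0"
proof (rule AE_zero_of_box_integrals[OF f])
  fix l r c d :: real assume lr: "l \<le> r" "c \<le> d"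
  have [measurable]: "f \<in> borel_measurable borel" using f by (auto simp: sqint_def)
  let ?K = "{l<..<r} \<times> {c<..<d}"
  have Ks: "sqint (\<lambda>z. indicator ?K z :: complex)"
    by (rule sqint_indicator) (auto intro!: bounded_Times borel_open open_Times)
  have dom: "integrable lborel (\<lambda>z. cmod (indicator ?K z * f z))"
    by (intro integrable_norm sqint_mult_integrable[OF Ks f])
  have bm [measurable]: "bump n l r \<in> borel_measurable borel" for n l r
    unfolding bump_def by measurable
  have "(\<lambda>n. LINT z|lborel. complex_of_real (bump n l r (fst z) * bump n c d (snd z)) * f z)
     \<longlonglongrightarrow> (LINT z|lborel. indicator ?K z * f z)"
  proof (rule integral_dominated_convergence[OF _ _ dom])
    show "(\<lambda>z. indicator ?K z * f z) \<in> borel_measurable lborel"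
      using Ks by (auto simp: sqint_def)
    show "AE z in lborel. (\<lambda>n. complex_of_real (bump n l r (fst z) * bump n c d (snd z)) * f z) \<longlonglongrightarrow> indicator ?K z * f z"
    proof (rule AE_I2)
      fix z :: "real \<times> real"
      have "(\<lambda>n. complex_of_real (bump n l r (fst z) * bump n c d (snd z)) * f z)
        \<longlonglongrightarrow> complex_of_real (indicator {l<..<r} (fst z) * indicator {c<..<d} (snd z)) * f z"
        by (intro tendsto_intros bump_tendsto lr)
      moreover have "complex_of_real (indicator {l<..<r} (fst z) * indicator {c<..<d} (snd z)) = indicator ?K z"
        by (cases z) (auto simp: indicator_def)
      ultimately show "(\<lambda>n. complex_of_real (bump n l r (fst z) * bump n c d (snd z)) * f z) \<longlonglongrightarrow> indicator ?K z * f z"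
        by simp
    qed
    show "AE z in lborel. norm (complex_of_real (bump n l r (fst z) * bump n c d (snd z)) * f z) \<le> cmod (indicator ?K z * f z)" for n
    proof (rule AE_I2)
      fix z :: "real \<times> real"
      show "norm (complex_of_real (bump n l r (fst z) * bump n c d (snd z)) * f z) \<le> cmod (indicator ?K z * f z)"
      proof (cases "z \<in> ?K")
        case True
        have "bump n l r (fst z) * bump n c d (snd z) \<le> 1 * 1" by (intro mult_mono bump_bounds) auto
        then show ?thesis using True bump_bounds(1)
          by (simp add: norm_mult abs_mult mult_left_le_one_le abs_of_nonneg)
      next
        case False
        then have "bump n l r (fst z) * bump n c d (snd z) = 0"
          using bump_outside[of "fst z" l r n] bump_outside[of "snd z" c d n] lr by (cases z) auto
        then show ?thesis by (simp only: of_real_0 mult_zero_left norm_zero norm_ge_zero)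
      qed
    qed
  qed measurable
  then have "(\<lambda>n::nat. 0) \<longlonglongrightarrow> (LINT z|lborel. indicator ?K z * f z)" by (simp only: z[OF lr])
  from LIMSEQ_unique[OF this tendsto_const] show "(LINT z|lborel. indicator ?K z * f z) = 0" .
qed

lemma has_weak_dx_unique:
  assumes u: "sqint u" "has_weak_dx u w" "has_weak_dx u y"
  shows "AE z in lborel. w z = y z"
proof -
  have wy: "sqint w" "sqint y" using u has_weak_dx_sqint by blast+
  have "AE z in lborel. w z - y z = 0"
  proof (rule AE_zero_of_bump_integrals)
    show "sqint (\<lambda>z. w z - y z)" using wy by auto
    fix l r c d :: real and n assume lr: "l \<le> r" "c \<le> d"
    obtain a' b' where ab: "C1c (bump n l r) a'" "C1c (bump n c d) b'" using C1c_bump lr by meson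
    note t = test_fun_product[OF ab]
    show "(LINT z|lborel. complex_of_real (bump n l r (fst z) * bump n c d (snd z)) * (w z - y z)) = 0"
      using has_weak_dxD[OF u(2) t] has_weak_dxD[OF u(3) t]
        sqint_mult_integrable[OF test_fun_sqint(1)[OF t] wy(1)] sqint_mult_integrable[OF test_fun_sqint(1)[OF t] wy(2)]
      by (simp add: right_diff_distrib scaleR_conv_of_real)
  qed
  then show ?thesis by simp
qed

section \<open>Differences as integrals of the weak derivative\<close>

lemma borel_measurable_pair_continuous:
  fixes g :: "'a::euclidean_space \<times> 'b::euclidean_space \<Rightarrow> 'c::euclidean_space"
    and w :: "'c \<Rightarrow> complex"
  assumes "w \<in> borel_measurable borel" "continuous_on UNIV g"
  shows "(\<lambda>p. w (g p)) \<in> borel_measurable (borel \<Otimes>\<^sub>M borel)"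
proof -
  have "g \<in> borel_measurable borel" using assms(2) by (rule borel_measurable_continuous_onI)
  then have "(\<lambda>p. w (g p)) \<in> borel_measurable borel" using assms(1) by measurable
  then show ?thesis by (simp add: borel_prod)
qed

lemma ennreal_cmod_integral_le:
  "ennreal (cmod (LINT x|M. f x)) \<le> (\<integral>\<^sup>+x. ennreal (cmod (f x)) \<partial>M)"
proof (cases "integrable M f")
  case True
  then show ?thesis using integral_norm_bound_ennreal by blast
qed (simp add: not_integrable_integral_eq)

text \<open>Minkowski's integral inequality for a superposition over a set of finite measure,
  from Cauchy-Schwarz in \<open>\<zeta>\<close> and Tonelli's theorem.\<close>

lemma nsq_set_integral_le:
  fixes f :: "'a::euclidean_space \<Rightarrow> 'b::euclidean_space \<Rightarrow> complex"
  assumes m [measurable]: "(\<lambda>x. f (fst x) (snd x)) \<in> borel_measurable (borel \<Otimes>\<^sub>M borel)"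
    and K [measurable]: "K \<in> sets borel"
    and C: "\<And>\<zeta>. \<zeta> \<in> K \<Longrightarrow> nsq (\<lambda>z. f z \<zeta>) \<le> C"
  shows "nsq (\<lambda>z. LINT \<zeta>|lborel. indicator K \<zeta> * f z \<zeta>) \<le> (emeasure lborel K)\<^sup>2 * C"
proof -
  let ?m = "emeasure lborel K" and ?g = "\<lambda>z \<zeta>. indicator K \<zeta> * ennreal ((cmod (f z \<zeta>))\<^sup>2)"
  have [measurable]: "(\<lambda>z. f z \<zeta>) \<in> borel_measurable borel" "f z \<in> borel_measurable borel" for z \<zeta>
    using measurable_compose[OF measurable_Pair2' m, of \<zeta>] measurable_compose[OF measurable_Pair1' m, of z] by simp_all
  have pt: "ennreal ((cmod (LINT \<zeta>|lborel. indicator K \<zeta> * f z \<zeta>))\<^sup>2) \<le> ?m * (\<integral>\<^sup>+\<zeta>. ?g z \<zeta> \<partial>lborel)" for z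
  proof -
    have "ennreal (cmod (LINT \<zeta>|lborel. indicator K \<zeta> * f z \<zeta>)) \<le> (\<integral>\<^sup>+\<zeta>. ennreal (cmod (indicator K \<zeta> * f z \<zeta>)) \<partial>lborel)"
      by (rule ennreal_cmod_integral_le)
    also have "\<dots> = (\<integral>\<^sup>+\<zeta>. indicator K \<zeta> * (indicator K \<zeta> * ennreal (cmod (f z \<zeta>))) \<partial>lborel)"
      by (intro nn_integral_cong) (auto simp: indicator_def)
    finally have "(ennreal (cmod (LINT \<zeta>|lborel. indicator K \<zeta> * f z \<zeta>)))\<^sup>2 \<le> (\<integral>\<^sup>+\<zeta>. indicator K \<zeta> * (indicator K \<zeta> * ennreal (cmod (f z \<zeta>))) \<partial>lborel)\<^sup>2"
      by (rule power_mono) auto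
    also have "\<dots> \<le> (\<integral>\<^sup>+\<zeta>. (indicator K \<zeta>)\<^sup>2 \<partial>lborel) * (\<integral>\<^sup>+\<zeta>. (indicator K \<zeta> * ennreal (cmod (f z \<zeta>)))\<^sup>2 \<partial>lborel)"
      by (rule Cauchy_Schwarz_nn_integral) auto
    also have "(\<integral>\<^sup>+\<zeta>. (indicator K \<zeta> :: ennreal)\<^sup>2 \<partial>lborel) = (\<integral>\<^sup>+\<zeta>. indicator K \<zeta> \<partial>lborel)"
      by (intro nn_integral_cong) (auto simp: indicator_def)
    also have "(\<integral>\<^sup>+\<zeta>. (indicator K \<zeta> * ennreal (cmod (f z \<zeta>)))\<^sup>2 \<partial>lborel) = (\<integral>\<^sup>+\<zeta>. ?g z \<zeta> \<partial>lborel)"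
      by (intro nn_integral_cong) (auto simp: indicator_def ennreal_power)
    finally show ?thesis by (simp add: ennreal_power)
  qed
  have "nsq (\<lambda>z. LINT \<zeta>|lborel. indicator K \<zeta> * f z \<zeta>) \<le> (\<integral>\<^sup>+z. ?m * (\<integral>\<^sup>+\<zeta>. ?g z \<zeta> \<partial>lborel) \<partial>lborel)"
    unfolding nsq_def by (intro nn_integral_mono pt)
  also have "\<dots> = ?m * (\<integral>\<^sup>+z. (\<integral>\<^sup>+\<zeta>. ?g z \<zeta> \<partial>lborel) \<partial>lborel)"
    by (rule nn_integral_cmult) measurable
  also have "(\<integral>\<^sup>+z. (\<integral>\<^sup>+\<zeta>. ?g z \<zeta> \<partial>lborel) \<partial>lborel) = (\<integral>\<^sup>+\<zeta>. (\<integral>\<^sup>+z. ?g z \<zeta> \<partial>lborel) \<partial>lborel)"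
    by (rule lborel_pair.Fubini'[symmetric]) measurable
  also have "?m * (\<integral>\<^sup>+\<zeta>. (\<integral>\<^sup>+z. ?g z \<zeta> \<partial>lborel) \<partial>lborel) \<le> ?m * (\<integral>\<^sup>+\<zeta>. C * indicator K \<zeta> \<partial>lborel)"
  proof (intro mult_left_mono nn_integral_mono)
    fix \<zeta>
    have "(\<integral>\<^sup>+z. ?g z \<zeta> \<partial>lborel) = indicator K \<zeta> * nsq (\<lambda>z. f z \<zeta>)"
      unfolding nsq_def by (intro nn_integral_cmult) measurable
    then show "(\<integral>\<^sup>+z. ?g z \<zeta> \<partial>lborel) \<le> C * indicator K \<zeta>" using C[of \<zeta>] by (cases "\<zeta> \<in> K") auto
  qed simp
  also have "(\<integral>\<^sup>+\<zeta>. C * indicator K \<zeta> \<partial>lborel) = C * ?m" by (simp add: nn_integral_cmult_indicator)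
  finally show ?thesis by (simp add: power2_eq_square mult_ac)
qed

lemma integrable_shifted_product:
  fixes p q :: "real \<times> real \<Rightarrow> complex" and k :: "real \<Rightarrow> real \<times> real"
  assumes p: "sqint p" and q: "sqint q" and k: "continuous_on UNIV k"
  shows "integrable (lborel \<Otimes>\<^sub>M lborel) (\<lambda>(z, r). indicator {0..s} r * (p z * q (z + k r)))"
proof (rule integrableI_bounded)
  have [measurable]: "p \<in> borel_measurable borel" "q \<in> borel_measurable borel" using p q by (auto simp: sqint_def)
  have km: "(\<lambda>x. q (fst x + k (snd x))) \<in> borel_measurable (borel \<Otimes>\<^sub>M borel)"
    by (rule borel_measurable_pair_continuous)
      (auto intro!: continuous_intros continuous_on_compose2[OF k])
  note [measurable] = km
  show m: "(\<lambda>(z, r). indicator {0..s} r * (p z * q (z + k r))) \<in> borel_measurable (lborel \<Otimes>\<^sub>M lborel)"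
    by measurable
  have "(\<integral>\<^sup>+x. ennreal (norm (case x of (z, r) \<Rightarrow> indicator {0..s} r * (p z * q (z + k r)))) \<partial>(lborel \<Otimes>\<^sub>M lborel))
    = (\<integral>\<^sup>+r. \<integral>\<^sup>+z. ennreal (norm (indicator {0..s} r * (p z * q (z + k r)))) \<partial>lborel \<partial>lborel)"
    using m by (subst lborel_pair.nn_integral_snd[symmetric]) auto
  also have "\<dots> \<le> (\<integral>\<^sup>+r. (nsq p + nsq q) * indicator {0..s} r \<partial>lborel)"
  proof (rule nn_integral_mono)
    fix r
    have "(\<integral>\<^sup>+z. ennreal (norm (indicator {0..s} r * (p z * q (z + k r)))) \<partial>lborel)
      \<le> (\<integral>\<^sup>+z. (ennreal ((cmod (p z))\<^sup>2) + ennreal ((cmod (q (z + k r)))\<^sup>2)) * indicator {0..s} r \<partial>lborel)"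
    proof (rule nn_integral_mono)
      fix z
      have "cmod (p z) * cmod (q (z + k r)) \<le> (cmod (p z))\<^sup>2 + (cmod (q (z + k r)))\<^sup>2"
        using sum_squares_bound[of "cmod (p z)" "cmod (q (z + k r))"]
          mult_nonneg_nonneg[OF norm_ge_zero norm_ge_zero, of "p z" "q (z + k r)"] by linarith
      then show "ennreal (norm (indicator {0..s} r * (p z * q (z + k r))))
        \<le> (ennreal ((cmod (p z))\<^sup>2) + ennreal ((cmod (q (z + k r)))\<^sup>2)) * indicator {0..s} r"
        by (auto simp: indicator_def norm_mult simp flip: ennreal_plus intro!: ennreal_leI)
    qed
    also have "\<dots> = (nsq p + nsq (\<lambda>z. q (z + k r))) * indicator {0..s} r"
      unfolding nsq_def by (simp add: nn_integral_multc nn_integral_add)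
    also have "nsq (\<lambda>z. q (z + k r)) = nsq q" by (rule nsq_translate) auto
    finally show "(\<integral>\<^sup>+z. ennreal (norm (indicator {0..s} r * (p z * q (z + k r)))) \<partial>lborel) \<le> (nsq p + nsq q) * indicator {0..s} r" .
  qed
  also have "\<dots> < \<infinity>"
    using p q by (simp add: nn_integral_cmult_indicator ennreal_mult_less_top sqint_def emeasure_lborel_Icc_eq)
  finally show "(\<integral>\<^sup>+x. ennreal (norm (case x of (z, r) \<Rightarrow> indicator {0..s} r * (p z * q (z + k r)))) \<partial>(lborel \<Otimes>\<^sub>M lborel)) < \<infinity>" .
qed

text \<open>The integral of \<open>w\<close> over the horizontal segment of length
  \<open>s\<close> that starts at \<open>z\<close>.\<close>

definition x_integral :: "real \<Rightarrow> (real \<times> real \<Rightarrow> complex) \<Rightarrow> real \<times> real \<Rightarrow> complex" where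
  "x_integral s w z = (LINT r|lborel. indicator {0..s} r * w (z + (r, 0)))"

lemma x_integral_measurable [measurable]:
  assumes w: "w \<in> borel_measurable borel"
  shows "x_integral s w \<in> borel_measurable borel"
proof -
  have [measurable]: "(\<lambda>x. w (fst x + (snd x, 0))) \<in> borel_measurable (borel \<Otimes>\<^sub>M borel)"
    by (rule borel_measurable_pair_continuous[OF w]) (intro continuous_intros)
  have "(\<lambda>z. LINT r|lborel. indicator {0..s} r * w (z + (r, 0))) \<in> borel_measurable borel"
    by measurable
  then show ?thesis by (simp add: x_integral_def[abs_def])
qed

lemma nsq_x_integral:
  assumes w: "w \<in> borel_measurable borel" and s: "s \<ge> 0"
  shows "nsq (x_integral s w) \<le> ennreal (s\<^sup>2) * nsq w"
proof -
  have "(\<lambda>x. w (fst x + (snd x, 0))) \<in> borel_measurable (borel \<Otimes>\<^sub>M borel)"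
    by (rule borel_measurable_pair_continuous[OF w]) (intro continuous_intros)
  then have "nsq (x_integral s w) \<le> (emeasure lborel {0..s})\<^sup>2 * nsq w"
    unfolding x_integral_def[abs_def] by (rule nsq_set_integral_le) (auto simp: nsq_translate[OF w])
  then show ?thesis using s by (simp add: ennreal_power)
qed

text \<open>The convolution of \<open>a\<close> with an indicator is a primitive of the
  difference of \<open>a\<close> and its translate, and again has compact support. It serves as
  the \<open>x\<close> factor of a test function.\<close>

lemma C1c_window_primitive:
  assumes a: "continuous_on UNIV a" "\<And>x. x \<notin> {l<..<r} \<Longrightarrow> a x = 0" and s: "s \<ge> 0"
  shows "C1c (\<lambda>x. LINT \<rho>|lborel. a (x - \<rho>) * indicator {0..s} \<rho>) (\<lambda>x. a x - a (x - s))"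
proof -
  have ac: "isCont a x" for x using a(1) by (simp add: continuous_on_eq_continuous_at)
  obtain A where "\<forall>x::real. -\<infinity> < ereal x \<longrightarrow> ereal x < \<infinity> \<longrightarrow> (A has_vector_derivative a x) (at x)"
    using einterval_antiderivative[of "-\<infinity>" "\<infinity>" a] ac by auto
  then have A: "(A has_real_derivative a x) (at x)" for x by (simp add: has_real_derivative_iff_has_vector_derivative)
  have eq: "(LINT \<rho>|lborel. a (x - \<rho>) * indicator {0..s} \<rho>) = A x - A (x - s)" for x
  proof -
    have "((\<lambda>\<rho>. - A (x - \<rho>)) has_real_derivative a (x - \<rho>)) (at \<rho>)" for \<rho>
      by (rule derivative_eq_intros DERIV_chain2[OF A] refl | simp)+
    moreover have "isCont (\<lambda>\<rho>. a (x - \<rho>)) \<rho>" for \<rho>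
      by (intro isCont_o2[OF _ ac]) (intro continuous_intros)
    ultimately have "(LINT \<rho>|lborel. a (x - \<rho>) * indicator {0..s} \<rho>) = - A (x - s) - (- A (x - 0))"
      using s by (intro integral_FTC_Icc_real) auto
    then show ?thesis by simp
  qed
  show ?thesis
    unfolding C1c_def
  proof (intro conjI allI)
    fix x
    show "((\<lambda>x. LINT \<rho>|lborel. a (x - \<rho>) * indicator {0..s} \<rho>) has_real_derivative a x - a (x - s)) (at x)"
      unfolding eq by (rule derivative_eq_intros A DERIV_chain2[OF A] refl | simp)+
    show "continuous_on UNIV (\<lambda>x. a x - a (x - s))"
      by (intro continuous_intros a continuous_on_compose2[OF a(1)]) auto
    show "bounded {x. (LINT \<rho>|lborel. a (x - \<rho>) * indicator {0..s} \<rho>) \<noteq> 0}"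
    proof (rule bounded_subset[of "{l..r+s}"])
      have "(LINT \<rho>|lborel. a (x - \<rho>) * indicator {0..s} \<rho>) = 0" if "x \<notin> {l..r+s}" for x
      proof -
        have "a (x - \<rho>) * indicator {0..s} \<rho> = 0" for \<rho>
          using a(2)[of "x - \<rho>"] that s by (auto simp: indicator_def)
        then show ?thesis by (simp only: Bochner_Integration.integral_zero)
      qed
      then show "{x. (LINT \<rho>|lborel. a (x - \<rho>) * indicator {0..s} \<rho>) \<noteq> 0} \<subseteq> {l..r+s}" by blast
    qed simp
  qed
qed

text \<open>The fundamental theorem of calculus for weak derivatives. Testing with
  \<open>\<Phi>(x) b(y)\<close>, where \<open>\<Phi>\<close> is the primitive of \<open>a -
  a(\<cdot> - s)\<close> from \<open>C1c_window_primitive\<close>, moves the difference from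
  \<open>a\<close> to \<open>u\<close> on one side and, by Fubini, turns \<open>\<Phi>\<close>
  into an integral over translates of \<open>w\<close> on the other.\<close>

lemma weak_dx_difference:
  assumes u: "sqint u" "has_weak_dx u w" and s: "s \<ge> 0"
  shows "AE z in lborel. u (z + (s, 0)) - u z = x_integral s w z"
proof -
  have w: "sqint w" using u has_weak_dx_sqint by blast
  have [measurable]: "u \<in> borel_measurable borel" "w \<in> borel_measurable borel" using u w by (auto simp: sqint_def)
  have xs: "sqint (x_integral s w)"
    unfolding sqint_def using w nsq_x_integral[of w s] s
    by (auto simp: sqint_def ennreal_mult_less_top intro!: x_integral_measurable le_less_trans[OF nsq_x_integral])
  have us: "sqint (\<lambda>z. u (z + (s, 0)))" using u by auto
  have "AE z in lborel. u (z + (s, 0)) - u z - x_integral s w z = 0"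
  proof (rule AE_zero_of_bump_integrals)
    show "sqint (\<lambda>z. u (z + (s, 0)) - u z - x_integral s w z)" by (intro sqint_diff us u xs)
    fix l r c d :: real and n assume lr: "l \<le> r" "c \<le> d"
    define a where "a = bump n l r"
    define b where "b = bump n c d"
    obtain a' b' where ab: "C1c a a'" "C1c b b'" using C1c_bump lr unfolding a_def b_def by meson
    define \<Phi> where "\<Phi> x = (LINT \<rho>|lborel. a (x - \<rho>) * indicator {0..s} \<rho>)" for x
    have ac: "continuous_on UNIV a" by (rule C1c_continuous[OF ab(1)])
    have bc: "continuous_on UNIV b" by (rule C1c_continuous[OF ab(2)])
    have C: "C1c \<Phi> (\<lambda>x. a x - a (x - s))"
      unfolding \<Phi>_def[abs_def] by (rule C1c_window_primitive[OF ac _ s, of l r]) (use bump_outside lr in \<open>auto simp: a_def\<close>)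
    note t = test_fun_product[OF C ab(2)]
    define p where "p z = complex_of_real (a (fst z) * b (snd z))" for z
    have p: "sqint p" unfolding p_def[abs_def] by (rule test_fun_sqint(1)[OF test_fun_product[OF ab]])
    have [measurable]: "p \<in> borel_measurable borel" using p by (auto simp: sqint_def)
    have 1: "(LINT z|lborel. complex_of_real ((a (fst z) - a (fst z - s)) * b (snd z)) * u z)
      = - (LINT z|lborel. complex_of_real (\<Phi> (fst z) * b (snd z)) * w z)"
      using has_weak_dxD[OF u(2) t] by (simp only: scaleR_conv_of_real)
    have pm: "sqint (\<lambda>z. p (z - (s, 0)))" using sqint_translate[OF p, of "- (s, 0)"] by (simp only: diff_conv_add_uminus)
    have "(LINT z|lborel. complex_of_real ((a (fst z) - a (fst z - s)) * b (snd z)) * u z)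
      = (LINT z|lborel. p z * u z - p (z - (s, 0)) * u z)"
      by (simp add: p_def algebra_simps)
    also have "\<dots> = (LINT z|lborel. p z * u z) - (LINT z|lborel. p (z - (s, 0)) * u z)"
      by (intro Bochner_Integration.integral_diff sqint_mult_integrable p pm u)
    also have "(LINT z|lborel. p (z - (s, 0)) * u z) = (LINT z|lborel. p z * u (z + (s, 0)))"
      using lebesgue_integral_lborel_translate[of "\<lambda>z. p (z - (s, 0)) * u z" "(s, 0)"] by simp
    finally have 2: "(LINT z|lborel. p z * u (z + (s, 0))) - (LINT z|lborel. p z * u z)
       = (LINT z|lborel. complex_of_real (\<Phi> (fst z) * b (snd z)) * w z)"
      unfolding 1 by (simp add: algebra_simps)
    have I1: "integrable (lborel \<Otimes>\<^sub>M lborel) (\<lambda>(z, \<rho>). indicator {0..s} \<rho> * (p z * w (z + (\<rho>, 0))))"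
      by (rule integrable_shifted_product[OF p w]) (intro continuous_intros)
    have I2: "integrable (lborel \<Otimes>\<^sub>M lborel) (\<lambda>(z, \<rho>). indicator {0..s} \<rho> * (w z * p (z + (- \<rho>, 0))))"
      by (rule integrable_shifted_product[OF w p]) (intro continuous_intros)
    \<comment> \<open>Fubini twice, with a translation in \<open>z\<close> in between.\<close>
    have "(LINT z|lborel. p z * x_integral s w z) = (LINT z|lborel. LINT \<rho>|lborel. indicator {0..s} \<rho> * (p z * w (z + (\<rho>, 0))))"
      unfolding x_integral_def by (simp only: integral_mult_right_zero[symmetric] mult.left_commute)
    also have "\<dots> = (LINT \<rho>|lborel. LINT z|lborel. indicator {0..s} \<rho> * (p z * w (z + (\<rho>, 0))))"
      by (rule lborel_pair.Fubini_integral[OF I1, symmetric])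
    also have "\<dots> = (LINT \<rho>|lborel. LINT z|lborel. indicator {0..s} \<rho> * (w z * p (z + (- \<rho>, 0))))"
    proof (rule Bochner_Integration.integral_cong[OF refl])
      fix \<rho> :: real
      show "(LINT z|lborel. indicator {0..s} \<rho> * (p z * w (z + (\<rho>, 0)))) = (LINT z|lborel. indicator {0..s} \<rho> * (w z * p (z + (- \<rho>, 0))))"
        using lebesgue_integral_lborel_translate[of "\<lambda>z. indicator {0..s} \<rho> * (w z * p (z + (- \<rho>, 0)))" "(\<rho>, 0)"]
        by (simp add: add.assoc mult.commute flip: zero_prod_def)
    qed
    also have "\<dots> = (LINT z|lborel. LINT \<rho>|lborel. indicator {0..s} \<rho> * (w z * p (z + (- \<rho>, 0))))"
      by (rule lborel_pair.Fubini_integral[OF I2])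
    also have "\<dots> = (LINT z|lborel. complex_of_real (\<Phi> (fst z) * b (snd z)) * w z)"
    proof (rule Bochner_Integration.integral_cong[OF refl])
      fix z :: "real \<times> real"
      have "(LINT \<rho>|lborel. indicator {0..s} \<rho> * (w z * p (z + (- \<rho>, 0))))
        = (LINT \<rho>|lborel. complex_of_real (a (fst z - \<rho>) * indicator {0..s} \<rho>) * (complex_of_real (b (snd z)) * w z))"
        by (intro Bochner_Integration.integral_cong) (auto simp: p_def indicator_def)
      also have "\<dots> = (LINT \<rho>|lborel. complex_of_real (a (fst z - \<rho>) * indicator {0..s} \<rho>)) * (complex_of_real (b (snd z)) * w z)"
        by (rule integral_mult_left_zero)
      also have "(LINT \<rho>|lborel. complex_of_real (a (fst z - \<rho>) * indicator {0..s} \<rho>)) = complex_of_real (\<Phi> (fst z))"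
        unfolding \<Phi>_def by (rule integral_complex_of_real)
      finally show "(LINT \<rho>|lborel. indicator {0..s} \<rho> * (w z * p (z + (- \<rho>, 0)))) = complex_of_real (\<Phi> (fst z) * b (snd z)) * w z"
        by simp
    qed
    finally have 3: "(LINT z|lborel. p z * x_integral s w z) = (LINT z|lborel. complex_of_real (\<Phi> (fst z) * b (snd z)) * w z)" .
    have "(LINT z|lborel. p z * (u (z + (s, 0)) - u z - x_integral s w z))
      = (LINT z|lborel. p z * u (z + (s, 0))) - (LINT z|lborel. p z * u z) - (LINT z|lborel. p z * x_integral s w z)"
      using sqint_mult_integrable[OF p us] sqint_mult_integrable[OF p u(1)] sqint_mult_integrable[OF p xs]
      by (simp add: right_diff_distrib)
    also have "\<dots> = 0" unfolding 2 3 by simp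
    finally show "(LINT z|lborel. complex_of_real (bump n l r (fst z) * bump n c d (snd z)) * (u (z + (s, 0)) - u z - x_integral s w z)) = 0"
      unfolding p_def a_def b_def .
  qed
  then show ?thesis by (auto elim!: eventually_mono)
qed

lemma nsq_translate_x:
  assumes u: "sqint u" "has_weak_dx u w" and s: "s \<ge> 0"
  shows "nsq (\<lambda>z. u (z + (s, 0)) - u z) \<le> ennreal (s\<^sup>2) * nsq w"
proof -
  have w: "w \<in> borel_measurable borel" using u has_weak_dx_sqint by (auto simp: sqint_def)
  have "nsq (\<lambda>z. u (z + (s, 0)) - u z) = nsq (x_integral s w)"
    by (rule nsq_cong_AE[OF weak_dx_difference[OF u s]])
  then show ?thesis using nsq_x_integral[OF w s] by simp
qed

section \<open>The quadratic form and the energy space\<close>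

text \<open>The real value of \<open>nsq\<close> on square-integrable functions; the quadratic
  form is a sum of such terms.\<close>

definition rnsq :: "('a::euclidean_space \<Rightarrow> complex) \<Rightarrow> real" where
  "rnsq f = (LINT z|lborel. (cmod (f z))\<^sup>2)"

lemma rnsq_nonneg [simp]: "0 \<le> rnsq f"
  by (simp add: rnsq_def)

lemma nsq_rnsq: "sqint f \<Longrightarrow> nsq f = ennreal (rnsq f)"
  by (simp add: rnsq_def nsq_eq_integral)

lemma rnsq_cong_AE:
  assumes "f \<in> borel_measurable borel" "g \<in> borel_measurable borel" "AE z in lborel. f z = g z"
  shows "rnsq f = rnsq g"
  unfolding rnsq_def using assms by (intro integral_cong_AE) (auto elim!: eventually_mono)

lemma rnsq_le_iff: "sqint f \<Longrightarrow> sqint g \<Longrightarrow> c \<ge> 0 \<Longrightarrow> rnsq f \<le> c * rnsq g \<longleftrightarrow> nsq f \<le> ennreal c * nsq g"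
  by (simp add: nsq_rnsq flip: ennreal_mult)

lemma rnsq_parallelogram:
  assumes "sqint f" "sqint g"
  shows "rnsq (\<lambda>z. f z + g z) + rnsq (\<lambda>z. f z - g z) = 2 * rnsq f + 2 * rnsq g"
proof -
  have i: "integrable lborel (\<lambda>z. (cmod (h z))\<^sup>2)" if "sqint h" for h :: "'a \<Rightarrow> complex"
    using that by (simp add: sqint_iff_integrable)
  have "rnsq (\<lambda>z. f z + g z) + rnsq (\<lambda>z. f z - g z) = (LINT z|lborel. (cmod (f z + g z))\<^sup>2 + (cmod (f z - g z))\<^sup>2)"
    unfolding rnsq_def by (rule Bochner_Integration.integral_add[symmetric]) (intro i sqint_add sqint_diff assms)+
  also have "\<dots> = (LINT z|lborel. 2 * (cmod (f z))\<^sup>2 + 2 * (cmod (g z))\<^sup>2)"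
  proof (rule Bochner_Integration.integral_cong[OF refl])
    fix z
    show "(cmod (f z + g z))\<^sup>2 + (cmod (f z - g z))\<^sup>2 = 2 * (cmod (f z))\<^sup>2 + 2 * (cmod (g z))\<^sup>2"
      by (simp only: cmod_power2 plus_complex.sel minus_complex.sel) (simp add: power2_eq_square algebra_simps)
  qed
  also have "\<dots> = 2 * rnsq f + 2 * rnsq g"
    unfolding rnsq_def using i[OF assms(1)] i[OF assms(2)] by simp
  finally show ?thesis .
qed

lemma rnsq_cmult: "rnsq (\<lambda>z. c * f z) = (cmod c)\<^sup>2 * rnsq f"
  by (simp add: rnsq_def norm_mult power_mult_distrib)

lemma rnsq_add_le:
  assumes "sqint f" "sqint g" "t > 0"
  shows "rnsq (\<lambda>z. f z + g z) \<le> (1 + t) * rnsq f + (1 + 1/t) * rnsq g"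
proof -
  have "nsq (\<lambda>z. f z + g z) \<le> ennreal (1 + t) * nsq f + ennreal (1 + 1/t) * nsq g"
    using assms by (intro nsq_add_le_weighted) (auto simp: sqint_def)
  then show ?thesis
    using assms by (simp add: nsq_rnsq sqint_add flip: ennreal_mult ennreal_plus)
qed

lemma rnsq_translate:
  assumes "f \<in> borel_measurable borel"
  shows "rnsq (\<lambda>z. f (z + c)) = rnsq f"
proof -
  have "rnsq g = enn2real (nsq g)" if [measurable]: "g \<in> borel_measurable borel" for g :: "'a \<Rightarrow> complex"
    unfolding rnsq_def nsq_def by (rule integral_eq_nn_integral) auto
  then show ?thesis using nsq_translate[OF assms] assms by simp
qed

text \<open>Multiplication by the square root of the symbol \<open>\<bar>\<eta>\<bar> +
  v\<eta>\<close>, which is nonnegative for \<open>\<bar>v\<bar> < 1\<close>. It writes the part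
  of the quadratic form in \<open>y\<close> as a squared norm; \<open>v = 0\<close> gives the
  half energy.\<close>

definition weighted :: "real \<Rightarrow> (real \<times> real \<Rightarrow> complex) \<Rightarrow> real \<times> real \<Rightarrow> complex" where
  "weighted v F z = of_real (sqrt (\<bar>snd z\<bar> + v * snd z)) * F z"

text \<open>The condition \<open>\<bar>v\<bar> < 1\<close> makes the symbol comparable with
  \<open>\<bar>\<eta>\<bar>\<close>, hence the quadratic form comparable with the norm of
  \<open>X\<close>.\<close>

lemma weighted_symbol:
  fixes v \<eta> :: real
  shows "\<bar>v\<bar> < 1 \<Longrightarrow> (1 - \<bar>v\<bar>) * \<bar>\<eta>\<bar> \<le> \<bar>\<eta>\<bar> + v * \<eta>" "\<bar>v\<bar> < 1 \<Longrightarrow> 0 \<le> \<bar>\<eta>\<bar> + v * \<eta>"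
  "\<bar>v\<bar> < 1 \<Longrightarrow> \<bar>\<eta>\<bar> + v * \<eta> \<le> 2 * \<bar>\<eta>\<bar>"
proof -
  assume v: "\<bar>v\<bar> < 1"
  have a: "\<bar>v * \<eta>\<bar> = \<bar>v\<bar> * \<bar>\<eta>\<bar>" by (simp add: abs_mult)
  have b: "\<bar>v\<bar> * \<bar>\<eta>\<bar> \<le> 1 * \<bar>\<eta>\<bar>" using v by (intro mult_right_mono) auto
  show "(1 - \<bar>v\<bar>) * \<bar>\<eta>\<bar> \<le> \<bar>\<eta>\<bar> + v * \<eta>" using a by (simp add: left_diff_distrib)
  show "0 \<le> \<bar>\<eta>\<bar> + v * \<eta>" "\<bar>\<eta>\<bar> + v * \<eta> \<le> 2 * \<bar>\<eta>\<bar>" using a b by linarith+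
qed

lemma weighted_measurable [measurable]:
  assumes [measurable]: "F \<in> borel_measurable borel"
  shows "weighted v F \<in> borel_measurable borel"
  unfolding weighted_def by measurable

lemma weighted_cmod: "\<bar>v\<bar> < 1 \<Longrightarrow> (cmod (weighted v F z))\<^sup>2 = (\<bar>snd z\<bar> + v * snd z) * (cmod (F z))\<^sup>2"
  using weighted_symbol(2)[of v "snd z"] by (simp add: weighted_def norm_mult power_mult_distrib)

lemma half_energy_eq: "half_energy F = nsq (weighted 0 F)"
  by (simp add: half_energy_def nsq_def weighted_cmod)

lemma nsq_weighted_le: "\<bar>v\<bar> < 1 \<Longrightarrow> F \<in> borel_measurable borel \<Longrightarrow> nsq (weighted v F) \<le> 2 * nsq (weighted 0 F)"
proof -
  assume v: "\<bar>v\<bar> < 1" and [measurable]: "F \<in> borel_measurable borel"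
  have "nsq (weighted v F) \<le> (\<integral>\<^sup>+z. ennreal 2 * ennreal ((cmod (weighted 0 F z))\<^sup>2) \<partial>lborel)"
    unfolding nsq_def
  proof (rule nn_integral_mono)
    fix z
    have "(cmod (weighted v F z))\<^sup>2 \<le> 2 * (cmod (weighted 0 F z))\<^sup>2"
      using mult_right_mono[OF weighted_symbol(3)[OF v, of "snd z"], of "(cmod (F z))\<^sup>2"] by (simp add: weighted_cmod v)
    then show "ennreal ((cmod (weighted v F z))\<^sup>2) \<le> ennreal 2 * ennreal ((cmod (weighted 0 F z))\<^sup>2)"
      using ennreal_leI[of _ "2 * (cmod (weighted 0 F z))\<^sup>2"] by (simp add: ennreal_mult)
  qed
  then show ?thesis unfolding nsq_def by (simp add: nn_integral_cmult)
qed

lemma nsq_weighted_ge: "\<bar>v\<bar> < 1 \<Longrightarrow> F \<in> borel_measurable borel \<Longrightarrow> ennreal (1 - \<bar>v\<bar>) * nsq (weighted 0 F) \<le> nsq (weighted v F)"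
proof -
  assume v: "\<bar>v\<bar> < 1" and [measurable]: "F \<in> borel_measurable borel"
  have "(\<integral>\<^sup>+z. ennreal (1 - \<bar>v\<bar>) * ennreal ((cmod (weighted 0 F z))\<^sup>2) \<partial>lborel) \<le> nsq (weighted v F)"
    unfolding nsq_def
  proof (rule nn_integral_mono)
    fix z
    have "(1 - \<bar>v\<bar>) * (cmod (weighted 0 F z))\<^sup>2 \<le> (cmod (weighted v F z))\<^sup>2"
      using mult_right_mono[OF weighted_symbol(1)[OF v, of "snd z"], of "(cmod (F z))\<^sup>2"] by (simp add: weighted_cmod v mult.assoc)
    then show "ennreal (1 - \<bar>v\<bar>) * ennreal ((cmod (weighted 0 F z))\<^sup>2) \<le> ennreal ((cmod (weighted v F z))\<^sup>2)"
      using v by (simp add: ennreal_leI flip: ennreal_mult)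
  qed
  then show ?thesis unfolding nsq_def by (simp add: nn_integral_cmult)
qed

text \<open>A weak derivative and a transform that witness \<open>u \<in> X\<close>. The
  functions chosen in the definition of the quadratic form agree with them almost everywhere
  (lemma \<open>quad_form_X_data\<close>), so any witnesses may be used to compute with it.\<close>

definition X_data :: "(real \<times> real \<Rightarrow> complex) \<Rightarrow> (real \<times> real \<Rightarrow> complex) \<Rightarrow> (real \<times> real \<Rightarrow> complex) \<Rightarrow> bool" where
  "X_data u w F \<longleftrightarrow> sqint u \<and> has_weak_dx u w \<and> has_fourier_y u F \<and> sqint (weighted 0 F)"

lemma has_fourier_y_sqint: "has_fourier_y u F \<Longrightarrow> sqint F"
  unfolding has_fourier_y_def L2_iff_sqint by blast

lemma X_dataD:
  assumes "X_data u w F"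
  shows "sqint u" "has_weak_dx u w" "has_fourier_y u F" "sqint (weighted 0 F)" "sqint w" "sqint F"
  using assms has_weak_dx_sqint has_fourier_y_sqint unfolding X_data_def by blast+

lemma X_iff_X_data: "u \<in> X \<longleftrightarrow> (\<exists>w F. X_data u w F)"
proof -
  have "integrable lborel (\<lambda>(x, \<eta>). \<bar>\<eta>\<bar> * (cmod (F (x, \<eta>)))\<^sup>2) \<longleftrightarrow> sqint (weighted 0 F)" if "has_fourier_y u F" for F
    using has_fourier_y_sqint[OF that] weighted_measurable[of F 0]
    by (simp add: sqint_iff_integrable weighted_cmod case_prod_beta')
  then show ?thesis unfolding X_def X_data_def L2_iff_sqint by blast
qed

lemma X_data_sqint_weighted: "X_data u w F \<Longrightarrow> \<bar>v\<bar> < 1 \<Longrightarrow> sqint (weighted v F)"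
  using X_dataD(4,6)[of u w F] nsq_weighted_le[of v F]
  by (auto simp: sqint_def ennreal_mult_less_top intro: le_less_trans)

lemma X_data_lincomb:
  assumes "X_data u w F" "X_data u' w' F'"
  shows "X_data (\<lambda>z. a * u z + b * u' z) (\<lambda>z. a * w z + b * w' z) (\<lambda>z. a * F z + b * F' z)"
proof -
  have "weighted 0 (\<lambda>z. a * F z + b * F' z) = (\<lambda>z. a * weighted 0 F z + b * weighted 0 F' z)"
    by (auto simp: weighted_def fun_eq_iff algebra_simps)
  moreover have "sqint (\<lambda>z. a * weighted 0 F z + b * weighted 0 F' z)"
    by (intro sqint_add sqint_cmult X_dataD[OF assms(1)] X_dataD[OF assms(2)])
  moreover have "sqint (\<lambda>z. a * u z + b * u' z)"
    by (intro sqint_add sqint_cmult X_dataD[OF assms(1)] X_dataD[OF assms(2)])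
  ultimately show ?thesis
    unfolding X_data_def using has_weak_dx_lincomb[OF X_dataD(1,2)[OF assms(1)] X_dataD(1,2)[OF assms(2)]]
      has_fourier_y_lincomb[OF X_dataD(1,3)[OF assms(1)] X_dataD(1,3)[OF assms(2)]] by simp
qed

text \<open>The action of the translation by \<open>c\<close> on the Fourier side.\<close>

definition modulated_shift :: "real \<times> real \<Rightarrow> (real \<times> real \<Rightarrow> complex) \<Rightarrow> real \<times> real \<Rightarrow> complex" where
  "modulated_shift c F = (\<lambda>(x, \<eta>). exp (\<i> * of_real (snd c * \<eta>)) * F (x + fst c, \<eta>))"

lemma rnsq_weighted_modulated_shift:
  assumes [measurable]: "F \<in> borel_measurable borel"
  shows "rnsq (weighted v (modulated_shift c F)) = rnsq (weighted v F)" "nsq (weighted v (modulated_shift c F)) = nsq (weighted v F)"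
proof -
  have eq: "cmod (weighted v (modulated_shift c F) z) = cmod (weighted v F (z + (fst c, 0)))" for z
    by (cases z) (simp add: weighted_def modulated_shift_def norm_mult)
  have "rnsq (weighted v (modulated_shift c F)) = rnsq (\<lambda>z. weighted v F (z + (fst c, 0)))" unfolding rnsq_def eq ..
  also have "\<dots> = rnsq (weighted v F)" by (rule rnsq_translate) measurable
  finally show "rnsq (weighted v (modulated_shift c F)) = rnsq (weighted v F)" .
  have "nsq (weighted v (modulated_shift c F)) = nsq (\<lambda>z. weighted v F (z + (fst c, 0)))" unfolding nsq_def eq ..
  also have "\<dots> = nsq (weighted v F)" by (rule nsq_translate) measurable
  finally show "nsq (weighted v (modulated_shift c F)) = nsq (weighted v F)" .
qed

lemma X_data_translate:
  assumes "X_data u w F"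
  shows "X_data (\<lambda>z. u (z + c)) (\<lambda>z. w (z + c)) (modulated_shift c F)"
proof -
  have f: "has_fourier_y (\<lambda>z. u (z + c)) (modulated_shift c F)"
    using has_fourier_y_translate[OF X_dataD(1,3)[OF assms], of "fst c" "snd c"] by (simp add: modulated_shift_def)
  have Fm: "F \<in> borel_measurable borel" using X_dataD(6)[OF assms] by (simp add: sqint_def)
  have "modulated_shift c F \<in> borel_measurable borel" using has_fourier_y_sqint[OF f] by (simp add: sqint_def)
  then have "sqint (weighted 0 (modulated_shift c F))"
    using X_dataD(4)[OF assms] rnsq_weighted_modulated_shift(2)[OF Fm, of 0 c] by (auto simp: sqint_def)
  then show ?thesis
    unfolding X_data_def using f has_weak_dx_translate[OF X_dataD(1,2)[OF assms], of c] X_dataD(1)[OF assms] by auto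
qed

lemma quad_form_X_data:
  assumes r: "X_data u w F" and v: "\<bar>v\<bar> < 1"
  shows "quad_form \<omega> v u = rnsq w + rnsq (weighted v F) + \<omega> * rnsq u"
proof -
  have "has_weak_dx u (weak_dx u)" unfolding weak_dx_def by (rule someI[of "has_weak_dx u", OF X_dataD(2)[OF r]])
  note w' = this has_weak_dx_sqint[OF this]
  have "has_fourier_y u (fourier_y u)" unfolding fourier_y_def by (rule someI[of "has_fourier_y u", OF X_dataD(3)[OF r]])
  note F' = this has_fourier_y_sqint[OF this]
  have m [measurable]: "weak_dx u \<in> borel_measurable borel" "w \<in> borel_measurable borel" "fourier_y u \<in> borel_measurable borel"
     "F \<in> borel_measurable borel"
    using w' F' X_dataD[OF r] by (auto simp: sqint_def)
  have aeF: "AE z in lborel. fourier_y u z = F z"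
    by (rule has_fourier_y_unique[OF X_dataD(1)[OF r] F'(1) X_dataD(3)[OF r]])
  have 1: "(LINT z|lborel. (cmod (weak_dx u z))\<^sup>2) = rnsq w"
    using rnsq_cong_AE[OF m(1,2) has_weak_dx_unique[OF X_dataD(1)[OF r] w'(1) X_dataD(2)[OF r]]] by (simp add: rnsq_def)
  have F0: "(LINT (x, \<eta>)|lborel. \<bar>\<eta>\<bar> * (cmod (fourier_y u (x, \<eta>)))\<^sup>2) = (LINT z|lborel. \<bar>snd z\<bar> * (cmod (F z))\<^sup>2)"
  proof (unfold case_prod_beta', rule integral_cong_AE)
    show "AE z in lborel. \<bar>snd z\<bar> * (cmod (fourier_y u (fst z, snd z)))\<^sup>2 = \<bar>snd z\<bar> * (cmod (F z))\<^sup>2" using aeF by eventually_elim simp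
  qed measurable
  have F1: "(LINT (x, \<eta>)|lborel. v * \<eta> * (cmod (fourier_y u (x, \<eta>)))\<^sup>2) = (LINT z|lborel. v * snd z * (cmod (F z))\<^sup>2)"
  proof (unfold case_prod_beta', rule integral_cong_AE)
    show "AE z in lborel. v * snd z * (cmod (fourier_y u (fst z, snd z)))\<^sup>2 = v * snd z * (cmod (F z))\<^sup>2" using aeF by eventually_elim simp
  qed measurable
  have i0: "integrable lborel (\<lambda>z. \<bar>snd z\<bar> * (cmod (F z))\<^sup>2)"
    using X_dataD(4)[OF r] by (simp add: sqint_iff_integrable weighted_cmod)
  have i1: "integrable lborel (\<lambda>z. v * snd z * (cmod (F z))\<^sup>2)"
  proof (rule Bochner_Integration.integrable_bound[OF i0])
    show "AE z in lborel. norm (v * snd z * (cmod (F z))\<^sup>2) \<le> norm (\<bar>snd z\<bar> * (cmod (F z))\<^sup>2)"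
      using v by (intro AE_I2) (auto simp: abs_mult mult.assoc intro!: mult_left_le_one_le)
  qed measurable
  have "(LINT z|lborel. \<bar>snd z\<bar> * (cmod (F z))\<^sup>2) + (LINT z|lborel. v * snd z * (cmod (F z))\<^sup>2) = rnsq (weighted v F)"
    unfolding rnsq_def weighted_cmod[OF v] using i0 i1 by (simp add: distrib_right)
  then show ?thesis
    unfolding quad_form_def F0 F1 1 by (simp add: rnsq_def)
qed

lemma norm_X_eq: "norm_X u = sqrt (quad_form 1 0 u)"
  unfolding norm_X_def quad_form_def by (simp add: case_prod_beta')

lemma norm_X_sq: "u \<in> X \<Longrightarrow> (norm_X u)\<^sup>2 = quad_form 1 0 u"
  by (auto simp: X_iff_X_data norm_X_eq quad_form_X_data)

lemma norm_X_nonneg: "0 \<le> norm_X u"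
  by (auto simp: norm_X_def intro!: add_nonneg_nonneg Bochner_Integration.integral_nonneg)

lemma X_sqint: "u \<in> X \<Longrightarrow> sqint u"
  using X_dataD(1) X_iff_X_data by blast

lemma X_lincomb: "u \<in> X \<Longrightarrow> h \<in> X \<Longrightarrow> (\<lambda>z. a * u z + b * h z) \<in> X"
  unfolding X_iff_X_data using X_data_lincomb by blast

lemma X_add: "u \<in> X \<Longrightarrow> h \<in> X \<Longrightarrow> (\<lambda>z. u z + h z) \<in> X"
  using X_lincomb[of u h 1 1] by simp

lemma X_diff: "u \<in> X \<Longrightarrow> h \<in> X \<Longrightarrow> (\<lambda>z. u z - h z) \<in> X"
  using X_lincomb[of u h 1 "-1"] by simp

lemma X_cmult: "u \<in> X \<Longrightarrow> (\<lambda>z. a * u z) \<in> X"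
  using X_lincomb[of u u a 0] by simp

lemma X_translate: "u \<in> X \<Longrightarrow> (\<lambda>z. u (z + c)) \<in> X"
  unfolding X_iff_X_data using X_data_translate by blast

lemma X_data_add: "X_data u w F \<Longrightarrow> X_data u' w' F' \<Longrightarrow> X_data (\<lambda>z. u z + u' z) (\<lambda>z. w z + w' z) (\<lambda>z. F z + F' z)"
  using X_data_lincomb[of u w F u' w' F' 1 1] by simp

lemma X_data_diff: "X_data u w F \<Longrightarrow> X_data u' w' F' \<Longrightarrow> X_data (\<lambda>z. u z - u' z) (\<lambda>z. w z - w' z) (\<lambda>z. F z - F' z)"
  using X_data_lincomb[of u w F u' w' F' 1 "-1"] by simp

lemma X_data_cmult: "X_data u w F \<Longrightarrow> X_data (\<lambda>z. a * u z) (\<lambda>z. a * w z) (\<lambda>z. a * F z)"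
  using X_data_lincomb[of u w F u w F a 0] by simp

lemma weighted_add: "weighted v (\<lambda>z. F z + G z) = (\<lambda>z. weighted v F z + weighted v G z)"
  by (simp add: weighted_def fun_eq_iff algebra_simps)

lemma weighted_diff: "weighted v (\<lambda>z. F z - G z) = (\<lambda>z. weighted v F z - weighted v G z)"
  by (simp add: weighted_def fun_eq_iff algebra_simps)

lemma weighted_cmult: "weighted v (\<lambda>z. a * F z) = (\<lambda>z. a * weighted v F z)"
  by (simp add: weighted_def fun_eq_iff algebra_simps)

text \<open>The form is a sum of squared norms of linear images of \<open>u\<close>. The identity
  takes the place of the inner product in what follows.\<close>

lemma quad_form_parallelogram:
  assumes u: "u \<in> X" and h: "h \<in> X" and v: "\<bar>v\<bar> < 1"
  shows "quad_form \<omega> v (\<lambda>z. u z + h z) + quad_form \<omega> v (\<lambda>z. u z - h z) = 2 * quad_form \<omega> v u + 2 * quad_form \<omega> v h"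
proof -
  obtain w F w' F' where r: "X_data u w F" "X_data h w' F'" using u h X_iff_X_data by blast
  have "\<omega> * (rnsq (\<lambda>z. u z + h z) + rnsq (\<lambda>z. u z - h z)) = \<omega> * (2 * rnsq u + 2 * rnsq h)"
    by (simp only: rnsq_parallelogram[OF X_dataD(1)[OF r(1)] X_dataD(1)[OF r(2)]])
  then show ?thesis
    unfolding quad_form_X_data[OF X_data_add[OF r] v] quad_form_X_data[OF X_data_diff[OF r] v] quad_form_X_data[OF r(1) v] quad_form_X_data[OF r(2) v]
      weighted_add weighted_diff
    using rnsq_parallelogram[OF X_dataD(5)[OF r(1)] X_dataD(5)[OF r(2)]]
      rnsq_parallelogram[OF X_data_sqint_weighted[OF r(1) v] X_data_sqint_weighted[OF r(2) v]]
    by (simp add: algebra_simps)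
qed

lemma quad_form_cmult:
  assumes u: "u \<in> X" and v: "\<bar>v\<bar> < 1"
  shows "quad_form \<omega> v (\<lambda>z. c * u z) = (cmod c)\<^sup>2 * quad_form \<omega> v u"
proof -
  obtain w F where r: "X_data u w F" using u X_iff_X_data by blast
  show ?thesis
    unfolding quad_form_X_data[OF X_data_cmult[OF r] v] quad_form_X_data[OF r v] weighted_cmult rnsq_cmult by (simp add: algebra_simps)
qed

lemma quad_form_translate:
  assumes u: "u \<in> X" and v: "\<bar>v\<bar> < 1"
  shows "quad_form \<omega> v (\<lambda>z. u (z + c)) = quad_form \<omega> v u"
proof -
  obtain w F where r: "X_data u w F" using u X_iff_X_data by blast
  show ?thesis
    unfolding quad_form_X_data[OF X_data_translate[OF r] v] quad_form_X_data[OF r v]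
    using X_dataD[OF r] by (simp add: rnsq_translate rnsq_weighted_modulated_shift sqint_def)
qed

lemma quad_form_ge:
  assumes u: "u \<in> X" and v: "\<bar>v\<bar> < 1"
  shows "\<omega> * rnsq u \<le> quad_form \<omega> v u"
proof -
  obtain w F where r: "X_data u w F" using u X_iff_X_data by blast
  show ?thesis unfolding quad_form_X_data[OF r v] by simp
qed

lemma quad_form_nonneg:
  assumes "u \<in> X" "\<bar>v\<bar> < 1" "\<omega> > 0"
  shows "0 \<le> quad_form \<omega> v u"
  using quad_form_ge[OF assms(1,2), of \<omega>] assms(3) by (meson rnsq_nonneg less_imp_le mult_nonneg_nonneg order_trans)

lemma quad_form_add_le:
  assumes u: "u \<in> X" and h: "h \<in> X" and v: "\<bar>v\<bar> < 1" and w: "\<omega> > 0" and t: "t > 0"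
  shows "quad_form \<omega> v (\<lambda>z. u z + h z) \<le> (1 + t) * quad_form \<omega> v u + (1 + 1/t) * quad_form \<omega> v h"
proof -
  obtain w F w' F' where r: "X_data u w F" "X_data h w' F'" using u h X_iff_X_data by blast
  note l1 = rnsq_add_le[OF X_dataD(5)[OF r(1)] X_dataD(5)[OF r(2)] t]
  note l2 = rnsq_add_le[OF X_data_sqint_weighted[OF r(1) v] X_data_sqint_weighted[OF r(2) v] t]
  note l3 = mult_left_mono[OF rnsq_add_le[OF X_dataD(1)[OF r(1)] X_dataD(1)[OF r(2)] t] less_imp_le[OF w]]
  have "(1 + t) * (rnsq w + rnsq (weighted v F) + \<omega> * rnsq u) + (1 + 1/t) * (rnsq w' + rnsq (weighted v F') + \<omega> * rnsq h)
    = ((1 + t) * rnsq w + (1 + 1/t) * rnsq w') + ((1 + t) * rnsq (weighted v F) + (1 + 1/t) * rnsq (weighted v F')) + \<omega> * ((1 + t) * rnsq u + (1 + 1/t) * rnsq h)"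
    by (simp only: distrib_left add_ac mult.left_commute[of \<omega>])
  then show ?thesis
    unfolding quad_form_X_data[OF X_data_add[OF r] v] quad_form_X_data[OF r(1) v] quad_form_X_data[OF r(2) v] weighted_add
    using l1 l2 l3 by linarith
qed

lemma quad_form_le_norm_X:
  assumes u: "u \<in> X" and v: "\<bar>v\<bar> < 1" and w: "\<omega> > 0"
  shows "quad_form \<omega> v u \<le> (2 + \<omega>) * (norm_X u)\<^sup>2"
proof -
  obtain w F where r: "X_data u w F" using u X_iff_X_data by blast
  have "nsq (weighted v F) \<le> 2 * nsq (weighted 0 F)" using X_dataD(6)[OF r] by (intro nsq_weighted_le v) (simp add: sqint_def)
  then have "rnsq (weighted v F) \<le> 2 * rnsq (weighted 0 F)"
    using X_data_sqint_weighted[OF r v] X_dataD(4)[OF r] rnsq_le_iff[of "weighted v F" "weighted 0 F" 2] by simp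
  then have "rnsq w + rnsq (weighted v F) + \<omega> * rnsq u \<le> (2 + \<omega>) * rnsq w + (2 + \<omega>) * rnsq (weighted 0 F) + (2 + \<omega>) * rnsq u"
    using mult_nonneg_nonneg[OF less_imp_le[OF w] rnsq_nonneg, of w] mult_nonneg_nonneg[OF less_imp_le[OF w] rnsq_nonneg, of "weighted 0 F"]
      rnsq_nonneg[of w] rnsq_nonneg[of u] unfolding distrib_right by linarith
  then show ?thesis
    unfolding norm_X_sq[OF u] quad_form_X_data[OF r v] quad_form_X_data[OF r, of 0, simplified] by (simp add: distrib_left)
qed

text \<open>The anisotropic modulus of continuity: one derivative in \<open>x\<close> costs
  \<open>s\<^sup>2\<close>, half a derivative in \<open>y\<close> costs
  \<open>\<bar>t\<bar>\<close>.\<close>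

lemma nsq_translate_le_quad_form:
  assumes u: "u \<in> X" and v: "\<bar>v\<bar> < 1" and w: "\<omega> > 0" and s: "s \<ge> 0"
  shows "nsq (\<lambda>z. u (z + (s, t)) - u z) \<le> ennreal (8 / (1 - \<bar>v\<bar>) * (s\<^sup>2 + \<bar>t\<bar>) * quad_form \<omega> v u)"
proof -
  obtain w F where r: "X_data u w F" using u X_iff_X_data by blast
  let ?A = "quad_form \<omega> v u"
  define k where "k = 1 / (1 - \<bar>v\<bar>)"
  have k: "k \<ge> 1" using v by (simp add: k_def)
  have um: "u \<in> borel_measurable borel" using X_dataD(1)[OF r] by (simp add: sqint_def)
  note [measurable] = um
  have Fm: "F \<in> borel_measurable borel" using X_dataD(6)[OF r] by (simp add: sqint_def)
  have "ennreal (1 - \<bar>v\<bar>) * nsq (weighted 0 F) \<le> nsq (weighted v F)" by (rule nsq_weighted_ge[OF v Fm])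
  then have "(1 - \<bar>v\<bar>) * rnsq (weighted 0 F) \<le> rnsq (weighted v F)"
    using X_dataD(4)[OF r] X_data_sqint_weighted[OF r v] v by (simp add: nsq_rnsq flip: ennreal_mult)
  also have "\<dots> \<le> ?A" unfolding quad_form_X_data[OF r v] using \<open>\<omega> > 0\<close> by simp
  finally have e0: "rnsq (weighted 0 F) \<le> k * ?A" using v by (simp add: k_def field_simps)
  have "1 * rnsq w \<le> k * ?A"
    unfolding quad_form_X_data[OF r v] using k \<open>\<omega> > 0\<close> by (intro mult_mono) auto
  then have e1: "rnsq w \<le> k * ?A" by simp
  have "nsq (\<lambda>z. u (z + (s, t)) - u z) \<le> 2 * nsq (\<lambda>z. u (z + (s, t)) - u (z + (0, t))) + 2 * nsq (\<lambda>z. u (z + (0, t)) - u z)"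
    by (rule nsq_triangle) measurable
  also have "nsq (\<lambda>z. u (z + (s, t)) - u (z + (0, t))) = nsq (\<lambda>z. u (z + (s, 0)) - u z)"
    using nsq_translate[of "\<lambda>z. u (z + (s, 0)) - u z" "(0, t)"] by (simp add: add.assoc)
  also have "\<dots> \<le> ennreal (s\<^sup>2) * nsq w" by (rule nsq_translate_x[OF X_dataD(1,2)[OF r] s])
  also have "nsq (\<lambda>z. u (z + (0, t)) - u z) \<le> ennreal (4 * \<bar>t\<bar>) * nsq (weighted 0 F)"
    using nsq_translate_y[OF X_dataD(1,3)[OF r], of t] by (simp add: half_energy_eq)
  finally have "nsq (\<lambda>z. u (z + (s, t)) - u z) \<le> 2 * (ennreal (s\<^sup>2) * nsq w) + 2 * (ennreal (4 * \<bar>t\<bar>) * nsq (weighted 0 F))"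
    by (simp add: mult_left_mono add_mono)
  also have "\<dots> = ennreal (2 * (s\<^sup>2 * rnsq w) + 2 * (4 * \<bar>t\<bar> * rnsq (weighted 0 F)))"
    unfolding nsq_rnsq[OF X_dataD(5)[OF r]] nsq_rnsq[OF X_dataD(4)[OF r]]
    by (simp add: ennreal_times_2 flip: ennreal_mult ennreal_plus)
  also have "\<dots> \<le> ennreal (8 * (s\<^sup>2 + \<bar>t\<bar>) * (k * ?A))"
  proof (rule ennreal_leI)
    have "s\<^sup>2 * rnsq w \<le> s\<^sup>2 * (k * ?A)" "\<bar>t\<bar> * rnsq (weighted 0 F) \<le> \<bar>t\<bar> * (k * ?A)" "0 \<le> s\<^sup>2 * rnsq w"
      using e0 e1 by (intro mult_left_mono mult_nonneg_nonneg; simp)+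
    moreover have "8 * (s\<^sup>2 + \<bar>t\<bar>) * (k * ?A) = 8 * (s\<^sup>2 * (k * ?A)) + 8 * (\<bar>t\<bar> * (k * ?A))"
      by (simp add: algebra_simps)
    ultimately show "2 * (s\<^sup>2 * rnsq w) + 2 * (4 * \<bar>t\<bar> * rnsq (weighted 0 F)) \<le> 8 * (s\<^sup>2 + \<bar>t\<bar>) * (k * ?A)"
      by linarith
  qed
  also have "8 * (s\<^sup>2 + \<bar>t\<bar>) * (k * ?A) = 8 / (1 - \<bar>v\<bar>) * (s\<^sup>2 + \<bar>t\<bar>) * ?A" by (simp add: k_def)
  finally show ?thesis .
qed

text \<open>Completeness for the norm given by the quadratic form. The functions, their
  derivatives and their weighted transforms converge in \<open>L\<^sup>2\<close> separately; the
  limits belong together because weak derivatives are closed, and because the transforms converge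
  in \<open>L\<^sup>2\<close>, so that the weighted transforms can be identified with the help of
  a subsequence converging almost everywhere.\<close>

lemma X_complete:
  assumes V: "\<And>n. V n \<in> X" and v: "\<bar>v\<bar> < 1" and w: "\<omega> > 0"
    and cau: "\<And>e. e > 0 \<Longrightarrow> \<exists>N. \<forall>i\<ge>N. \<forall>j\<ge>N. quad_form \<omega> v (\<lambda>z. V i z - V j z) \<le> e"
  shows "\<exists>u\<in>X. (\<lambda>n. quad_form \<omega> v (\<lambda>z. V n z - u z)) \<longlonglongrightarrow> 0"
proof -
  have "\<forall>n. \<exists>w F. X_data (V n) w F" using V X_iff_X_data by blast
  then obtain W F where r: "\<And>n. X_data (V n) (W n) (F n)" by metis
  have Vs: "sqint (V n)" and Ws: "sqint (W n)" and Fs: "sqint (F n)" and Gs: "sqint (weighted v (F n))" for n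
    using X_dataD[OF r[of n]] X_data_sqint_weighted[OF r v] by auto
  have q: "quad_form \<omega> v (\<lambda>z. V i z - V j z) = rnsq (\<lambda>z. W i z - W j z) + rnsq (\<lambda>z. weighted v (F i) z - weighted v (F j) z) + \<omega> * rnsq (\<lambda>z. V i z - V j z)" for i j
    unfolding quad_form_X_data[OF X_data_diff[OF r r] v] weighted_diff ..
  have cW: "\<exists>N. \<forall>i\<ge>N. \<forall>j\<ge>N. nsq (\<lambda>z. W i z - W j z) \<le> ennreal e"
    and cG: "\<exists>N. \<forall>i\<ge>N. \<forall>j\<ge>N. nsq (\<lambda>z. weighted v (F i) z - weighted v (F j) z) \<le> ennreal e" if e: "e > 0" for e
  proof -
    obtain N where N: "\<forall>i\<ge>N. \<forall>j\<ge>N. quad_form \<omega> v (\<lambda>z. V i z - V j z) \<le> e" using cau[OF e] by blast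
    have "rnsq (\<lambda>z. W i z - W j z) \<le> e \<and> rnsq (\<lambda>z. weighted v (F i) z - weighted v (F j) z) \<le> e" if "i \<ge> N" "j \<ge> N" for i j
      using N[rule_format, OF that] mult_nonneg_nonneg[OF less_imp_le[OF w] rnsq_nonneg[of "\<lambda>z. V i z - V j z"]]
        rnsq_nonneg[of "\<lambda>z. W i z - W j z"] rnsq_nonneg[of "\<lambda>z. weighted v (F i) z - weighted v (F j) z"]
      unfolding q by linarith
    then show "\<exists>N. \<forall>i\<ge>N. \<forall>j\<ge>N. nsq (\<lambda>z. W i z - W j z) \<le> ennreal e"
      "\<exists>N. \<forall>i\<ge>N. \<forall>j\<ge>N. nsq (\<lambda>z. weighted v (F i) z - weighted v (F j) z) \<le> ennreal e"
      unfolding nsq_rnsq[OF sqint_diff[OF Ws Ws]] nsq_rnsq[OF sqint_diff[OF Gs Gs]] by (meson ennreal_leI)+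
  qed
  have cV: "\<exists>N. \<forall>i\<ge>N. \<forall>j\<ge>N. nsq (\<lambda>z. V i z - V j z) \<le> ennreal e" if e: "e > 0" for e
  proof -
    obtain N where N: "\<forall>i\<ge>N. \<forall>j\<ge>N. quad_form \<omega> v (\<lambda>z. V i z - V j z) \<le> e * \<omega>" using cau[of "e * \<omega>"] e w by auto
    have "rnsq (\<lambda>z. V i z - V j z) \<le> e" if "i \<ge> N" "j \<ge> N" for i j
    proof -
      have "\<omega> * rnsq (\<lambda>z. V i z - V j z) \<le> \<omega> * e"
        using N[rule_format, OF that] quad_form_ge[OF X_diff[OF V V] v, of \<omega> i j] by (simp add: mult.commute)
      then show ?thesis using w by simp
    qed
    then show ?thesis unfolding nsq_rnsq[OF sqint_diff[OF Vs Vs]] by (meson ennreal_leI)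
  qed
  obtain u where u: "sqint u" "(\<lambda>n. nsq (\<lambda>z. V n z - u z)) \<longlonglongrightarrow> 0" using sqint_complete[OF Vs cV] by blast
  obtain y where y: "sqint y" "(\<lambda>n. nsq (\<lambda>z. W n z - y z)) \<longlonglongrightarrow> 0" using sqint_complete[OF Ws cW] by blast
  have dx: "has_weak_dx u y" by (rule has_weak_dx_closed[OF Vs u X_dataD(2)[OF r] y])
  obtain G where G: "has_fourier_y u G" using has_fourier_y_exists[OF u(1)] by blast
  have G': "sqint G" by (rule has_fourier_y_sqint[OF G])
  have m [measurable]: "G \<in> borel_measurable borel" "\<And>n. F n \<in> borel_measurable borel"
    using G' Fs by (auto simp: sqint_def)
  have limF: "(\<lambda>n. nsq (\<lambda>z. F n z - G z)) \<longlonglongrightarrow> 0"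
  proof (rule tendsto_sandwich[OF _ _ tendsto_const])
    show "\<forall>\<^sub>F n in sequentially. nsq (\<lambda>z. F n z - G z) \<le> 2 * nsq (\<lambda>z. V n z - u z)"
    proof (rule always_eventually, rule allI)
      fix n
      have "has_fourier_y (\<lambda>z. 1 * V n z + (-1) * u z) (\<lambda>z. 1 * F n z + (-1) * G z)"
        by (rule has_fourier_y_lincomb[OF Vs X_dataD(3)[OF r] u(1) G])
      then have "has_fourier_y (\<lambda>z. V n z - u z) (\<lambda>z. F n z - G z)" by simp
      from has_fourier_y_nsq_le(1)[OF sqint_diff[OF Vs u(1)] this] show "nsq (\<lambda>z. F n z - G z) \<le> 2 * nsq (\<lambda>z. V n z - u z)" .
    qed
    have "(\<lambda>n. 2 * nsq (\<lambda>z. V n z - u z)) \<longlonglongrightarrow> 2 * 0" by (intro ennreal_tendsto_cmult u) simp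
    then show "(\<lambda>n. 2 * nsq (\<lambda>z. V n z - u z)) \<longlonglongrightarrow> 0" by simp
  qed auto
  obtain s where s: "strict_mono s" "AE z in lborel. (\<lambda>n. F (s n) z - G z) \<longlonglongrightarrow> 0"
    using nsq_tendsto_0_AE_subseq[OF sqint_diff[OF Fs G'] limF] by blast
  have estG: "\<exists>N. \<forall>n\<ge>N. nsq (\<lambda>z. weighted v (F n) z - weighted v G z) \<le> ennreal e" if e: "e > 0" for e
  proof -
    obtain N where N: "\<forall>i\<ge>N. \<forall>j\<ge>N. nsq (\<lambda>z. weighted v (F i) z - weighted v (F j) z) \<le> ennreal e" using cG[OF e] by blast
    have "nsq (\<lambda>z. weighted v (F n) z - weighted v G z) \<le> ennreal e" if n: "n \<ge> N" for n
    proof (rule nsq_le_of_AE_lim[where f="\<lambda>k z. weighted v (F n) z - weighted v (F (s k)) z" and N=N])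
      show "AE z in lborel. (\<lambda>k. weighted v (F n) z - weighted v (F (s k)) z) \<longlonglongrightarrow> weighted v (F n) z - weighted v G z"
        using s(2) unfolding weighted_def by eventually_elim (intro tendsto_intros, simp add: LIM_zero_cancel)
      show "nsq (\<lambda>z. weighted v (F n) z - weighted v (F (s k)) z) \<le> ennreal e" if "k \<ge> N" for k
        using N n that seq_suble[OF s(1), of k] by auto
    qed measurable
    then show ?thesis by blast
  qed
  have wG: "sqint (weighted v G)"
  proof -
    obtain N where "nsq (\<lambda>z. weighted v (F N) z - weighted v G z) \<le> ennreal 1" using estG[of 1] by auto
    then have "sqint (\<lambda>z. weighted v (F N) z - weighted v G z)"
      by (auto simp: sqint_def intro: le_less_trans)
    from sqint_diff[OF Gs[of N] this] show ?thesis by simp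
  qed
  have "sqint (weighted 0 G)"
  proof -
    have "ennreal (1 - \<bar>v\<bar>) * nsq (weighted 0 G) < \<infinity>"
      using nsq_weighted_ge[OF v m(1)] wG by (auto simp: sqint_def intro: le_less_trans)
    then have "nsq (weighted 0 G) < \<infinity>" using v by (auto simp: ennreal_mult_less_top ennreal_eq_0_iff)
    then show ?thesis by (simp add: sqint_def)
  qed
  then have ru: "X_data u y G" using u dx G by (simp add: X_data_def)
  then have uX: "u \<in> X" using X_iff_X_data by blast
  have to_real: "(\<lambda>n. rnsq (f n)) \<longlonglongrightarrow> 0" if "\<And>n. sqint (f n)" "(\<lambda>n. nsq (f n)) \<longlonglongrightarrow> 0" for f :: "nat \<Rightarrow> real \<times> real \<Rightarrow> complex"
    using that(2) unfolding nsq_rnsq[OF that(1)] by (subst (asm) ennreal_tendsto_0_iff) auto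
  have "(\<lambda>n. rnsq (\<lambda>z. W n z - y z) + rnsq (\<lambda>z. weighted v (F n) z - weighted v G z) + \<omega> * rnsq (\<lambda>z. V n z - u z)) \<longlonglongrightarrow> 0 + 0 + \<omega> * 0"
    by (intro tendsto_intros to_real sqint_diff Ws y Gs wG Vs u ennreal_tendsto_0I estG)
  moreover have "quad_form \<omega> v (\<lambda>z. V n z - u z) = rnsq (\<lambda>z. W n z - y z) + rnsq (\<lambda>z. weighted v (F n) z - weighted v G z) + \<omega> * rnsq (\<lambda>z. V n z - u z)" for n
    unfolding quad_form_X_data[OF X_data_diff[OF r ru] v] weighted_diff ..
  ultimately show ?thesis by (intro bexI[OF _ uX]) simp
qed

section \<open>A nonzero element of the energy space\<close>

lemma test_fun_mult:
  assumes f: "test_fun f fx fy" and g: "test_fun g gx gy"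
  shows "test_fun (\<lambda>z. f z * g z) (\<lambda>z. fx z * g z + f z * gx z) (\<lambda>z. fy z * g z + f z * gy z)"
  unfolding test_fun_def
proof (intro conjI allI)
  fix z
  show "((\<lambda>z. f z * g z) has_derivative (\<lambda>(a, b). a * (fx z * g z + f z * gx z) + b * (fy z * g z + f z * gy z))) (at z)"
    by (rule has_derivative_eq_rhs[OF has_derivative_mult[OF test_funD(1)[OF f] test_funD(1)[OF g]]])
      (auto simp: fun_eq_iff algebra_simps)
  show "continuous_on UNIV (\<lambda>z. fx z * g z + f z * gx z)" "continuous_on UNIV (\<lambda>z. fy z * g z + f z * gy z)"
    by (intro continuous_intros test_funD(2,3)[OF f] test_funD(2,3)[OF g] test_fun_continuous[OF f] test_fun_continuous[OF g])+
  show "bounded {z. f z * g z \<noteq> 0}" by (rule bounded_subset[OF test_funD(4)[OF f]]) auto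
qed

lemma test_fun_support:
  assumes t: "test_fun f fx fy"
  obtains R where "\<And>z. norm z > R \<Longrightarrow> f z = 0" "\<And>z. norm z > R \<Longrightarrow> fx z = 0"
proof -
  obtain R1 where R1: "\<forall>z\<in>{z. f z \<noteq> 0}. norm z \<le> R1" using test_funD(4)[OF t] unfolding bounded_iff by blast
  obtain R2 where R2: "\<forall>z\<in>{z. fx z \<noteq> 0}. norm z \<le> R2" using test_fun_bounded_dx[OF t] unfolding bounded_iff by blast
  show ?thesis by (rule that[of "max R1 R2"]) (use R1 R2 in force)+
qed

lemma test_fun_partial_x:
  assumes t: "test_fun f fx fy"
  shows "((\<lambda>x. f (x, y)) has_real_derivative fx (x, y)) (at x)"
proof -
  have "((\<lambda>x. (x, y)) has_derivative (\<lambda>h. (h, 0))) (at x)" by (auto intro!: derivative_eq_intros)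
  from has_derivative_compose[OF this test_funD(1)[OF t]]
  have "((\<lambda>x. f (x, y)) has_derivative (\<lambda>h. h * fx (x, y))) (at x)" by simp
  then show ?thesis unfolding has_field_derivative_def by (rule has_derivative_eq_rhs) (simp add: fun_eq_iff)
qed

text \<open>The integral over each horizontal line is an increment of \<open>f\<close> between
  points outside its support.\<close>

lemma test_fun_integral_dx:
  assumes t: "test_fun f fx fy"
  shows "(LINT z|lborel. complex_of_real (fx z)) = 0"
proof -
  obtain R where R: "\<And>z. norm z > R \<Longrightarrow> f z = 0" "\<And>z. norm z > R \<Longrightarrow> fx z = 0"
    using test_fun_support[OF t] by blast
  define K where "K = \<bar>R\<bar> + 1"
  have K: "K > 0" "\<And>z. norm z \<ge> K \<Longrightarrow> f z = 0" "\<And>z. norm z \<ge> K \<Longrightarrow> fx z = 0"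
    using R unfolding K_def by (auto simp: abs_if split: if_splits)
  have "integrable lborel (\<lambda>z. complex_of_real (fx z) * indicator (cball 0 K) z)"
    by (intro sqint_mult_integrable test_fun_sqint(2)[OF t] sqint_indicator) auto
  also have "(\<lambda>z. complex_of_real (fx z) * indicator (cball 0 K) z) = (\<lambda>z. complex_of_real (fx z))"
    using K(3) by (auto simp: fun_eq_iff indicator_def)
  finally have i: "integrable (lborel \<Otimes>\<^sub>M lborel) (\<lambda>z. complex_of_real (fx z))" by (simp add: lborel_prod)
  have "(LINT z|lborel. complex_of_real (fx z)) = (LINT z|(lborel \<Otimes>\<^sub>M lborel). complex_of_real (fx z))"
    by (simp add: lborel_prod)
  also have "\<dots> = (LINT y|lborel. LINT x|lborel. complex_of_real (fx (x, y)))"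
    using lborel_pair.integral_snd[of "\<lambda>x y. complex_of_real (fx (x, y))"] i by (simp add: case_prod_beta')
  also have "\<dots> = (LINT y|(lborel::real measure). 0)"
  proof (rule Bochner_Integration.integral_cong[OF refl])
    fix y :: real
    have n: "\<bar>x\<bar> \<le> norm (x, y)" for x :: real using norm_fst_le[of x y] by simp
    have c: "isCont (\<lambda>x. fx (x, y)) x" for x
    proof -
      have "continuous_on UNIV (\<lambda>x. fx (x, y))"
        by (intro continuous_on_compose2[OF test_funD(2)[OF t]] continuous_intros) auto
      then show ?thesis by (simp add: continuous_on_eq_continuous_at)
    qed
    have "(LINT x|lborel. fx (x, y) * indicator {-K..K} x) = f (K, y) - f (-K, y)"
      using K(1) by (intro integral_FTC_Icc_real test_fun_partial_x[OF t] c) auto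
    also have "\<dots> = 0" using K(2)[of "(K, y)"] K(2)[of "(-K, y)"] n[of K] n[of "-K"] K(1) by simp
    also have "(\<lambda>x. fx (x, y) * indicator {-K..K} x) = (\<lambda>x. fx (x, y))"
    proof
      fix x show "fx (x, y) * indicator {-K..K} x = fx (x, y)"
        using K(3)[of "(x, y)"] n[of x] by (cases "x \<in> {-K..K}") auto
    qed
    finally show "(LINT x|lborel. complex_of_real (fx (x, y))) = 0" by (simp add: integral_complex_of_real)
  qed
  finally show ?thesis by simp
qed

lemma has_weak_dx_test_fun:
  assumes t: "test_fun f fx fy"
  shows "has_weak_dx (\<lambda>z. complex_of_real (f z)) (\<lambda>z. complex_of_real (fx z))"
  unfolding has_weak_dx_iff
proof (intro conjI allI impI)
  show "(\<lambda>z. complex_of_real (fx z)) \<in> L2" using test_fun_sqint(2)[OF t] by (simp add: L2_iff_sqint)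
  fix g gx gy assume g: "test_fun g gx gy"
  have "(LINT z|lborel. complex_of_real (gx z * f z + g z * fx z)) = 0"
    by (rule test_fun_integral_dx[OF test_fun_mult[OF g t]])
  then have "(LINT z|lborel. complex_of_real (gx z) * complex_of_real (f z) + complex_of_real (g z) * complex_of_real (fx z)) = 0"
    by simp
  then have "(LINT z|lborel. complex_of_real (gx z) * complex_of_real (f z)) + (LINT z|lborel. complex_of_real (g z) * complex_of_real (fx z)) = 0"
    by (subst (asm) Bochner_Integration.integral_add) (intro sqint_mult_integrable test_fun_sqint[OF t] test_fun_sqint[OF g])+
  then show "(LINT z|lborel. gx z *\<^sub>R complex_of_real (f z)) = - (LINT z|lborel. g z *\<^sub>R complex_of_real (fx z))"
    unfolding scaleR_conv_of_real by (simp add: add_eq_0_iff2)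
qed

lemma exp_difference_quotient:
  fixes c :: complex
  shows "(\<lambda>n. of_nat (Suc n) * (exp (c / of_nat (Suc n)) - 1)) \<longlonglongrightarrow> c"
proof (cases "c = 0")
  case False
  have h: "(\<lambda>n. c / of_nat (Suc n)) \<longlonglongrightarrow> 0"
    by (rule LIMSEQ_Suc[OF lim_const_over_n])
  have "((\<lambda>h. (exp (0 + h) - exp 0) / h) \<longlongrightarrow> exp 0) (at (0::complex))"
    using DERIV_exp[of 0] unfolding DERIV_def .
  then have d: "((\<lambda>h. (exp h - 1) / h) \<longlongrightarrow> 1) (at (0::complex))" by simp
  have "(\<lambda>n. (exp (c / of_nat (Suc n)) - 1) / (c / of_nat (Suc n))) \<longlonglongrightarrow> 1"
  proof (rule filterlim_compose[OF d])
    show "filterlim (\<lambda>n. c / of_nat (Suc n)) (at 0) sequentially"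
      using h False by (simp add: filterlim_at del: of_nat_Suc)
  qed
  then have "(\<lambda>n. c * ((exp (c / of_nat (Suc n)) - 1) / (c / of_nat (Suc n)))) \<longlonglongrightarrow> c * 1" by (intro tendsto_intros)
  then show ?thesis using False by (simp add: mult.commute del: of_nat_Suc)
qed simp

lemma nsq_swap:
  fixes f :: "real \<times> real \<Rightarrow> complex"
  assumes "f \<in> borel_measurable borel"
  shows "nsq (\<lambda>z. f (snd z, fst z)) = nsq f"
proof -
  have [measurable]: "f \<in> borel_measurable (borel \<Otimes>\<^sub>M borel)" using assms by (simp add: borel_prod)
  show ?thesis unfolding nsq_def lborel_prod[symmetric]
    by (subst lborel_pair.nn_integral_snd[symmetric], measurable, subst lborel.nn_integral_fst[symmetric], measurable)
qed

text \<open>Only the half derivative in \<open>y\<close> needs an argument. For a function that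
  is symmetric in its two variables the \<open>x\<close> derivative also bounds the difference
  quotients in \<open>y\<close>. On the Fourier side these converge pointwise to
  \<open>\<i>\<eta>F\<close>, so that \<open>\<eta>F\<close> is square-integrable by Fatou's
  lemma, and \<open>\<bar>\<eta>\<bar> \<le> 1 + \<eta>\<^sup>2\<close>.\<close>

lemma symmetric_test_fun_in_X:
  assumes t: "test_fun f fx fy" and sym: "\<And>x y. f (x, y) = f (y, x)"
  shows "(\<lambda>z. complex_of_real (f z)) \<in> X"
proof -
  define u where "u z = complex_of_real (f z)" for z
  have us: "sqint u" unfolding u_def[abs_def] by (rule test_fun_sqint(1)[OF t])
  obtain F where F: "has_fourier_y u F" using has_fourier_y_exists[OF us] by blast
  have Fs: "sqint F" by (rule has_fourier_y_sqint[OF F])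
  have [measurable]: "F \<in> borel_measurable borel" using Fs by (simp add: sqint_def)
  have w: "sqint (\<lambda>z. complex_of_real (fx z))" by (rule test_fun_sqint(2)[OF t])
  define C where "C = rnsq (\<lambda>z. complex_of_real (fx z))"
  have C: "C \<ge> 0" "nsq (\<lambda>z. u (z + (0, s)) - u z) \<le> ennreal (C * s\<^sup>2)" if "s \<ge> 0" for s
  proof -
    have [measurable]: "u \<in> borel_measurable borel" using us by (rule sqint_measurable)
    have "u (z + (0, s)) - u z = u ((snd z, fst z) + (s, 0)) - u (snd z, fst z)" for z
      using sym[of "fst z" "snd z"] sym[of "fst z" "snd z + s"] by (cases z) (simp add: u_def)
    then have "nsq (\<lambda>z. u (z + (0, s)) - u z) = nsq (\<lambda>z. u (z + (s, 0)) - u z)"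
      using nsq_swap[of "\<lambda>z. u (z + (s, 0)) - u z"] by simp
    also have "\<dots> \<le> ennreal (s\<^sup>2) * nsq (\<lambda>z. complex_of_real (fx z))"
      using has_weak_dx_test_fun[OF t] that us unfolding u_def[abs_def, symmetric] by (intro nsq_translate_x)
    also have "\<dots> = ennreal (C * s\<^sup>2)"
      unfolding nsq_rnsq[OF w] C_def by (simp add: mult.commute flip: ennreal_mult)
    finally show "nsq (\<lambda>z. u (z + (0, s)) - u z) \<le> ennreal (C * s\<^sup>2)" .
  qed (simp add: C_def)
  \<comment> \<open>The transforms of the difference quotients with step \<open>1 / Suc
    n\<close>.\<close>
  define G where "G n z = of_nat (Suc n) * (modulated_shift (0, 1 / real (Suc n)) F z - F z)" for n z
  have mod: "has_fourier_y (\<lambda>z. u (z + (0, s))) (modulated_shift (0, s) F)" for s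
    using has_fourier_y_translate[OF us F, of 0 s] by (simp add: modulated_shift_def)
  have mods: "sqint (modulated_shift (0, s) F)" for s by (rule has_fourier_y_sqint[OF mod])
  have Gs: "sqint (G n)" for n unfolding G_def[abs_def] by (intro sqint_cmult sqint_diff mods Fs)
  have Gb: "nsq (G n) \<le> ennreal (2 * C)" for n
  proof -
    let ?s = "1 / real (Suc n)"
    have [measurable]: "modulated_shift (0, ?s) F \<in> borel_measurable borel" using mods[of ?s] by (simp add: sqint_def)
    have "has_fourier_y (\<lambda>z. 1 * u (z + (0, ?s)) + (-1) * u z) (\<lambda>z. 1 * modulated_shift (0, ?s) F z + (-1) * F z)"
      by (intro has_fourier_y_lincomb mod us F sqint_translate)
    then have "has_fourier_y (\<lambda>z. u (z + (0, ?s)) - u z) (\<lambda>z. modulated_shift (0, ?s) F z - F z)" by simp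
    then have "nsq (\<lambda>z. modulated_shift (0, ?s) F z - F z) \<le> 2 * nsq (\<lambda>z. u (z + (0, ?s)) - u z)"
      by (intro has_fourier_y_nsq_le(1) sqint_diff sqint_translate us)
    also have "\<dots> \<le> 2 * ennreal (C * ?s\<^sup>2)" by (intro mult_left_mono C) auto
    also have "\<dots> = ennreal (2 * (C * ?s\<^sup>2))" using C(1)[of 0] by (simp add: ennreal_times_2)
    finally have b: "nsq (\<lambda>z. modulated_shift (0, ?s) F z - F z) \<le> ennreal (2 * (C * ?s\<^sup>2))" .
    have "nsq (G n) = ennreal ((real (Suc n))\<^sup>2) * nsq (\<lambda>z. modulated_shift (0, ?s) F z - F z)"
      unfolding G_def[abs_def] by (subst nsq_cmult) (auto simp del: of_nat_Suc)
    also have "\<dots> \<le> ennreal ((real (Suc n))\<^sup>2) * ennreal (2 * (C * ?s\<^sup>2))" by (intro mult_left_mono b) auto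
    also have "\<dots> = ennreal ((real (Suc n))\<^sup>2 * (2 * (C * ?s\<^sup>2)))" using C(1)[of 0] by (intro ennreal_mult[symmetric]) auto
    also have "(real (Suc n))\<^sup>2 * (2 * (C * ?s\<^sup>2)) = 2 * C" by (simp add: power_divide del: of_nat_Suc)
    finally show ?thesis .
  qed
  define H where "H z = \<i> * of_real (snd z) * F z" for z
  have Hb: "nsq H \<le> ennreal (2 * C)"
  proof (rule nsq_le_of_AE_lim[where f=G and N=0])
    show "G n \<in> borel_measurable borel" for n using Gs[of n] by (simp add: sqint_def)
    show "AE z in lborel. (\<lambda>n. G n z) \<longlonglongrightarrow> H z"
    proof (rule AE_I2)
      fix z :: "real \<times> real"
      obtain x y where z: "z = (x, y)" by (cases z)
      have "(\<lambda>n. of_nat (Suc n) * (exp (\<i> * of_real y / of_nat (Suc n)) - 1) * F z) \<longlonglongrightarrow> (\<i> * of_real y) * F z"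
        by (intro tendsto_mult exp_difference_quotient tendsto_const)
      moreover have "G n z = of_nat (Suc n) * (exp (\<i> * of_real y / of_nat (Suc n)) - 1) * F z" for n
        by (simp add: G_def modulated_shift_def z algebra_simps)
      ultimately show "(\<lambda>n. G n z) \<longlonglongrightarrow> H z" by (simp add: H_def z)
    qed
  qed (use Gb in auto)
  have [measurable]: "H \<in> borel_measurable borel" unfolding H_def by measurable
  have "nsq (weighted 0 F) \<le> (\<integral>\<^sup>+z. ennreal ((cmod (F z))\<^sup>2) + ennreal ((cmod (H z))\<^sup>2) \<partial>lborel)"
    unfolding nsq_def
  proof (rule nn_integral_mono)
    fix z :: "real \<times> real"
    have "\<bar>snd z\<bar> \<le> 1 + (snd z)\<^sup>2"
      using zero_le_power2[of "\<bar>snd z\<bar> - 1"] abs_ge_zero[of "snd z"] by (simp add: power2_diff)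
    then have "\<bar>snd z\<bar> * (cmod (F z))\<^sup>2 \<le> (1 + (snd z)\<^sup>2) * (cmod (F z))\<^sup>2" by (rule mult_right_mono) simp
    then have "(cmod (weighted 0 F z))\<^sup>2 \<le> (cmod (F z))\<^sup>2 + (cmod (H z))\<^sup>2"
      by (simp add: weighted_cmod H_def norm_mult power_mult_distrib distrib_right)
    then show "ennreal ((cmod (weighted 0 F z))\<^sup>2) \<le> ennreal ((cmod (F z))\<^sup>2) + ennreal ((cmod (H z))\<^sup>2)"
      by (simp add: ennreal_leI flip: ennreal_plus)
  qed
  also have "\<dots> = nsq F + nsq H" unfolding nsq_def by (rule nn_integral_add) auto
  also have "\<dots> < \<infinity>" using Fs Hb by (auto simp: sqint_def intro: le_less_trans)
  finally have "sqint (weighted 0 F)" by (simp add: sqint_def)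
  then have "X_data u (\<lambda>z. complex_of_real (fx z)) F"
    unfolding X_data_def using us F has_weak_dx_test_fun[OF t] unfolding u_def[abs_def] by simp
  then show ?thesis using X_iff_X_data unfolding u_def[abs_def] by blast
qed

lemma X_nontrivial: "\<exists>u\<in>X. nonzero u"
proof -
  obtain b' where b: "C1c (bump 1 0 1) b'" using C1c_bump[of 0 1 1] by auto
  note t = test_fun_product[OF b b]
  let ?u = "\<lambda>z. complex_of_real (bump 1 0 1 (fst z) * bump 1 0 1 (snd z))"
  have pos: "bump 1 0 1 x > 0" if "0 < x" "x < 1" for x
    using that by (auto simp: bump_def max_def intro!: divide_pos_pos add_pos_nonneg)
  have "nonzero ?u"
    unfolding nonzero_def
  proof
    assume "AE z in lborel. ?u z = 0"
    then have "AE z in lborel. z \<notin> box (0, 0) (1::real, 1::real)"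
    proof eventually_elim
      case (elim z)
      then show ?case using pos[of "fst z"] pos[of "snd z"] by (cases z) (auto simp: box_def Basis_prod_def)
    qed
    then have "emeasure lborel (box (0, 0) (1::real, 1::real)) = 0"
      by (subst (asm) AE_iff_measurable[OF _ refl]) auto
    moreover have "emeasure lborel (box (0, 0) (1::real, 1::real)) = 1"
      by (subst emeasure_lborel_box) (auto simp: Basis_prod_def prod.union_disjoint)
    ultimately show False by simp
  qed
  then show ?thesis using symmetric_test_fun_in_X[OF t] by (simp add: mult.commute) blast
qed

section \<open>Averages over anisotropic rectangles\<close>

definition cell :: "real \<Rightarrow> real \<Rightarrow> (real \<times> real) set" where
  "cell a b = {0..<a} \<times> {0..<b}"

definition cell_avg :: "real \<Rightarrow> real \<Rightarrow> (real \<times> real \<Rightarrow> complex) \<Rightarrow> real \<times> real \<Rightarrow> complex" where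
  "cell_avg a b u z = (LINT \<zeta>|lborel. indicator (cell a b) \<zeta> * u (z + \<zeta>)) / of_real (a * b)"

lemma cell_measurable [measurable]: "cell a b \<in> sets borel"
  unfolding cell_def by (intro borel_Times) auto

lemma emeasure_cell: "a \<ge> 0 \<Longrightarrow> b \<ge> 0 \<Longrightarrow> emeasure lborel (cell a b) = ennreal (a * b)"
  unfolding cell_def lborel_prod[symmetric]
  by (subst lborel.emeasure_pair_measure_Times) (auto simp: ennreal_mult)

lemma sqint_cell: "sqint (\<lambda>\<zeta>. indicator (cell a b) \<zeta> :: complex)"
  by (rule sqint_indicator) (auto simp: cell_def intro!: bounded_Times borel_Times)

lemma nsq_cell: "a \<ge> 0 \<Longrightarrow> b \<ge> 0 \<Longrightarrow> nsq (\<lambda>\<zeta>. indicator (cell a b) \<zeta> :: complex) = ennreal (a * b)"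
  by (simp add: nsq_indicator emeasure_cell)

lemma sqint_shift: "sqint u \<Longrightarrow> sqint (\<lambda>\<zeta>. u (z + \<zeta>))"
  using sqint_translate[of u z] by (simp add: add.commute)

lemma cell_avg_integrable: "sqint u \<Longrightarrow> integrable lborel (\<lambda>\<zeta>. indicator (cell a b) \<zeta> * u (z + \<zeta>))"
  by (intro sqint_mult_integrable sqint_cell sqint_shift)

lemma cell_avg_measurable [measurable]:
  assumes u: "u \<in> borel_measurable borel"
  shows "cell_avg a b u \<in> borel_measurable borel"
proof -
  have [measurable]: "(\<lambda>x. u (fst x + snd x)) \<in> borel_measurable (borel \<Otimes>\<^sub>M borel)"
    by (rule borel_measurable_pair_continuous[OF u]) (intro continuous_intros)
  have "(\<lambda>z. (LINT \<zeta>|lborel. indicator (cell a b) \<zeta> * u (z + \<zeta>)) / of_real (a * b)) \<in> borel_measurable borel"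
    by measurable
  then show ?thesis by (simp add: cell_avg_def[abs_def])
qed

lemma cell_avg_bound:
  assumes u: "sqint u" and ab: "a > 0" "b > 0" and C: "nsq u \<le> ennreal C" "C \<ge> 0"
  shows "cmod (cell_avg a b u z) \<le> sqrt (C / (a * b))"
proof -
  let ?I = "LINT \<zeta>|lborel. indicator (cell a b) \<zeta> * u (z + \<zeta>)"
  have "ennreal ((cmod ?I)\<^sup>2) \<le> nsq (\<lambda>\<zeta>. indicator (cell a b) \<zeta> :: complex) * nsq (\<lambda>\<zeta>. u (z + \<zeta>))"
    by (rule CS_integral[OF sqint_cell sqint_shift[OF u]])
  also have "nsq (\<lambda>\<zeta>. u (z + \<zeta>)) = nsq u"
    using nsq_translate[of u z] u by (simp add: add.commute sqint_def)
  also have "nsq (\<lambda>\<zeta>. indicator (cell a b) \<zeta> :: complex) * nsq u \<le> ennreal (a * b) * ennreal C"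
    using ab C by (intro mult_mono) (auto simp: nsq_cell)
  also have "\<dots> = ennreal (a * b * C)" using ab C by (simp add: ennreal_mult)
  finally have "(cmod ?I)\<^sup>2 \<le> a * b * C" using ab C by simp
  then have "(cmod ?I)\<^sup>2 / (a * b)\<^sup>2 \<le> a * b * C / (a * b)\<^sup>2" by (rule divide_right_mono) simp
  also have "a * b * C / (a * b)\<^sup>2 = C / (a * b)" using ab by (simp add: power2_eq_square)
  finally have "(cmod ?I / (a * b))\<^sup>2 \<le> C / (a * b)" by (simp add: power_divide)
  then have "cmod ?I / (a * b) \<le> sqrt (C / (a * b))" by (rule real_le_rsqrt)
  then show ?thesis using ab by (simp add: cell_avg_def norm_divide norm_mult)
qed

lemma cell_avg_diff:
  assumes u: "sqint u" "sqint h"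
  shows "cell_avg a b (\<lambda>z. u z - h z) z = cell_avg a b u z - cell_avg a b h z"
  unfolding cell_avg_def using cell_avg_integrable[OF u(1)] cell_avg_integrable[OF u(2)]
  by (simp add: right_diff_distrib diff_divide_distrib)

lemma cell_avg_half_add:
  assumes u: "sqint u" "sqint h"
  shows "cell_avg a b (\<lambda>z. (u z + h z) / 2) z = (cell_avg a b u z + cell_avg a b h z) / 2"
proof -
  have "(LINT \<zeta>|lborel. indicator (cell a b) \<zeta> * ((u (z + \<zeta>) + h (z + \<zeta>)) / 2))
    = (LINT \<zeta>|lborel. indicator (cell a b) \<zeta> * u (z + \<zeta>) / 2 + indicator (cell a b) \<zeta> * h (z + \<zeta>) / 2)"
    by (simp add: add_divide_distrib distrib_left)
  also have "\<dots> = (LINT \<zeta>|lborel. indicator (cell a b) \<zeta> * u (z + \<zeta>)) / 2 + (LINT \<zeta>|lborel. indicator (cell a b) \<zeta> * h (z + \<zeta>)) / 2"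
    using cell_avg_integrable[OF u(1)] cell_avg_integrable[OF u(2)] by simp
  finally have e: "(LINT \<zeta>|lborel. indicator (cell a b) \<zeta> * ((u (z + \<zeta>) + h (z + \<zeta>)) / 2))
    = (LINT \<zeta>|lborel. indicator (cell a b) \<zeta> * u (z + \<zeta>)) / 2 + (LINT \<zeta>|lborel. indicator (cell a b) \<zeta> * h (z + \<zeta>)) / 2" .
  show ?thesis unfolding cell_avg_def e by (simp add: add_divide_distrib mult_ac)
qed

lemma cell_avg_translate: "cell_avg a b (\<lambda>z. u (z + c)) z = cell_avg a b u (z + c)"
  by (simp add: cell_avg_def add_ac)

text \<open>When a rectangle is a disjoint union of two translates of a cell, the integral over
  it splits accordingly; the two doubling lemmas below are its instances.\<close>

lemma cell_split_integral:
  assumes u: "sqint u" and ind: "\<And>\<zeta>. indicator K \<zeta> = (indicator (cell a b) \<zeta> + indicator (cell a b) (\<zeta> - c) :: complex)"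
  shows "(LINT \<zeta>|lborel. indicator K \<zeta> * u (z + \<zeta>))
    = (LINT \<zeta>|lborel. indicator (cell a b) \<zeta> * u (z + \<zeta>)) + (LINT \<zeta>|lborel. indicator (cell a b) \<zeta> * u (z + c + \<zeta>))"
proof -
  have [measurable]: "u \<in> borel_measurable borel" using u by (simp add: sqint_def)
  let ?g = "\<lambda>\<zeta>. indicator (cell a b) (\<zeta> - c) * u (z + \<zeta>)"
  have s: "sqint (\<lambda>\<zeta>. indicator (cell a b) (\<zeta> - c) :: complex)"
    using sqint_translate[OF sqint_cell, of a b "- c"] by simp
  have i: "integrable lborel ?g" by (rule sqint_mult_integrable[OF s sqint_shift[OF u]])
  have "(LINT \<zeta>|lborel. indicator K \<zeta> * u (z + \<zeta>)) = (LINT \<zeta>|lborel. indicator (cell a b) \<zeta> * u (z + \<zeta>) + ?g \<zeta>)"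
    by (simp only: ind distrib_right)
  also have "\<dots> = (LINT \<zeta>|lborel. indicator (cell a b) \<zeta> * u (z + \<zeta>)) + (LINT \<zeta>|lborel. ?g \<zeta>)"
    by (rule Bochner_Integration.integral_add[OF cell_avg_integrable[OF u] i])
  also have "(LINT \<zeta>|lborel. ?g \<zeta>) = (LINT \<zeta>|lborel. ?g (\<zeta> + c))"
    by (rule lebesgue_integral_lborel_translate[symmetric]) measurable
  finally show ?thesis by (simp add: add_ac)
qed

lemma cell_avg_double_x:
  assumes u: "sqint u" and a: "a > 0"
  shows "cell_avg (2 * a) b u z = (cell_avg a b u z + cell_avg a b u (z + (a, 0))) / 2"
proof -
  have "(LINT \<zeta>|lborel. indicator (cell (2 * a) b) \<zeta> * u (z + \<zeta>))
    = (LINT \<zeta>|lborel. indicator (cell a b) \<zeta> * u (z + \<zeta>)) + (LINT \<zeta>|lborel. indicator (cell a b) \<zeta> * u (z + (a, 0) + \<zeta>))"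
    using a by (intro cell_split_integral[OF u]) (auto simp: cell_def indicator_def)
  then show ?thesis unfolding cell_avg_def by (simp add: add_divide_distrib mult_ac)
qed

lemma cell_avg_double_y:
  assumes u: "sqint u" and b: "b > 0"
  shows "cell_avg a (2 * b) u z = (cell_avg a b u z + cell_avg a b u (z + (0, b))) / 2"
proof -
  have "(LINT \<zeta>|lborel. indicator (cell a (2 * b)) \<zeta> * u (z + \<zeta>))
    = (LINT \<zeta>|lborel. indicator (cell a b) \<zeta> * u (z + \<zeta>)) + (LINT \<zeta>|lborel. indicator (cell a b) \<zeta> * u (z + (0, b) + \<zeta>))"
    using b by (intro cell_split_integral[OF u]) (auto simp: cell_def indicator_def)
  then show ?thesis unfolding cell_avg_def by (simp add: add_divide_distrib mult_ac)
qed

lemma cell_avg_shift_bound: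
  assumes u: "sqint u" and ab: "a > 0" "b > 0" and C: "nsq (\<lambda>z. u (z + c) - u z) \<le> ennreal C" "C \<ge> 0"
  shows "cmod (cell_avg a b u (z + c) - cell_avg a b u z) \<le> sqrt (C / (a * b))"
  using cell_avg_bound[OF sqint_diff[OF sqint_translate[OF u] u] ab C, of z]
  by (simp add: cell_avg_diff[OF sqint_translate[OF u] u] cell_avg_translate)

lemma nsq_minus_cell_avg:
  assumes u: "sqint u" and ab: "a > 0" "b > 0"
    and C: "\<And>\<zeta>. \<zeta> \<in> cell a b \<Longrightarrow> nsq (\<lambda>z. u (z + \<zeta>) - u z) \<le> ennreal C" "C \<ge> 0"
  shows "nsq (\<lambda>z. u z - cell_avg a b u z) \<le> ennreal C"
proof -
  note um [measurable] = sqint_measurable[OF u]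
  let ?I = "\<lambda>z. LINT \<zeta>|lborel. indicator (cell a b) \<zeta> * (u (z + \<zeta>) - u z)"
  have shift: "(\<lambda>x. u (fst x + snd x)) \<in> borel_measurable (borel \<Otimes>\<^sub>M borel)"
    by (rule borel_measurable_pair_continuous[OF um]) (intro continuous_intros)
  have m: "(\<lambda>x. u (fst x + snd x) - u (fst x)) \<in> borel_measurable (borel \<Otimes>\<^sub>M borel)" using shift by measurable
  have ic: "(LINT \<zeta>|lborel. indicator (cell a b) \<zeta> * u z) = of_real (a * b) * u z" for z
  proof -
    have "integrable lborel (\<lambda>\<zeta>. indicator (cell a b) \<zeta> * (indicator (cell a b) \<zeta> :: complex))"
      by (intro sqint_mult_integrable sqint_cell)
    also have "(\<lambda>\<zeta>. indicator (cell a b) \<zeta> * (indicator (cell a b) \<zeta> :: complex)) = indicator (cell a b)"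
      by (auto simp: indicator_def fun_eq_iff)
    finally have i: "integrable lborel (indicator (cell a b) :: _ \<Rightarrow> complex)" .
    have "(LINT \<zeta>|lborel. indicator (cell a b) \<zeta> :: complex) = (LINT \<zeta>|lborel. complex_of_real (indicator (cell a b) \<zeta>))"
      by (intro Bochner_Integration.integral_cong) (auto simp: indicator_def)
    also have "\<dots> = complex_of_real (LINT \<zeta>|lborel. indicator (cell a b) \<zeta>)" by (rule integral_complex_of_real)
    also have "(LINT \<zeta>|lborel. indicator (cell a b) \<zeta> :: real) = a * b"
      using ab by (simp add: measure_def emeasure_cell)
    finally show ?thesis by simp
  qed
  have ii: "integrable lborel (\<lambda>\<zeta>. indicator (cell a b) \<zeta> * u z)" for z
  proof -
    have "integrable lborel (\<lambda>\<zeta>. indicator (cell a b) \<zeta> * (indicator (cell a b) \<zeta> :: complex) * u z)"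
      by (intro integrable_mult_left sqint_mult_integrable sqint_cell)
    also have "(\<lambda>\<zeta>. indicator (cell a b) \<zeta> * (indicator (cell a b) \<zeta> :: complex) * u z) = (\<lambda>\<zeta>. indicator (cell a b) \<zeta> * u z)"
      by (auto simp: indicator_def fun_eq_iff)
    finally show ?thesis .
  qed
  have eq: "u z - cell_avg a b u z = of_real (- 1 / (a * b)) * ?I z" for z
  proof -
    have "?I z = (LINT \<zeta>|lborel. indicator (cell a b) \<zeta> * u (z + \<zeta>)) - of_real (a * b) * u z"
      using cell_avg_integrable[OF u, of a b z] ii[of z]
      by (simp only: right_diff_distrib Bochner_Integration.integral_diff ic)
    then have "cell_avg a b u z - u z = ?I z / of_real (a * b)"
      using ab unfolding cell_avg_def by (simp add: diff_divide_distrib)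
    then have "- (cell_avg a b u z - u z) = of_real (- 1 / (a * b)) * ?I z" by simp
    then show ?thesis by simp
  qed
  have [measurable]: "?I \<in> borel_measurable borel" using shift by measurable
  have "nsq (\<lambda>z. u z - cell_avg a b u z) = ennreal ((1 / (a * b))\<^sup>2) * nsq ?I"
    unfolding eq using ab by (subst nsq_cmult) (auto simp: norm_divide norm_mult)
  also have "nsq ?I \<le> (emeasure lborel (cell a b))\<^sup>2 * ennreal C"
    using C by (intro nsq_set_integral_le m) auto
  also have "\<dots> = ennreal ((a * b)\<^sup>2 * C)" using ab C by (simp add: emeasure_cell ennreal_power flip: ennreal_mult)
  finally have "nsq (\<lambda>z. u z - cell_avg a b u z) \<le> ennreal ((1 / (a * b))\<^sup>2) * ennreal ((a * b)\<^sup>2 * C)"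
    by (simp add: mult_left_mono)
  also have "\<dots> = ennreal C" using ab C by (subst ennreal_mult[symmetric]) (auto simp: power_divide)
  finally show ?thesis .
qed

text \<open>The two facts about \<open>u\<close> on which all bounds for
  \<open>\<bar>u\<bar>\<close> to the power \<open>q\<close> rest. They hold with common
  constants for all \<open>u \<in> X\<close> with \<open>A u \<le> 1\<close>.\<close>

definition modulus_bound :: "real \<Rightarrow> real \<Rightarrow> (real \<times> real \<Rightarrow> complex) \<Rightarrow> bool" where
  "modulus_bound \<kappa> \<mu> u \<longleftrightarrow> sqint u \<and> nsq u \<le> ennreal \<mu> \<and>
     (\<forall>s\<ge>0. \<forall>t\<ge>0. nsq (\<lambda>z. u (z + (s, t)) - u z) \<le> ennreal (\<kappa> * (s\<^sup>2 + t)))"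

text \<open>Width \<open>2\<^sup>-\<^sup>k\<close> and height \<open>4\<^sup>-\<^sup>k\<close>
  balance the two terms of the modulus \<open>s\<^sup>2 + t\<close>; the rectangle has area
  \<open>8\<^sup>-\<^sup>k\<close>.\<close>

definition dyadic_avg :: "nat \<Rightarrow> (real \<times> real \<Rightarrow> complex) \<Rightarrow> real \<times> real \<Rightarrow> complex" where
  "dyadic_avg k = cell_avg ((1/2)^k) ((1/4)^k)"

lemma modulus_boundD:
  assumes "modulus_bound \<kappa> \<mu> u"
  shows "sqint u" "nsq u \<le> ennreal \<mu>" "s \<ge> 0 \<Longrightarrow> t \<ge> 0 \<Longrightarrow> nsq (\<lambda>z. u (z + (s, t)) - u z) \<le> ennreal (\<kappa> * (s\<^sup>2 + t))"
  using assms unfolding modulus_bound_def by blast+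

lemma half_pow_sq: "((1/2::real)^k)\<^sup>2 = (1/4)^k"
  by (simp add: power_mult_distrib[symmetric] power2_eq_square)

lemma nsq_minus_dyadic_avg:
  assumes u: "modulus_bound \<kappa> \<mu> u" and k: "\<kappa> > 0"
  shows "nsq (\<lambda>z. u z - dyadic_avg k u z) \<le> ennreal (2 * \<kappa> * (1/4)^k)"
  unfolding dyadic_avg_def
proof (rule nsq_minus_cell_avg[OF modulus_boundD(1)[OF u]])
  fix \<zeta> assume "\<zeta> \<in> cell ((1/2)^k) ((1/4)^k)"
  then obtain s t where z: "\<zeta> = (s, t)" "0 \<le> s" "s \<le> (1/2)^k" "0 \<le> t" "t \<le> (1/4)^k" by (auto simp: cell_def)
  have "s\<^sup>2 \<le> ((1/2)^k)\<^sup>2" using z by (intro power_mono) auto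
  then have "s\<^sup>2 + t \<le> 2 * (1/4)^k" using z unfolding half_pow_sq by linarith
  then have "\<kappa> * (s\<^sup>2 + t) \<le> 2 * \<kappa> * (1/4)^k" using mult_left_mono[of "s\<^sup>2 + t" "2 * (1/4)^k" \<kappa>] k by simp
  then show "nsq (\<lambda>z. u (z + \<zeta>) - u z) \<le> ennreal (2 * \<kappa> * (1/4)^k)"
    using modulus_boundD(3)[OF u z(2,4)] z(1) by (auto intro: order_trans ennreal_leI)
qed (use k in auto)

text \<open>From one scale to the next the rectangle is halved once in width and twice in height.
  Each halving changes the average by half the difference between two neighbouring cells, a cell
  average of a difference of translates, to which \<open>cell_avg_bound\<close> applies: a
  modulus of order \<open>4\<^sup>-\<^sup>k\<close> over an area of order
  \<open>8\<^sup>-\<^sup>k\<close>, whose root is of order \<open>sqrt 2 ^ k\<close>.\<close>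

lemma dyadic_avg_step:
  assumes u: "modulus_bound \<kappa> \<mu> u" and k: "\<kappa> > 0"
  shows "cmod (dyadic_avg (Suc k) u z) \<le> cmod (dyadic_avg k u z) + 2 * sqrt \<kappa> * sqrt 2 ^ Suc k"
proof -
  define s where "s = (1/2::real) ^ Suc k"
  have s: "s > 0" by (simp add: s_def)
  have s2: "(1/4::real) ^ Suc k = s\<^sup>2" unfolding s_def half_pow_sq ..
  have us: "sqint u" by (rule modulus_boundD(1)[OF u])
  have rs: "sqrt (\<kappa> / s) = sqrt \<kappa> * sqrt 2 ^ Suc k"
  proof -
    have "\<kappa> / s = \<kappa> * 2 ^ Suc k" unfolding s_def by (simp only: power_one_over divide_inverse inverse_inverse_eq mult_1_left power_inverse)
    then show ?thesis by (simp only: real_sqrt_mult real_sqrt_power)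
  qed
  \<comment> \<open>Halving the width.\<close>
  have 1: "cmod (cell_avg (2 * s) (4 * s\<^sup>2) u z - cell_avg s (4 * s\<^sup>2) u z) \<le> sqrt (\<kappa> / s)"
  proof -
    have "nsq (\<lambda>z. u (z + (s, 0)) - u z) \<le> ennreal (\<kappa> * s\<^sup>2)" using modulus_boundD(3)[OF u, of s 0] s by simp
    then have "cmod (cell_avg s (4 * s\<^sup>2) u (z + (s, 0)) - cell_avg s (4 * s\<^sup>2) u z) \<le> sqrt (\<kappa> * s\<^sup>2 / (s * (4 * s\<^sup>2)))"
      using s k by (intro cell_avg_shift_bound us) auto
    also have "\<dots> \<le> sqrt (\<kappa> / s)" using s k by (intro real_sqrt_le_mono) (simp add: field_simps)
    finally have "cmod ((cell_avg s (4 * s\<^sup>2) u (z + (s, 0)) - cell_avg s (4 * s\<^sup>2) u z) / 2) \<le> sqrt (\<kappa> / s)"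
      by (simp add: norm_divide) (smt (verit) norm_ge_zero)
    moreover have "cell_avg (2 * s) (4 * s\<^sup>2) u z - cell_avg s (4 * s\<^sup>2) u z = (cell_avg s (4 * s\<^sup>2) u (z + (s, 0)) - cell_avg s (4 * s\<^sup>2) u z) / 2"
      unfolding cell_avg_double_x[OF us s] by (simp add: field_simps)
    ultimately show ?thesis by (simp only:)
  qed
  \<comment> \<open>Halving the height, for a cell of arbitrary height; it is used for both
    halvings.\<close>
  have 2: "2 * cmod (cell_avg s (2 * b) u z - cell_avg s b u z) \<le> sqrt (\<kappa> / s)" if b: "b > 0" for b
  proof -
    have "nsq (\<lambda>z. u (z + (0, b)) - u z) \<le> ennreal (\<kappa> * b)" using modulus_boundD(3)[OF u, of 0 b] b by simp
    then have "cmod (cell_avg s b u (z + (0, b)) - cell_avg s b u z) \<le> sqrt (\<kappa> * b / (s * b))"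
      using s b k by (intro cell_avg_shift_bound us) auto
    also have "\<kappa> * b / (s * b) = \<kappa> / s" using b by simp
    finally have "cmod (cell_avg s b u (z + (0, b)) - cell_avg s b u z) \<le> sqrt (\<kappa> / s)" .
    moreover have "cell_avg s (2 * b) u z - cell_avg s b u z = (cell_avg s b u (z + (0, b)) - cell_avg s b u z) / 2"
      unfolding cell_avg_double_y[OF us b] by (simp add: field_simps)
    ultimately show ?thesis by (simp only: norm_divide norm_numeral)
  qed
  have dk: "dyadic_avg k u z = cell_avg (2 * s) (4 * s\<^sup>2) u z"
  proof -
    have "4 * s\<^sup>2 = (1/4)^k" unfolding s2[symmetric] by simp
    moreover have "2 * s = (1/2)^k" by (simp add: s_def)
    ultimately show ?thesis unfolding dyadic_avg_def by simp
  qed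
  have dk1: "dyadic_avg (Suc k) u z = cell_avg s (s\<^sup>2) u z" unfolding dyadic_avg_def s2 s_def[symmetric] ..
  have "cmod (dyadic_avg k u z - dyadic_avg (Suc k) u z) \<le> cmod (cell_avg (2 * s) (4 * s\<^sup>2) u z - cell_avg s (4 * s\<^sup>2) u z)
     + cmod (cell_avg s (4 * s\<^sup>2) u z - cell_avg s (2 * s\<^sup>2) u z) + cmod (cell_avg s (2 * s\<^sup>2) u z - cell_avg s (s\<^sup>2) u z)"
    unfolding dk dk1
    using norm_triangle_ineq[of "cell_avg (2 * s) (4 * s\<^sup>2) u z - cell_avg s (4 * s\<^sup>2) u z" "cell_avg s (4 * s\<^sup>2) u z - cell_avg s (s\<^sup>2) u z"]
      norm_triangle_ineq[of "cell_avg s (4 * s\<^sup>2) u z - cell_avg s (2 * s\<^sup>2) u z" "cell_avg s (2 * s\<^sup>2) u z - cell_avg s (s\<^sup>2) u z"]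
    by simp
  also have "\<dots> \<le> 2 * sqrt (\<kappa> / s)" using 1 2[of "2 * s\<^sup>2"] 2[of "s\<^sup>2"] s by simp
  finally have d: "cmod (dyadic_avg k u z - dyadic_avg (Suc k) u z) \<le> 2 * sqrt \<kappa> * sqrt 2 ^ Suc k" unfolding rs by simp
  show "cmod (dyadic_avg (Suc k) u z) \<le> cmod (dyadic_avg k u z) + 2 * sqrt \<kappa> * sqrt 2 ^ Suc k"
    using d norm_triangle_sub[of "dyadic_avg (Suc k) u z" "dyadic_avg k u z"] norm_minus_commute[of "dyadic_avg k u z" "dyadic_avg (Suc k) u z"] by linarith
qed

text \<open>The coefficient 8 absorbs the sum of the increments of
  \<open>dyadic_avg_step\<close>, whose ratio is \<open>sqrt 2\<close>.\<close>

definition dyadic_avg_bound_const :: "real \<Rightarrow> real \<Rightarrow> real" where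
  "dyadic_avg_bound_const \<kappa> \<mu> = sqrt \<mu> + 8 * sqrt \<kappa>"

lemma dyadic_avg_bound:
  assumes u: "modulus_bound \<kappa> \<mu> u" and k: "\<kappa> > 0" "\<mu> > 0"
  shows "cmod (dyadic_avg k u z) \<le> dyadic_avg_bound_const \<kappa> \<mu> * sqrt 2 ^ k"
proof (induction k)
  case 0
  have "cmod (dyadic_avg 0 u z) \<le> sqrt (\<mu> / (1 * 1))"
    unfolding dyadic_avg_def using cell_avg_bound[OF modulus_boundD(1)[OF u], of 1 1 \<mu> z] modulus_boundD(2)[OF u] k by simp
  then show ?case using k by (simp add: dyadic_avg_bound_const_def) (smt (verit) real_sqrt_ge_zero)
next
  case (Suc k)
  let ?p = "sqrt 2 ^ k :: real"
  have p: "?p > 0" by simp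
  have r: "(7/5::real) \<le> sqrt 2" by (rule real_le_rsqrt) (simp add: power2_eq_square)
  have sk: "sqrt \<kappa> > 0" "sqrt \<mu> > 0" using k by auto
  have "2 * sqrt \<kappa> * sqrt 2 \<le> dyadic_avg_bound_const \<kappa> \<mu> * (sqrt 2 - 1)"
  proof -
    have r2: "sqrt 2 \<le> (3/2::real)" by (rule real_le_lsqrt) (auto simp: power2_eq_square)
    have "2 * sqrt \<kappa> * sqrt 2 \<le> 2 * sqrt \<kappa> * (3/2)" using r2 sk by (intro mult_left_mono) auto
    also have "\<dots> \<le> 8 * sqrt \<kappa> * (2/5)" using sk by simp
    also have "\<dots> \<le> dyadic_avg_bound_const \<kappa> \<mu> * (sqrt 2 - 1)" using r sk by (intro mult_mono) (auto simp: dyadic_avg_bound_const_def)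
    finally show ?thesis .
  qed
  then have "2 * sqrt \<kappa> * sqrt 2 * ?p \<le> dyadic_avg_bound_const \<kappa> \<mu> * (sqrt 2 - 1) * ?p" using p by (intro mult_right_mono) auto
  then show ?case using dyadic_avg_step[OF u k(1), of k z] Suc by (simp add: algebra_simps)
qed

section \<open>The subcritical embedding\<close>

text \<open>Where \<open>\<bar>u\<bar>\<close> is more than twice the bound of its average, at
  least half of \<open>u\<close> comes from the difference between \<open>u\<close> and the
  average, which is small in \<open>L\<^sup>2\<close>.\<close>

lemma high_level_set:
  assumes u: "modulus_bound \<kappa> \<mu> u" and k: "\<kappa> > 0" and c: "\<And>z. cmod (dyadic_avg j u z) \<le> c"
  shows "(\<integral>\<^sup>+z. ennreal ((cmod (u z))\<^sup>2) * indicator {z. cmod (u z) > 2 * c} z \<partial>lborel) \<le> ennreal (8 * \<kappa> * (1/4)^j)"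
proof -
  have um [measurable]: "u \<in> borel_measurable borel" using modulus_boundD(1)[OF u] by (simp add: sqint_def)
  have [measurable]: "dyadic_avg j u \<in> borel_measurable borel" unfolding dyadic_avg_def by measurable
  have "(\<integral>\<^sup>+z. ennreal ((cmod (u z))\<^sup>2) * indicator {z. cmod (u z) > 2 * c} z \<partial>lborel)
    \<le> (\<integral>\<^sup>+z. ennreal 4 * ennreal ((cmod (u z - dyadic_avg j u z))\<^sup>2) \<partial>lborel)"
  proof (rule nn_integral_mono)
    fix z
    show "ennreal ((cmod (u z))\<^sup>2) * indicator {z. cmod (u z) > 2 * c} z \<le> ennreal 4 * ennreal ((cmod (u z - dyadic_avg j u z))\<^sup>2)"
    proof (cases "cmod (u z) > 2 * c")
      case True
      have "cmod (u z) \<le> cmod (u z - dyadic_avg j u z) + cmod (dyadic_avg j u z)" using norm_triangle_ineq[of "u z - dyadic_avg j u z" "dyadic_avg j u z"] by simp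
      then have "cmod (u z) \<le> 2 * cmod (u z - dyadic_avg j u z)" using True c[of z] by linarith
      then have "(cmod (u z))\<^sup>2 \<le> (2 * cmod (u z - dyadic_avg j u z))\<^sup>2" by (rule power_mono) simp
      then have "(cmod (u z))\<^sup>2 \<le> 4 * (cmod (u z - dyadic_avg j u z))\<^sup>2" by (simp add: power_mult_distrib)
      then show ?thesis using True ennreal_leI[of "(cmod (u z))\<^sup>2" "4 * (cmod (u z - dyadic_avg j u z))\<^sup>2"] by (simp add: ennreal_mult)
    qed simp
  qed
  also have "\<dots> = ennreal 4 * nsq (\<lambda>z. u z - dyadic_avg j u z)" unfolding nsq_def by (rule nn_integral_cmult) measurable
  also have "\<dots> \<le> ennreal 4 * ennreal (2 * \<kappa> * (1/4)^j)" by (intro mult_left_mono nsq_minus_dyadic_avg[OF u k]) simp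
  also have "\<dots> = ennreal (8 * \<kappa> * (1/4)^j)" using k by (subst ennreal_mult[symmetric]) auto
  finally show ?thesis .
qed

lemma powr_split_square: "x \<ge> 0 \<Longrightarrow> x powr q = x powr (q - 2) * x\<^sup>2" for x q :: real
  by (cases "x = 0") (auto simp: powr_diff powr_numeral field_simps)

lemma ennreal_le_sum3:
  fixes a b c :: ennreal
  shows "a \<le> a + b + c" "b \<le> a + b + c" "c \<le> a + b + c"
proof -
  show "a \<le> a + b + c" by (rule order_trans[of _ "a + b"]) auto
  show "b \<le> a + b + c" by (rule order_trans[of _ "a + b"]) auto
  show "c \<le> a + b + c" by auto
qed

text \<open>A decomposition of \<open>x powr q = x powr (q - 2) \<cdot> x\<^sup>2\<close>
  according to the level of \<open>x\<close>: below \<open>2\<delta>\<close>, between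
  \<open>2\<delta>\<close> and the \<open>k\<close>-th dyadic level, and above it. On each range
  \<open>x powr (q - 2)\<close> is replaced by its largest value.\<close>

lemma powr_le_levels:
  fixes x \<delta> q D :: real
  assumes x: "x \<ge> 0" and q: "q > 2" and d: "\<delta> \<ge> 0" and D: "D > 0"
  shows "ennreal (x powr q) \<le> ennreal ((2 * \<delta>) powr (q - 2)) * ennreal (x\<^sup>2)
    + ennreal ((2 * (D * sqrt 2 ^ k)) powr (q - 2)) * (ennreal (x\<^sup>2) * indicator {x. x > 2 * \<delta>} x)
    + (\<Sum>i. ennreal ((2 * (D * sqrt 2 ^ Suc (k + i))) powr (q - 2)) * (ennreal (x\<^sup>2) * indicator {x. x > 2 * (D * sqrt 2 ^ (k + i))} x))"
    (is "_ \<le> ?a + ?b + (\<Sum>i. ?c i)")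
proof -
  have le: "ennreal (x powr q) \<le> ennreal (y powr (q - 2)) * ennreal (x\<^sup>2)" if "x \<le> y" for y
  proof -
    have "x powr (q - 2) \<le> y powr (q - 2)" using that x q by (intro powr_mono2) auto
    then have "x powr q \<le> y powr (q - 2) * x\<^sup>2" unfolding powr_split_square[OF x, of q] by (rule mult_right_mono) simp
    then show ?thesis by (simp add: ennreal_leI flip: ennreal_mult)
  qed
  consider "x \<le> 2 * \<delta>" | "x > 2 * \<delta>" "x \<le> 2 * (D * sqrt 2 ^ k)" | "x > 2 * (D * sqrt 2 ^ k)" by linarith
  then show ?thesis
  proof cases
    case 1
    then have "ennreal (x powr q) \<le> ?a" by (rule le)
    then show ?thesis using ennreal_le_sum3(1) by (rule order_trans)
  next
    case 2
    then have "ennreal (x powr q) \<le> ?b" using le[of "2 * (D * sqrt 2 ^ k)"] by simp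
    then show ?thesis using ennreal_le_sum3(2) by (rule order_trans)
  next
    case 3
    obtain n where "x / (2 * D) < sqrt 2 ^ n"
      using real_arch_pow[of "sqrt 2" "x / (2 * D)"] by auto
    then have ex: "x \<le> 2 * (D * sqrt 2 ^ n)" using D by (simp add: field_simps)
    \<comment> \<open>The lowest dyadic level above \<open>x\<close>; then \<open>x\<close>
      exceeds the level before it.\<close>
    define j where "j = (LEAST n. x \<le> 2 * (D * sqrt 2 ^ n))"
    have j: "x \<le> 2 * (D * sqrt 2 ^ j)" unfolding j_def by (rule LeastI[of _ n]) (rule ex)
    have "k < j"
    proof (rule ccontr)
      assume "\<not> k < j"
      then have "sqrt 2 ^ j \<le> (sqrt 2 ^ k :: real)" by (intro power_increasing) auto
      then have "2 * (D * sqrt 2 ^ j) \<le> 2 * (D * sqrt 2 ^ k)" using D by simp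
      with 3 j show False by linarith
    qed
    then obtain i where i: "j = Suc (k + i)" using less_iff_Suc_add by auto
    have "\<not> x \<le> 2 * (D * sqrt 2 ^ (k + i))" using not_less_Least[of "k + i" "\<lambda>n. x \<le> 2 * (D * sqrt 2 ^ n)"] i by (simp add: j_def)
    then have "ennreal (x powr q) \<le> ?c i" using le[OF j] by (simp add: i)
    also have "?c i \<le> (\<Sum>i. ?c i)" using sum_le_suminf[of ?c "{i}"] by simp
    finally show ?thesis using ennreal_le_sum3(3) by (rule order_trans)
  qed
qed

definition dyadic_avg_ratio :: "real \<Rightarrow> real" where "dyadic_avg_ratio q = sqrt 2 powr (q - 2) / 4"

text \<open>This is where \<open>q < 6\<close>, that is \<open>p < 5\<close>, enters.\<close>

lemma dyadic_avg_ratio: "2 < q \<Longrightarrow> q < 6 \<Longrightarrow> 0 < dyadic_avg_ratio q \<and> dyadic_avg_ratio q < 1"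
proof -
  assume q: "2 < q" "q < 6"
  have "sqrt 2 powr (q - 2) < sqrt 2 powr 4" using q by (intro powr_less_mono) (auto simp: real_less_rsqrt)
  also have "sqrt 2 powr 4 = (sqrt 2)^4" by (simp add: powr_numeral)
  also have "(sqrt 2)^4 = (4::real)" using power_mult[of "sqrt 2" 2 2] by simp
  finally show ?thesis by (simp add: dyadic_avg_ratio_def)
qed

definition dyadic_avg_const :: "real \<Rightarrow> real \<Rightarrow> real \<Rightarrow> real" where
  "dyadic_avg_const \<kappa> \<mu> q = 8 * \<kappa> * (2 * dyadic_avg_bound_const \<kappa> \<mu>) powr (q - 2) * (1 + sqrt 2 powr (q - 2) / (1 - dyadic_avg_ratio q))"

text \<open>The estimate of \<open>powr_le_levels\<close> is integrated: each term is controlled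
  by \<open>high_level_set\<close>, at the levels above \<open>k\<close> with the universal bound
  \<open>dyadic_avg_bound\<close>, below with the assumed bound \<open>\<delta>\<close>. With
  \<open>k = 0\<close> this is the Sobolev embedding; with \<open>k\<close> large and
  \<open>\<delta>\<close> small it says that small averages force a small integral.\<close>

lemma nn_powr_le:
  assumes u: "modulus_bound \<kappa> \<mu> u" and k: "\<kappa> > 0" "\<mu> > 0" and q: "2 < q" "q < 6"
    and d: "\<And>z. cmod (dyadic_avg k u z) \<le> \<delta>"
  shows "(\<integral>\<^sup>+z. ennreal (cmod (u z) powr q) \<partial>lborel)
    \<le> ennreal ((2 * \<delta>) powr (q - 2) * \<mu> + dyadic_avg_const \<kappa> \<mu> q * dyadic_avg_ratio q ^ k)"
proof -
  have um [measurable]: "u \<in> borel_measurable borel" using modulus_boundD(1)[OF u] by (simp add: sqint_def)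
  have d0: "\<delta> \<ge> 0" using d[of 0] norm_ge_zero order_trans by blast
  define D where "D = dyadic_avg_bound_const \<kappa> \<mu>"
  have D: "D > 0" using k by (simp add: D_def dyadic_avg_bound_const_def add_pos_pos)
  define B where "B = (2 * D) powr (q - 2)"
  define \<rho> where "\<rho> = sqrt 2 powr (q - 2)"
  define \<theta> where "\<theta> = dyadic_avg_ratio q"
  have \<theta>: "0 < \<theta>" "\<theta> < 1" using dyadic_avg_ratio[OF q] by (auto simp: \<theta>_def)
  have \<rho>: "\<rho> > 0" "\<theta> = \<rho> * (1/4)" by (auto simp: \<rho>_def \<theta>_def dyadic_avg_ratio_def)
  have B: "B \<ge> 0" by (simp add: B_def)
  have lev: "(2 * (D * sqrt 2 ^ j)) powr (q - 2) = B * \<rho> ^ j" for j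
  proof -
    have "(2 * (D * sqrt 2 ^ j)) powr (q - 2) = (2 * D) powr (q - 2) * (sqrt 2 ^ j) powr (q - 2)"
      using D by (simp add: powr_mult mult.assoc[symmetric])
    also have "(sqrt 2 ^ j) powr (q - 2) = \<rho> ^ j"
      unfolding \<rho>_def by (simp add: powr_realpow[symmetric] powr_powr powr_power mult.commute)
    finally show ?thesis by (simp add: B_def)
  qed
  let ?I = "\<lambda>c z. ennreal ((cmod (u z))\<^sup>2) * indicator {z. cmod (u z) > 2 * c} z"
  have "(\<integral>\<^sup>+z. ennreal (cmod (u z) powr q) \<partial>lborel) \<le> (\<integral>\<^sup>+z. ennreal ((2 * \<delta>) powr (q - 2)) * ennreal ((cmod (u z))\<^sup>2)
    + ennreal (B * \<rho> ^ k) * ?I \<delta> z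
    + (\<Sum>i. ennreal (B * \<rho> ^ Suc (k + i)) * ?I (D * sqrt 2 ^ (k + i)) z) \<partial>lborel)"
  proof (rule nn_integral_mono)
    fix z
    have "indicator {z. cmod (u z) > 2 * c} z = (indicator {x. x > 2 * c} (cmod (u z)) :: ennreal)" for c
      by (simp add: indicator_def)
    then show "ennreal (cmod (u z) powr q) \<le> ennreal ((2 * \<delta>) powr (q - 2)) * ennreal ((cmod (u z))\<^sup>2)
    + ennreal (B * \<rho> ^ k) * ?I \<delta> z + (\<Sum>i. ennreal (B * \<rho> ^ Suc (k + i)) * ?I (D * sqrt 2 ^ (k + i)) z)"
      using powr_le_levels[OF norm_ge_zero[of "u z"] q(1) d0 D, of k] by (simp only: lev)
  qed
  also have "\<dots> = ennreal ((2 * \<delta>) powr (q - 2)) * nsq u + ennreal (B * \<rho> ^ k) * (\<integral>\<^sup>+z. ?I \<delta> z \<partial>lborel)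
    + (\<Sum>i. ennreal (B * \<rho> ^ Suc (k + i)) * (\<integral>\<^sup>+z. ?I (D * sqrt 2 ^ (k + i)) z \<partial>lborel))"
    unfolding nsq_def by (simp add: nn_integral_add nn_integral_cmult nn_integral_suminf)
  also have "\<dots> \<le> ennreal ((2 * \<delta>) powr (q - 2)) * ennreal \<mu> + ennreal (B * \<rho> ^ k) * ennreal (8 * \<kappa> * (1/4)^k)
    + (\<Sum>i. ennreal (B * \<rho> ^ Suc (k + i)) * ennreal (8 * \<kappa> * (1/4)^(k + i)))"
    by (intro add_mono mult_left_mono suminf_le summableI high_level_set[OF u k(1)] d modulus_boundD(2)[OF u])
      (auto simp: D_def intro: dyadic_avg_bound[OF u k])
  also have "(\<Sum>i. ennreal (B * \<rho> ^ Suc (k + i)) * ennreal (8 * \<kappa> * (1/4)^(k + i))) = ennreal (8 * \<kappa> * B * \<rho> * \<theta> ^ k / (1 - \<theta>))"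
  proof -
    have e: "ennreal (B * \<rho> ^ Suc (k + i)) * ennreal (8 * \<kappa> * (1/4)^(k + i)) = ennreal (8 * \<kappa> * B * \<rho> * \<theta> ^ k * \<theta> ^ i)" for i
    proof -
      have "B * \<rho> ^ Suc (k + i) * (8 * \<kappa> * (1/4)^(k + i)) = 8 * \<kappa> * B * \<rho> * \<theta> ^ k * \<theta> ^ i"
        unfolding \<rho>(2) power_mult_distrib power_add power_Suc by (simp only: ac_simps)
      moreover have "ennreal (B * \<rho> ^ Suc (k + i)) * ennreal (8 * \<kappa> * (1/4)^(k + i)) = ennreal (B * \<rho> ^ Suc (k + i) * (8 * \<kappa> * (1/4)^(k + i)))"
        by (rule ennreal_mult[symmetric]) (use B \<rho>(1) k in simp_all)
      ultimately show ?thesis by (simp only:)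
    qed
    have "(\<lambda>i. 8 * \<kappa> * B * \<rho> * \<theta> ^ k * \<theta> ^ i) sums (8 * \<kappa> * B * \<rho> * \<theta> ^ k * (1 / (1 - \<theta>)))"
      using \<theta> by (intro sums_mult geometric_sums) auto
    then show ?thesis unfolding e using B \<rho>(1) k \<theta>
      by (subst suminf_ennreal2) (auto simp: sums_iff)
  qed
  also have "ennreal (B * \<rho> ^ k) * ennreal (8 * \<kappa> * (1/4)^k) = ennreal (8 * \<kappa> * B * \<theta> ^ k)"
  proof -
    have "ennreal (B * \<rho> ^ k) * ennreal (8 * \<kappa> * (1/4)^k) = ennreal (B * \<rho> ^ k * (8 * \<kappa> * (1/4)^k))"
      by (rule ennreal_mult[symmetric]) (use B \<rho>(1) k in simp_all)
    also have "B * \<rho> ^ k * (8 * \<kappa> * (1/4)^k) = 8 * \<kappa> * B * \<theta> ^ k"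
      unfolding \<rho>(2) power_mult_distrib by (simp only: ac_simps)
    finally show ?thesis .
  qed
  also have "ennreal ((2 * \<delta>) powr (q - 2)) * ennreal \<mu> + ennreal (8 * \<kappa> * B * \<theta> ^ k) + ennreal (8 * \<kappa> * B * \<rho> * \<theta> ^ k / (1 - \<theta>))
    = ennreal ((2 * \<delta>) powr (q - 2) * \<mu> + 8 * \<kappa> * B * \<theta> ^ k + 8 * \<kappa> * B * \<rho> * \<theta> ^ k / (1 - \<theta>))"
    using B \<rho>(1) k \<theta> by (simp flip: ennreal_mult ennreal_plus)
  also have "(2 * \<delta>) powr (q - 2) * \<mu> + 8 * \<kappa> * B * \<theta> ^ k + 8 * \<kappa> * B * \<rho> * \<theta> ^ k / (1 - \<theta>)
    = (2 * \<delta>) powr (q - 2) * \<mu> + dyadic_avg_const \<kappa> \<mu> q * \<theta> ^ k"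
    unfolding dyadic_avg_const_def D_def[symmetric] B_def[symmetric] \<rho>_def[symmetric] \<theta>_def[symmetric]
    by (simp add: algebra_simps)
  finally show ?thesis unfolding \<theta>_def .
qed

section \<open>The variational problem\<close>

locale nls =
  fixes \<omega> v p :: real
  assumes \<omega>: "\<omega> > 0" and v: "\<bar>v\<bar> < 1" and p: "1 < p" "p < 5"
begin

definition q :: real where "q = p + 1"

lemma q: "2 < q" "q < 6" using p by (auto simp: q_def)

definition A :: "(real \<times> real \<Rightarrow> complex) \<Rightarrow> real" where "A u = quad_form \<omega> v u"

definition N :: "(real \<times> real \<Rightarrow> complex) \<Rightarrow> real" where "N u = (LINT z|lborel. cmod (u z) powr q)"

text \<open>The constant of \<open>nsq_translate_le_quad_form\<close>.\<close>

definition \<kappa> :: real where "\<kappa> = 8 / (1 - \<bar>v\<bar>)"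

lemma \<kappa>: "\<kappa> > 0" using v by (simp add: \<kappa>_def)

lemma A_nonneg: "u \<in> X \<Longrightarrow> 0 \<le> A u" unfolding A_def using \<omega> v by (intro quad_form_nonneg)

lemma A_ge: "u \<in> X \<Longrightarrow> \<omega> * rnsq u \<le> A u" unfolding A_def by (rule quad_form_ge[OF _ v])

lemma A_cmult: "u \<in> X \<Longrightarrow> A (\<lambda>z. c * u z) = (cmod c)\<^sup>2 * A u" unfolding A_def by (rule quad_form_cmult[OF _ v])

lemma A_translate: "u \<in> X \<Longrightarrow> A (\<lambda>z. u (z + c)) = A u" unfolding A_def by (rule quad_form_translate[OF _ v])

lemma A_parallelogram: "u \<in> X \<Longrightarrow> h \<in> X \<Longrightarrow> A (\<lambda>z. u z + h z) + A (\<lambda>z. u z - h z) = 2 * A u + 2 * A h"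
  unfolding A_def by (rule quad_form_parallelogram[OF _ _ v])

lemma A_add_le: "u \<in> X \<Longrightarrow> h \<in> X \<Longrightarrow> t > 0 \<Longrightarrow> A (\<lambda>z. u z + h z) \<le> (1 + t) * A u + (1 + 1/t) * A h"
  unfolding A_def by (rule quad_form_add_le[OF _ _ v \<omega>])

lemma X_modulus_bound:
  assumes u: "u \<in> X" and A1: "A u \<le> 1"
  shows "modulus_bound \<kappa> (1 / \<omega>) u"
  unfolding modulus_bound_def
proof (intro conjI allI impI)
  show s: "sqint u" by (rule X_sqint[OF u])
  have "\<omega> * rnsq u \<le> 1" using A_ge[OF u] A1 by linarith
  then have "rnsq u \<le> 1 / \<omega>" using \<omega> by (simp add: field_simps)
  then show "nsq u \<le> ennreal (1 / \<omega>)" by (simp add: nsq_rnsq[OF s] ennreal_leI)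
  fix s t :: real assume st: "s \<ge> 0" "t \<ge> 0"
  have "nsq (\<lambda>z. u (z + (s, t)) - u z) \<le> ennreal (\<kappa> * (s\<^sup>2 + \<bar>t\<bar>) * A u)"
    unfolding \<kappa>_def A_def by (rule nsq_translate_le_quad_form[OF u v \<omega> st(1)])
  also have "\<dots> \<le> ennreal (\<kappa> * (s\<^sup>2 + t))"
    using mult_left_mono[OF A1, of "\<kappa> * (s\<^sup>2 + t)"] \<kappa> st by (intro ennreal_leI) simp
  finally show "nsq (\<lambda>z. u (z + (s, t)) - u z) \<le> ennreal (\<kappa> * (s\<^sup>2 + t))" .
qed

lemma normalize:
  assumes u: "u \<in> X"
  shows "\<exists>c>0. (\<lambda>z. of_real c * u z) \<in> X \<and> A (\<lambda>z. of_real c * u z) \<le> 1"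
proof -
  define c where "c = 1 / sqrt (1 + A u)"
  have "1 + A u > 0" using A_nonneg[OF u] by simp
  then have "c > 0" "c\<^sup>2 * A u \<le> 1" by (auto simp: c_def power_divide divide_le_eq)
  then show ?thesis using X_cmult[OF u] A_cmult[OF u, of "of_real c"] by (intro exI[of _ c]) auto
qed

lemma sobolev_bounded: "\<exists>C\<ge>0. \<forall>u\<in>X. A u \<le> 1 \<longrightarrow> (\<integral>\<^sup>+z. ennreal (cmod (u z) powr q) \<partial>lborel) \<le> ennreal C"
proof (intro exI conjI ballI impI)
  let ?D = "dyadic_avg_bound_const \<kappa> (1 / \<omega>)"
  fix u assume "u \<in> X" "A u \<le> 1"
  note u = X_modulus_bound[OF this]
  show "(\<integral>\<^sup>+z. ennreal (cmod (u z) powr q) \<partial>lborel) \<le> ennreal (max 0 ((2 * ?D) powr (q - 2) * (1 / \<omega>) + dyadic_avg_const \<kappa> (1 / \<omega>) q * dyadic_avg_ratio q ^ 0))"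
    by (rule order_trans[OF nn_powr_le[OF u \<kappa> _ q, where k=0 and \<delta>="?D"]])
      (use dyadic_avg_bound[OF u \<kappa>, of 0] \<omega> in \<open>auto intro: ennreal_leI\<close>)
qed simp

lemma X_powr_integrable:
  assumes u: "u \<in> X"
  shows "integrable lborel (\<lambda>z. cmod (u z) powr q)"
proof -
  have um [measurable]: "u \<in> borel_measurable borel" using X_sqint[OF u] by (simp add: sqint_def)
  obtain C where C: "\<And>u. u \<in> X \<Longrightarrow> A u \<le> 1 \<Longrightarrow> (\<integral>\<^sup>+z. ennreal (cmod (u z) powr q) \<partial>lborel) \<le> ennreal C"
    using sobolev_bounded by blast
  obtain c where c: "c > 0" "(\<lambda>z. of_real c * u z) \<in> X" "A (\<lambda>z. of_real c * u z) \<le> 1" using normalize[OF u] by blast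
  have "(\<integral>\<^sup>+z. ennreal (cmod (of_real c * u z) powr q) \<partial>lborel) < \<infinity>"
    using C[OF c(2,3)] by (auto intro: le_less_trans)
  then have "integrable lborel (\<lambda>z. cmod (of_real c * u z) powr q)"
    by (intro integrableI_bounded) auto
  then have "integrable lborel (\<lambda>z. c powr q * cmod (u z) powr q)"
    using c(1) by (simp add: norm_mult powr_mult)
  then show ?thesis using c(1) by simp
qed

lemma nn_N: "u \<in> X \<Longrightarrow> (\<integral>\<^sup>+z. ennreal (cmod (u z) powr q) \<partial>lborel) = ennreal (N u)"
  unfolding N_def by (rule nn_integral_eq_integral[OF X_powr_integrable]) auto

lemma N_nonneg: "0 \<le> N u" unfolding N_def by simp

lemma N_cmult: "N (\<lambda>z. of_real c * u z) = \<bar>c\<bar> powr q * N u"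
  by (simp add: N_def norm_mult powr_mult)

lemma N_translate:
  assumes "u \<in> X" shows "N (\<lambda>z. u (z + c)) = N u"
proof -
  have [measurable]: "u \<in> borel_measurable borel" using X_sqint[OF assms] by (simp add: sqint_def)
  have "ennreal (N (\<lambda>z. u (z + c))) = ennreal (N u)"
    unfolding nn_N[OF assms, symmetric] nn_N[OF X_translate[OF assms], symmetric]
    by (rule nn_integral_lborel_translate) measurable
  then show ?thesis using N_nonneg by (simp add: ennreal_inj)
qed

text \<open>A substitute for concentration compactness: the scale \<open>k\<close> beyond which
  the geometric series contributes less than \<open>\<eta>/2\<close> depends on
  \<open>\<eta>\<close> alone, so a lower bound for \<open>N u\<close> is seen by the averages at
  this single scale.\<close>

lemma nonvanishing:
  assumes \<eta>: "\<eta> > 0"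
  shows "\<exists>k. \<exists>\<delta>>0. \<forall>u\<in>X. A u \<le> 1 \<longrightarrow> N u > \<eta> \<longrightarrow> (\<exists>z. cmod (dyadic_avg k u z) > \<delta>)"
proof -
  define E where "E = dyadic_avg_const \<kappa> (1 / \<omega>) q"
  have "(\<lambda>k. E * dyadic_avg_ratio q ^ k) \<longlonglongrightarrow> E * 0"
    using dyadic_avg_ratio[OF q] by (intro tendsto_intros LIMSEQ_power_zero) auto
  then have "eventually (\<lambda>k. E * dyadic_avg_ratio q ^ k < \<eta> / 2) sequentially"
    using \<eta> by (intro order_tendstoD(2)) auto
  then obtain k where k: "E * dyadic_avg_ratio q ^ k < \<eta> / 2" using eventually_happens'[OF sequentially_bot] by blast
  \<comment> \<open>The value for which \<open>(2\<delta>) powr (q - 2) / \<omega> =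
    \<eta>/2\<close>.\<close>
  define \<delta> where "\<delta> = (\<eta> * \<omega> / 2) powr (1 / (q - 2)) / 2"
  have \<delta>: "\<delta> > 0" using \<eta> \<omega> by (simp add: \<delta>_def)
  have "(2 * \<delta>) powr (q - 2) * (1 / \<omega>) = \<eta> / 2"
    using \<eta> \<omega> q by (simp add: \<delta>_def powr_powr)
  then have tot: "(2 * \<delta>) powr (q - 2) * (1 / \<omega>) + E * dyadic_avg_ratio q ^ k < \<eta>" using k by linarith
  have "\<exists>z. cmod (dyadic_avg k u z) > \<delta>" if u: "u \<in> X" "A u \<le> 1" "N u > \<eta>" for u
  proof (rule ccontr)
    assume "\<not> (\<exists>z. cmod (dyadic_avg k u z) > \<delta>)"
    then have "\<And>z. cmod (dyadic_avg k u z) \<le> \<delta>" by (meson not_less)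
    from nn_powr_le[OF X_modulus_bound[OF u(1,2)] \<kappa> _ q this] \<omega>
    have "ennreal (N u) \<le> ennreal ((2 * \<delta>) powr (q - 2) * (1 / \<omega>) + E * dyadic_avg_ratio q ^ k)"
      by (simp add: nn_N[OF u(1)] E_def)
    also have "\<dots> \<le> ennreal \<eta>" using tot by (intro ennreal_leI) simp
    finally show False using u(3) \<eta> by simp
  qed
  then show ?thesis using \<delta> by blast
qed

end

section \<open>Limits of convex combinations\<close>

text \<open>Dyadic convex combinations of the members of the sequence with index at least
  \<open>n\<close>. Closure under midpoints is all that the parallelogram law uses, and it gives
  a simple induction principle.\<close>

inductive_set midpoint_hull :: "(nat \<Rightarrow> real \<times> real \<Rightarrow> complex) \<Rightarrow> nat \<Rightarrow> (real \<times> real \<Rightarrow> complex) set"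
  for U n where
  base: "n \<le> k \<Longrightarrow> U k \<in> midpoint_hull U n"
| mid: "f \<in> midpoint_hull U n \<Longrightarrow> g \<in> midpoint_hull U n \<Longrightarrow> (\<lambda>z. (f z + g z) / 2) \<in> midpoint_hull U n"

lemma midpoint_hull_mono: "f \<in> midpoint_hull U m \<Longrightarrow> n \<le> m \<Longrightarrow> f \<in> midpoint_hull U n"
  by (induction rule: midpoint_hull.induct) (auto intro: midpoint_hull.intros)

lemma X_mid: "f \<in> X \<Longrightarrow> g \<in> X \<Longrightarrow> (\<lambda>z. (f z + g z) / 2) \<in> X"
  using X_lincomb[of f g "1/2" "1/2"] by (simp add: add_divide_distrib)

lemma midpoint_hull_X: "f \<in> midpoint_hull U n \<Longrightarrow> (\<And>k. U k \<in> X) \<Longrightarrow> f \<in> X"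
  by (induction rule: midpoint_hull.induct) (auto intro: X_mid)

lemma dyadic_avg_mid: "f \<in> X \<Longrightarrow> g \<in> X \<Longrightarrow> dyadic_avg j (\<lambda>z. (f z + g z) / 2) z = (dyadic_avg j f z + dyadic_avg j g z) / 2"
  unfolding dyadic_avg_def by (intro cell_avg_half_add X_sqint)

text \<open>Discs are convex: what holds for the averages of the tail holds for those of its
  combinations.\<close>

lemma midpoint_hull_dyadic_avg:
  assumes "f \<in> midpoint_hull U n" and U: "\<And>k. U k \<in> X" and c: "\<And>k. k \<ge> n \<Longrightarrow> cmod (dyadic_avg j (U k) z - c) \<le> e"
  shows "cmod (dyadic_avg j f z - c) \<le> e"
  using assms(1)
proof (induction rule: midpoint_hull.induct)
  case (base k)
  then show ?case by (rule c)
next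
  case (mid f g)
  have "dyadic_avg j (\<lambda>z. (f z + g z) / 2) z - c = ((dyadic_avg j f z - c) + (dyadic_avg j g z - c)) / 2"
    by (simp add: dyadic_avg_mid midpoint_hull_X[OF mid.hyps(1) U] midpoint_hull_X[OF mid.hyps(2) U] field_simps)
  moreover have "cmod ((dyadic_avg j f z - c) + (dyadic_avg j g z - c)) \<le> 2 * e"
    using norm_triangle_ineq[of "dyadic_avg j f z - c" "dyadic_avg j g z - c"] mid.IH by linarith
  ultimately show ?case by (simp only: norm_divide norm_numeral)
qed

text \<open>Convexity of \<open>x powr r\<close> at the points \<open>x/(1-t)\<close> and
  \<open>y/t\<close> with weights \<open>1-t\<close> and \<open>t\<close>. As \<open>t\<close>
  tends to 0 the factor of \<open>x powr r\<close> tends to 1.\<close>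

lemma powr_add_le_weighted:
  fixes x y t r :: real
  assumes "x \<ge> 0" "y \<ge> 0" "0 < t" "t < 1" "r \<ge> 1"
  shows "(x + y) powr r \<le> (1 - t) powr (1 - r) * x powr r + t powr (1 - r) * y powr r"
proof (cases "x = 0 \<or> y = 0")
  case True
  have "1 \<le> t powr (1 - r)" using powr_mono'[of "1 - r" 0 t] assms by simp
  moreover have "1 \<le> (1 - t) powr (1 - r)" using powr_mono'[of "1 - r" 0 "1 - t"] assms by simp
  ultimately show ?thesis
    using True mult_right_mono[of 1 "t powr (1 - r)" "y powr r"] mult_right_mono[of 1 "(1 - t) powr (1 - r)" "x powr r"]
    by auto
next
  case False
  have "((1 - t) * (x / (1 - t)) + t * (y / t)) powr r \<le> (1 - t) * (x / (1 - t)) powr r + t * (y / t) powr r"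
  proof -
    have "convex_on {0<..} (\<lambda>x::real. x powr r)" using assms(5) by (rule powr_convex)
    from convex_onD[OF this, of t "x / (1 - t)" "y / t"] show ?thesis using assms False by simp
  qed
  moreover have "(1 - t) * (x / (1 - t)) = x" "t * (y / t) = y" using assms by auto
  moreover have "(1 - t) * (x / (1 - t)) powr r = (1 - t) powr (1 - r) * x powr r"
    using assms by (simp add: powr_divide powr_diff)
  moreover have "t * (y / t) powr r = t powr (1 - r) * y powr r"
    using assms by (simp add: powr_divide powr_diff)
  ultimately show ?thesis by simp
qed

context nls
begin

text \<open>The constant of the embedding, and the maximum to be attained.\<close>

definition S :: real where "S = Sup {N u | u. u \<in> X \<and> A u \<le> 1}"

lemma N_le_S: "u \<in> X \<Longrightarrow> A u \<le> 1 \<Longrightarrow> N u \<le> S"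
proof -
  obtain C where C: "C \<ge> 0" "\<And>u. u \<in> X \<Longrightarrow> A u \<le> 1 \<Longrightarrow> (\<integral>\<^sup>+z. ennreal (cmod (u z) powr q) \<partial>lborel) \<le> ennreal C"
    using sobolev_bounded by blast
  have "N u \<le> C" if "u \<in> X" "A u \<le> 1" for u
    using C(2)[OF that] C(1) by (simp add: nn_N[OF that(1)])
  then have "bdd_above {N u | u. u \<in> X \<and> A u \<le> 1}" by (auto simp: bdd_above_def)
  then show "u \<in> X \<Longrightarrow> A u \<le> 1 \<Longrightarrow> N u \<le> S" unfolding S_def by (intro cSup_upper) auto
qed

lemma N_pos:
  assumes u: "u \<in> X" "nonzero u" shows "N u > 0"
proof (rule ccontr)
  assume "\<not> N u > 0"
  then have "N u = 0" using N_nonneg[of u] by linarith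
  then have "AE z in lborel. cmod (u z) powr q = 0"
    unfolding N_def using X_powr_integrable[OF u(1)] by (subst (asm) integral_nonneg_eq_0_iff_AE) auto
  then show False using u(2) by (auto simp: nonzero_def)
qed

lemma A_pos:
  assumes u: "u \<in> X" "nonzero u" shows "A u > 0"
proof (rule ccontr)
  assume "\<not> A u > 0"
  then have "\<omega> * rnsq u \<le> 0" using A_ge[OF u(1)] by linarith
  then have "rnsq u \<le> 0" using \<omega> by (simp add: mult_le_0_iff)
  then have "nsq u = 0" using nsq_rnsq[OF X_sqint[OF u(1)]] by (simp add: ennreal_neg)
  then show False using u(2) X_sqint[OF u(1)] by (auto simp: nonzero_def nsq_eq_0_iff sqint_def)
qed

lemma S_pos: "S > 0"
proof -
  obtain u where u: "u \<in> X" "nonzero u" using X_nontrivial by blast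
  obtain c where c: "c > 0" "(\<lambda>z. of_real c * u z) \<in> X" "A (\<lambda>z. of_real c * u z) \<le> 1" using normalize[OF u(1)] by blast
  have "0 < N (\<lambda>z. of_real c * u z)" using N_pos[OF u] c(1) by (simp add: N_cmult)
  then show ?thesis using N_le_S[OF c(2,3)] by linarith
qed

lemma N_le:
  assumes u: "u \<in> X" shows "N u \<le> S * A u powr (q / 2)"
proof (cases "nonzero u")
  case False
  then have "N u = 0" unfolding N_def nonzero_def
    using X_powr_integrable[OF u] by (subst integral_nonneg_eq_0_iff_AE) auto
  then show ?thesis using S_pos by simp
next
  case True
  have a: "A u > 0" by (rule A_pos[OF u True])
  define c where "c = 1 / sqrt (A u)"
  have c: "c > 0" using a by (simp add: c_def)
  have "c\<^sup>2 * A u = 1" using a by (simp add: c_def power_divide)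
  then have "A (\<lambda>z. of_real c * u z) = 1" using A_cmult[OF u, of "of_real c"] by simp
  then have "c powr q * N u \<le> S" using N_le_S[of "\<lambda>z. of_real c * u z"] X_cmult[OF u] c by (simp add: N_cmult)
  moreover have "c powr q = 1 / A u powr (q / 2)"
    using a by (simp add: c_def powr_divide powr_half_sqrt[symmetric] powr_powr)
  ultimately show ?thesis using a by (simp add: field_simps)
qed

lemma A_mid:
  assumes "f \<in> X" "g \<in> X"
  shows "A (\<lambda>z. (f z + g z) / 2) = A f / 2 + A g / 2 - A (\<lambda>z. f z - g z) / 4"
proof -
  have "A (\<lambda>z. (f z + g z) / 2) = A (\<lambda>z. f z + g z) / 4"
    using A_cmult[OF X_add[OF assms], of "1/2"] by (simp add: power2_eq_square norm_divide)
  then show ?thesis using A_parallelogram[OF assms] by simp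
qed

lemma midpoint_hull_A_le:
  assumes "f \<in> midpoint_hull U n" and U: "\<And>k. U k \<in> X" "\<And>k. A (U k) \<le> c"
  shows "A f \<le> c"
  using assms(1)
proof (induction rule: midpoint_hull.induct)
  case (mid f g)
  have "f \<in> X" "g \<in> X" using midpoint_hull_X[OF mid.hyps(1) U(1)] midpoint_hull_X[OF mid.hyps(2) U(1)] by auto
  then show ?case using A_mid[of f g] mid.IH A_nonneg[OF X_diff[of f g]] by linarith
qed (rule U)

text \<open>The Hilbert space argument for the element of least norm in a convex set, applied to
  the tails. Their infima \<open>d n\<close> increase to a limit \<open>D\<close>; if \<open>V
  n\<close> is within \<open>1 / Suc n\<close> of \<open>d n\<close>, then the midpoint of
  \<open>V i\<close> and \<open>V j\<close> has \<open>A\<close> at least \<open>d M\<close>, for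
  \<open>i, j \<ge> M\<close>, and the parallelogram law makes \<open>V\<close> a Cauchy
  sequence.\<close>

lemma convex_combinations_converge:
  assumes U: "\<And>k. U k \<in> X" "\<And>k. A (U k) \<le> 1"
  shows "\<exists>V u. (\<forall>n. V n \<in> midpoint_hull U n) \<and> u \<in> X \<and> (\<lambda>n. A (\<lambda>z. V n z - u z)) \<longlonglongrightarrow> 0"
proof -
  define d where "d n = Inf (A ` midpoint_hull U n)" for n
  have bdd: "bdd_below (A ` midpoint_hull U n)" for n
    using A_nonneg midpoint_hull_X[OF _ U(1)] by (intro bdd_belowI[of _ 0]) auto
  have ne: "A ` midpoint_hull U n \<noteq> {}" for n using midpoint_hull.base[of n n U] by auto
  have dle: "d n \<le> A f" if "f \<in> midpoint_hull U n" for n f unfolding d_def using bdd that by (intro cInf_lower) auto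
  have "\<exists>f\<in>midpoint_hull U n. A f < d n + 1 / real (Suc n)" for n
    using cInf_lessD[OF ne[of n], of "d n + 1 / real (Suc n)"] unfolding d_def by (auto simp del: of_nat_Suc)
  then obtain V where V: "\<And>n. V n \<in> midpoint_hull U n" "\<And>n. A (V n) < d n + 1 / real (Suc n)" by metis
  have VX: "V n \<in> X" for n using midpoint_hull_X[OF V(1) U(1)] .
  have dmono: "d n \<le> d m" if "n \<le> m" for n m
    unfolding d_def using bdd ne that by (intro cInf_superset_mono) (auto intro: midpoint_hull_mono)
  have d1: "d n \<le> 1" for n using dle[OF midpoint_hull.base[of n n U]] U(2)[of n] by simp
  have "bdd_above (range d)" using d1 by (auto simp: bdd_above_def)
  define D where "D = (SUP n. d n)"
  have dD: "d n \<le> D" for n unfolding D_def using \<open>bdd_above (range d)\<close> by (rule cSUP_upper[rotated]) simp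
  have cau: "\<exists>M. \<forall>i\<ge>M. \<forall>j\<ge>M. quad_form \<omega> v (\<lambda>z. V i z - V j z) \<le> e" if e: "e > 0" for e
  proof -
    have "\<exists>n. D - e / 8 < d n" using less_cSUP_iff[of UNIV d "D - e/8"] \<open>bdd_above (range d)\<close> e by (auto simp: D_def)
    then obtain n where n: "D - e / 8 < d n" by blast
    obtain m where m: "1 / real (Suc m) < e / 8" using nat_approx_posE[of "e/8"] e by auto
    define M where "M = max n m"
    have "quad_form \<omega> v (\<lambda>z. V i z - V j z) \<le> e" if ij: "i \<ge> M" "j \<ge> M" for i j
    proof -
      have "(\<lambda>z. (V i z + V j z) / 2) \<in> midpoint_hull U M"
        by (intro midpoint_hull.mid midpoint_hull_mono[OF V(1)] ij)
      then have "d M \<le> A (V i) / 2 + A (V j) / 2 - A (\<lambda>z. V i z - V j z) / 4"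
        using dle A_mid[OF VX VX] by metis
      moreover have "d M \<ge> D - e / 8" using dmono[of n M] n by (simp add: M_def)
      moreover have bV: "A (V k) \<le> D + e / 8" if "k \<ge> M" for k
      proof -
        have "1 / real (Suc k) \<le> 1 / real (Suc m)" using that by (intro divide_left_mono) (auto simp: M_def)
        then show ?thesis using V(2)[of k] dD[of k] m by linarith
      qed
      ultimately show ?thesis using bV[OF ij(1)] bV[OF ij(2)] unfolding A_def[symmetric] by linarith
    qed
    then show ?thesis by blast
  qed
  from X_complete[OF VX v \<omega> cau] obtain u where "u \<in> X" "(\<lambda>n. A (\<lambda>z. V n z - u z)) \<longlonglongrightarrow> 0"
    unfolding A_def by blast
  then show ?thesis using V(1) by blast
qed

lemma dyadic_avg_diff_le:
  assumes "f \<in> X" "g \<in> X"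
  shows "cmod (dyadic_avg k f z - dyadic_avg k g z) \<le> sqrt (A (\<lambda>z. f z - g z) * 8 ^ k / \<omega>)"
proof -
  note fg = X_sqint[OF assms(1)] X_sqint[OF assms(2)]
  have "rnsq (\<lambda>z. f z - g z) \<le> A (\<lambda>z. f z - g z) / \<omega>"
    using A_ge[OF X_diff[OF assms]] \<omega> by (simp add: field_simps)
  then have "nsq (\<lambda>z. f z - g z) \<le> ennreal (A (\<lambda>z. f z - g z) / \<omega>)"
    unfolding nsq_rnsq[OF sqint_diff[OF fg]] by (rule ennreal_leI)
  moreover have "0 \<le> A (\<lambda>z. f z - g z) / \<omega>" using A_nonneg[OF X_diff[OF assms]] \<omega> by simp
  ultimately have "cmod (cell_avg ((1/2)^k) ((1/4)^k) (\<lambda>z. f z - g z) z) \<le> sqrt (A (\<lambda>z. f z - g z) / \<omega> / ((1/2)^k * (1/4)^k))"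
    by (intro cell_avg_bound sqint_diff fg) auto
  also have "(1/2::real)^k * (1/4)^k = 1 / 8 ^ k" unfolding power_mult_distrib[symmetric] by (simp add: power_one_over)
  finally show ?thesis unfolding dyadic_avg_def cell_avg_diff[OF fg, symmetric] by (simp add: field_simps)
qed

lemma dyadic_avg_equicontinuous:
  assumes u: "u \<in> X" "A u \<le> 1" and st: "s \<ge> 0" "t \<ge> 0"
  shows "cmod (dyadic_avg k u (z + (s, t)) - dyadic_avg k u z) \<le> sqrt (\<kappa> * (s\<^sup>2 + t) * 8 ^ k)"
proof -
  note a = X_modulus_bound[OF u]
  have "cmod (dyadic_avg k u (z + (s, t)) - dyadic_avg k u z) \<le> sqrt (\<kappa> * (s\<^sup>2 + t) / ((1/2)^k * (1/4)^k))"
    unfolding dyadic_avg_def using \<kappa> st by (intro cell_avg_shift_bound modulus_boundD(1)[OF a] modulus_boundD(3)[OF a]) auto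
  also have "(1/2::real)^k * (1/4)^k = 1 / 8 ^ k" unfolding power_mult_distrib[symmetric] by (simp add: power_one_over)
  finally show ?thesis by simp
qed

text \<open>The argument of Arzela and Ascoli: a diagonal subsequence converges at all scales and
  all rational points, and equicontinuity extends this to all points.\<close>

lemma dyadic_avg_convergent_subsequence:
  assumes U: "\<And>k. U k \<in> X" "\<And>k. A (U k) \<le> 1"
  shows "\<exists>r::nat\<Rightarrow>nat. strict_mono r \<and> (\<forall>k z. convergent (\<lambda>n. dyadic_avg k (U (r n)) z))"
proof -
  define D where "D = dyadic_avg_bound_const \<kappa> (1 / \<omega>)"
  have D: "D > 0" using \<kappa> \<omega> by (simp add: D_def dyadic_avg_bound_const_def add_pos_pos)
  \<comment> \<open>Rescaled so that all scales have the common bound 1 and can be treated as one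
    family indexed by scale and point.\<close>
  define f where "f n x = (case x of (k, z) \<Rightarrow> dyadic_avg k (U n) z / of_real (D * sqrt 2 ^ k))" for n x
  have fb: "norm (f n x) \<le> 1" for n x
  proof -
    obtain k z where x: "x = (k, z)" by (cases x)
    have "cmod (dyadic_avg k (U n) z) \<le> D * sqrt 2 ^ k"
      unfolding D_def using \<omega> by (intro dyadic_avg_bound[OF X_modulus_bound[OF U] \<kappa>]) simp
    then show ?thesis using D by (simp add: f_def x norm_divide norm_mult norm_power)
  qed
  have "countable ((UNIV :: nat set) \<times> (\<rat> \<times> \<rat> :: (real \<times> real) set))"
    by (intro countable_SIGMA countable_rat) auto
  then obtain r where r: "strict_mono (r :: nat \<Rightarrow> nat)"
    "\<And>x. x \<in> UNIV \<times> (\<rat> \<times> \<rat>) \<Longrightarrow> \<exists>l. (\<lambda>n. f (r n) x) \<longlonglongrightarrow> l"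
    using function_convergent_subsequence[of "(UNIV :: nat set) \<times> (\<rat> \<times> \<rat> :: (real \<times> real) set)" f 1] fb by blast
  have rat: "convergent (\<lambda>n. dyadic_avg k (U (r n)) z)" if z: "z \<in> \<rat> \<times> \<rat>" for k z
  proof -
    obtain l where "(\<lambda>n. f (r n) (k, z)) \<longlonglongrightarrow> l" using r(2)[of "(k, z)"] z by auto
    then have "(\<lambda>n. f (r n) (k, z) * of_real (D * sqrt 2 ^ k)) \<longlonglongrightarrow> l * of_real (D * sqrt 2 ^ k)" by (intro tendsto_intros)
    then show ?thesis using D by (auto simp: f_def convergent_def)
  qed
  have "Cauchy (\<lambda>n. dyadic_avg k (U (r n)) z)" for k z
  proof (rule metric_CauchyI)
    fix e :: real assume e: "e > 0"
    \<comment> \<open>The size of \<open>s\<^sup>2 + t\<close> up to which the modulus of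
      \<open>dyadic_avg_equicontinuous\<close> is at most \<open>e/3\<close>.\<close>
    define c where "c = (e/3)\<^sup>2 / (\<kappa> * 8 ^ k)"
    have c: "c > 0" using e \<kappa> by (simp add: c_def)
    define m where "m = min 1 (c / 4)"
    have m: "m > 0" "m \<le> 1" "m \<le> c / 4" using c by (auto simp: m_def)
    \<comment> \<open>The rational point is taken to the lower left of \<open>z\<close>, since
      the modulus is stated for nonnegative shifts.\<close>
    obtain x where x: "x \<in> \<rat>" "fst z - m < x" "x < fst z" using Rats_dense_in_real[of "fst z - m" "fst z"] m by auto
    obtain y where y: "y \<in> \<rat>" "snd z - m < y" "y < snd z" using Rats_dense_in_real[of "snd z - m" "snd z"] m by auto
    have xy: "z = (x, y) + (fst z - x, snd z - y)" by (cases z) simp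
    have close: "cmod (dyadic_avg k (U n) z - dyadic_avg k (U n) (x, y)) < e / 3" for n
    proof -
      have "(fst z - x)\<^sup>2 \<le> (fst z - x) * 1" unfolding power2_eq_square using x m by (intro mult_left_mono) auto
      then have "(fst z - x)\<^sup>2 \<le> c / 4" using x m by simp
      then have "(fst z - x)\<^sup>2 + (snd z - y) < c" using y(2) m(3) c by simp
      then have "\<kappa> * ((fst z - x)\<^sup>2 + (snd z - y)) * 8 ^ k < \<kappa> * c * 8 ^ k" using \<kappa> by simp
      also have "\<dots> = (e/3)\<^sup>2" using \<kappa> by (simp add: c_def)
      finally have "sqrt (\<kappa> * ((fst z - x)\<^sup>2 + (snd z - y)) * 8 ^ k) < e / 3" using e by (intro real_less_lsqrt) auto
      moreover have "cmod (dyadic_avg k (U n) ((x, y) + (fst z - x, snd z - y)) - dyadic_avg k (U n) (x, y)) \<le> sqrt (\<kappa> * ((fst z - x)\<^sup>2 + (snd z - y)) * 8 ^ k)"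
        using x y by (intro dyadic_avg_equicontinuous U) auto
      ultimately show ?thesis using xy by simp
    qed
    have "Cauchy (\<lambda>n. dyadic_avg k (U (r n)) (x, y))" using rat[of "(x, y)" k] x y by (simp add: Cauchy_convergent_iff)
    then obtain M where M: "\<And>i j. i \<ge> M \<Longrightarrow> j \<ge> M \<Longrightarrow> dist (dyadic_avg k (U (r i)) (x, y)) (dyadic_avg k (U (r j)) (x, y)) < e / 3"
      using metric_CauchyD[of _ "e/3"] e by (metis divide_pos_pos zero_less_numeral)
    have "dist (dyadic_avg k (U (r i)) z) (dyadic_avg k (U (r j)) z) < e" if "i \<ge> M" "j \<ge> M" for i j
    proof -
      have "dist (dyadic_avg k (U (r i)) z) (dyadic_avg k (U (r j)) z) \<le> cmod (dyadic_avg k (U (r i)) z - dyadic_avg k (U (r i)) (x, y))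
        + dist (dyadic_avg k (U (r i)) (x, y)) (dyadic_avg k (U (r j)) (x, y)) + cmod (dyadic_avg k (U (r j)) z - dyadic_avg k (U (r j)) (x, y))"
        unfolding dist_norm[symmetric] by (metis add.assoc dist_commute dist_triangle dist_triangle_le add_left_mono)
      then show ?thesis using close[of "r i"] close[of "r j"] M[OF that] by linarith
    qed
    then show "\<exists>M. \<forall>i\<ge>M. \<forall>j\<ge>M. dist (dyadic_avg k (U (r i)) z) (dyadic_avg k (U (r j)) z) < e" by blast
  qed
  then show ?thesis using r(1) by (auto simp: Cauchy_convergent_iff)
qed

text \<open>The averages of \<open>V n\<close> have the same limit as those of \<open>U
  n\<close>, because they are convex combinations of the tail, and converge to those of
  \<open>u\<close>, because \<open>V n\<close> converges in norm.\<close>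

lemma dyadic_avg_limit:
  assumes U: "\<And>k. U k \<in> X" and conv: "convergent (\<lambda>n. dyadic_avg k (U n) z)"
    and V: "\<And>n. V n \<in> midpoint_hull U n" and u: "u \<in> X" and lim: "(\<lambda>n. A (\<lambda>z. V n z - u z)) \<longlonglongrightarrow> 0"
  shows "(\<lambda>n. dyadic_avg k (U n) z) \<longlonglongrightarrow> dyadic_avg k u z"
proof -
  obtain l where l: "(\<lambda>n. dyadic_avg k (U n) z) \<longlonglongrightarrow> l" using conv by (auto simp: convergent_def)
  have VX: "V n \<in> X" for n using midpoint_hull_X[OF V U] .
  have "(\<lambda>n. dyadic_avg k (V n) z) \<longlonglongrightarrow> l"
  proof (rule LIMSEQ_I)
    fix e :: real assume e: "e > 0"
    then obtain M where M: "\<And>n. n \<ge> M \<Longrightarrow> norm (dyadic_avg k (U n) z - l) < e / 2" using LIMSEQ_D[OF l, of "e/2"] by auto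
    have "norm (dyadic_avg k (V n) z - l) < e" if "n \<ge> M" for n
    proof -
      have "cmod (dyadic_avg k (V n) z - l) \<le> e / 2"
        by (rule midpoint_hull_dyadic_avg[OF V[of n] U]) (use M that in \<open>force intro: less_imp_le\<close>)
      then show ?thesis using e by simp
    qed
    then show "\<exists>M. \<forall>n\<ge>M. norm (dyadic_avg k (V n) z - l) < e" by blast
  qed
  moreover have "(\<lambda>n. dyadic_avg k (V n) z) \<longlonglongrightarrow> dyadic_avg k u z"
  proof (rule Lim_null[THEN iffD2], rule Lim_null_comparison)
    show "\<forall>\<^sub>F n in sequentially. norm (dyadic_avg k (V n) z - dyadic_avg k u z) \<le> sqrt (A (\<lambda>z. V n z - u z) * 8 ^ k / \<omega>)"
      by (intro always_eventually allI dyadic_avg_diff_le VX u)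
    have "(\<lambda>n. sqrt (A (\<lambda>z. V n z - u z) * 8 ^ k / \<omega>)) \<longlonglongrightarrow> sqrt (0 * 8 ^ k / \<omega>)"
      using \<omega> by (intro tendsto_intros lim) auto
    then show "(\<lambda>n. sqrt (A (\<lambda>z. V n z - u z) * 8 ^ k / \<omega>)) \<longlonglongrightarrow> 0" by simp
  qed
  ultimately show ?thesis using l LIMSEQ_unique by blast
qed

section \<open>Attainment of the maximum\<close>

lemma A_limit:
  assumes V: "\<And>n. V n \<in> X" "\<And>n. A (V n) \<le> 1" and u: "u \<in> X" and lim: "(\<lambda>n. A (\<lambda>z. V n z - u z)) \<longlonglongrightarrow> 0"
  shows "A u \<le> 1" "e > 0 \<Longrightarrow> \<exists>M. \<forall>n\<ge>M. A u - e \<le> A (V n)"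
proof -
  have *: "\<exists>M. \<forall>n\<ge>M. A u - e \<le> A (V n)" if e: "e > 0" for e
  proof -
    define t where "t = e / 2"
    have t: "t > 0" using e by (simp add: t_def)
    have "(\<lambda>n. (1 + 1/t) * A (\<lambda>z. V n z - u z)) \<longlonglongrightarrow> (1 + 1/t) * 0" by (intro tendsto_intros lim)
    then have "eventually (\<lambda>n. (1 + 1/t) * A (\<lambda>z. V n z - u z) < e / 2) sequentially"
      using e by (intro order_tendstoD(2)) auto
    then obtain M where M: "\<And>n. n \<ge> M \<Longrightarrow> (1 + 1/t) * A (\<lambda>z. V n z - u z) < e / 2" by (auto simp: eventually_sequentially)
    have "A u - e \<le> A (V n)" if "n \<ge> M" for n
    proof -
      have d: "(\<lambda>z. u z - V n z) \<in> X" by (rule X_diff[OF u V(1)])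
      have "A (\<lambda>z. u z - V n z) = A (\<lambda>z. V n z - u z)"
        using A_cmult[OF X_diff[OF V(1)[of n] u], of "-1"] by simp
      then have "A u \<le> (1 + t) * A (V n) + (1 + 1/t) * A (\<lambda>z. V n z - u z)"
        using A_add_le[OF V(1)[of n] d t] by simp
      moreover have "t * A (V n) \<le> t * 1" using V(2)[of n] t by (intro mult_left_mono) auto
      ultimately show ?thesis using M[OF that] by (simp add: distrib_right t_def)
    qed
    then show ?thesis by blast
  qed
  then show "e > 0 \<Longrightarrow> \<exists>M. \<forall>n\<ge>M. A u - e \<le> A (V n)" .
  show "A u \<le> 1"
  proof (rule field_le_epsilon)
    fix e :: real assume "e > 0"
    then obtain M where "A u - e \<le> A (V M)" using * by blast
    then show "A u \<le> 1 + e" using V(2)[of M] by linarith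
  qed
qed

text \<open>Local strong compactness. For a fine scale \<open>j\<close> the functions are
  uniformly close in \<open>L\<^sup>2\<close> to their averages, and the averages converge
  boundedly; against a square-integrable weight dominated convergence applies, so \<open>U
  n\<close> tends to \<open>u\<close> in the weighted norm.\<close>

lemma AE_convergent_subsequence:
  assumes U: "\<And>n. U n \<in> X" "\<And>n. A (U n) \<le> 1" and u: "u \<in> X" "A u \<le> 1"
    and lim: "\<And>k z. (\<lambda>n. dyadic_avg k (U n) z) \<longlonglongrightarrow> dyadic_avg k u z"
  shows "\<exists>r::nat\<Rightarrow>nat. strict_mono r \<and> (AE z in lborel. (\<lambda>n. U (r n) z) \<longlonglongrightarrow> u z)"
proof -
  obtain k :: "real \<times> real \<Rightarrow> real" where k: "\<And>z. 0 < k z" "\<And>z. k z \<le> 1" "sqint (\<lambda>z. complex_of_real (k z))"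
    using positive_sqint_weight by blast
  define w where "w z = complex_of_real (k z)" for z
  have w: "w z \<noteq> 0" "cmod (w z) \<le> 1" "sqint w" for z
    using k(1,2)[of z] k(3) unfolding w_def[abs_def] by (auto simp: abs_of_pos)
  have wm [measurable]: "w \<in> borel_measurable borel" using w(3) by (simp add: sqint_def)
  have us: "sqint u" "\<And>n. sqint (U n)" using X_sqint u U by auto
  have um [measurable]: "u \<in> borel_measurable borel" "\<And>n. U n \<in> borel_measurable borel" using us by (auto simp: sqint_def)
  have dm [measurable]: "f \<in> borel_measurable borel \<Longrightarrow> dyadic_avg j f \<in> borel_measurable borel" for j f
    unfolding dyadic_avg_def by measurable
  have wle: "nsq (\<lambda>z. w z * f z) \<le> nsq f" for f
    using mult_left_le_one_le[OF norm_ge_zero norm_ge_zero w(2)] by (intro nsq_mono_AE AE_I2) (simp add: norm_mult)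
  have "(\<lambda>n. nsq (\<lambda>z. w z * (U n z - u z))) \<longlonglongrightarrow> 0"
  proof (rule ennreal_tendsto_0I)
    fix e :: real assume e: "e > 0"
    have "(\<lambda>j. 2 * \<kappa> * (1/4)^j) \<longlonglongrightarrow> 2 * \<kappa> * 0" by (intro tendsto_intros LIMSEQ_power_zero) auto
    then have "eventually (\<lambda>j. 2 * \<kappa> * (1/4)^j < e / 10) sequentially" using e by (intro order_tendstoD(2)) auto
    then obtain j where j: "2 * \<kappa> * (1/4)^j < e / 10" using eventually_happens'[OF sequentially_bot] by blast
    define D where "D = dyadic_avg_bound_const \<kappa> (1 / \<omega>) * sqrt 2 ^ j"
    have Db: "cmod (dyadic_avg j f z) \<le> D" if "f \<in> X" "A f \<le> 1" for f z
      unfolding D_def using \<omega> by (intro dyadic_avg_bound[OF X_modulus_bound[OF that] \<kappa>]) simp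
    have "(\<lambda>n. nsq (\<lambda>z. w z * (dyadic_avg j (U n) z - dyadic_avg j u z))) \<longlonglongrightarrow> 0"
    proof (rule nsq_tendsto_0_dominated)
      show "sqint (\<lambda>z. of_real (2 * D) * w z)" by (intro sqint_cmult w)
      show "AE z in lborel. cmod (w z * (dyadic_avg j (U n) z - dyadic_avg j u z)) \<le> cmod (of_real (2 * D) * w z)" for n
      proof (rule AE_I2)
        fix z
        have "cmod (dyadic_avg j (U n) z - dyadic_avg j u z) \<le> 2 * D"
          using norm_triangle_ineq4[of "dyadic_avg j (U n) z" "dyadic_avg j u z"] Db[OF U(1)[of n] U(2)[of n], of z] Db[OF u, of z] by linarith
        then have "cmod (w z) * cmod (dyadic_avg j (U n) z - dyadic_avg j u z) \<le> cmod (w z) * \<bar>2 * D\<bar>" by (intro mult_left_mono) auto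
        then show "cmod (w z * (dyadic_avg j (U n) z - dyadic_avg j u z)) \<le> cmod (of_real (2 * D) * w z)"
          unfolding norm_mult norm_of_real by (simp only: mult.commute)
      qed
      show "AE z in lborel. (\<lambda>n. w z * (dyadic_avg j (U n) z - dyadic_avg j u z)) \<longlonglongrightarrow> 0"
        by (intro AE_I2 tendsto_mult_right_zero LIM_zero lim)
    qed measurable
    from ennreal_tendsto_0D[OF this, of "e / 10"] e
    obtain M where M: "\<And>n. n \<ge> M \<Longrightarrow> nsq (\<lambda>z. w z * (dyadic_avg j (U n) z - dyadic_avg j u z)) \<le> ennreal (e / 10)" by auto
    have approx: "nsq (\<lambda>z. w z * f z - w z * dyadic_avg j f z) \<le> ennreal (e / 10)" if f: "f \<in> X" "A f \<le> 1" for f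
    proof -
      have "nsq (\<lambda>z. w z * (f z - dyadic_avg j f z)) \<le> ennreal (2 * \<kappa> * (1/4)^j)"
        using wle nsq_minus_dyadic_avg[OF X_modulus_bound[OF f] \<kappa>] by (rule order_trans)
      also have "\<dots> \<le> ennreal (e / 10)" using j by (intro ennreal_leI) simp
      finally show ?thesis by (simp add: right_diff_distrib)
    qed
    have "nsq (\<lambda>z. w z * (U n z - u z)) \<le> ennreal e" if n: "n \<ge> M" for n
    proof -
      have 1: "nsq (\<lambda>z. w z * dyadic_avg j (U n) z - w z * dyadic_avg j u z) \<le> ennreal (e / 10)"
        using M[OF n] by (simp add: right_diff_distrib)
      have 2: "nsq (\<lambda>z. w z * dyadic_avg j u z - w z * u z) \<le> ennreal (e / 10)"
        using approx[OF u] by (subst nsq_diff_commute)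
      have 3: "nsq (\<lambda>z. w z * dyadic_avg j (U n) z - w z * u z) \<le> ennreal (4 * e / 10)"
        by (rule nsq_triangle_le[OF _ _ _ 1 2]) (use e in \<open>measurable, simp_all\<close>)
      have "nsq (\<lambda>z. w z * U n z - w z * u z) \<le> ennreal e"
        by (rule nsq_triangle_le[OF _ _ _ approx[OF U(1)[of n] U(2)[of n]] 3]) (use e in \<open>measurable, simp_all\<close>)
      then show ?thesis by (simp add: right_diff_distrib)
    qed
    then show "\<exists>M. \<forall>n\<ge>M. nsq (\<lambda>z. w z * (U n z - u z)) \<le> ennreal e" by blast
  qed
  moreover have "sqint (\<lambda>z. w z * (U n z - u z))" for n
    using wle[of "\<lambda>z. U n z - u z"] sqint_diff[OF us(2)[of n] us(1)] by (auto simp: sqint_def intro: le_less_trans)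
  ultimately obtain r where r: "strict_mono (r :: nat \<Rightarrow> nat)" "AE z in lborel. (\<lambda>n. w z * (U (r n) z - u z)) \<longlonglongrightarrow> 0"
    using nsq_tendsto_0_AE_subseq[of "\<lambda>n z. w z * (U n z - u z)"] by blast
  have "AE z in lborel. (\<lambda>n. U (r n) z) \<longlonglongrightarrow> u z"
    using r(2)
  proof eventually_elim
    case (elim z)
    have "(\<lambda>n. w z * (U (r n) z - u z) / w z) \<longlonglongrightarrow> 0 / w z" by (intro tendsto_intros elim w)
    then show ?case using w(1)[of z] by (simp add: LIM_zero_iff)
  qed
  then show ?thesis using r(1) by blast
qed

text \<open>The functional \<open>f \<mapsto> A (f + u) - A f\<close> is affine, being \<open>A
  u\<close> plus twice the inner product with \<open>u\<close>; so a strict bound on the tail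
  passes to its combinations.\<close>

lemma midpoint_hull_polar_less:
  assumes "f \<in> midpoint_hull U n" and U: "\<And>k. U k \<in> X" and u: "u \<in> X"
    and c: "\<And>k. k \<ge> n \<Longrightarrow> A (\<lambda>z. U k z + u z) - A (U k) < c"
  shows "A (\<lambda>z. f z + u z) - A f < c"
  using assms(1)
proof (induction rule: midpoint_hull.induct)
  case (base k) then show ?case by (rule c)
next
  case (mid f g)
  have fg: "f \<in> X" "g \<in> X" using midpoint_hull_X[OF mid.hyps(1) U] midpoint_hull_X[OF mid.hyps(2) U] by auto
  have "A (\<lambda>z. ((f z + u z) + (g z + u z)) / 2) = A (\<lambda>z. f z + u z) / 2 + A (\<lambda>z. g z + u z) / 2 - A (\<lambda>z. (f z + u z) - (g z + u z)) / 4"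
    by (rule A_mid[OF X_add[OF fg(1) u] X_add[OF fg(2) u]])
  moreover have "(\<lambda>z. ((f z + u z) + (g z + u z)) / 2) = (\<lambda>z. (f z + g z) / 2 + u z)" by (simp add: field_simps)
  moreover have "(\<lambda>z. (f z + u z) - (g z + u z)) = (\<lambda>z. f z - g z)" by simp
  ultimately show ?case using A_mid[OF fg] mid.IH by simp
qed

text \<open>For a weak limit one would have \<open>A (U k - u) = A (U k) - A u + o(1)\<close>.
  Here the inequality is obtained for infinitely many \<open>k\<close>: if the affine functional
  of \<open>midpoint_hull_polar_less\<close> were smaller at every \<open>U k\<close> of a tail
  than at the combination \<open>V m\<close> of that tail, it would be smaller at \<open>V
  m\<close> itself. At \<open>V m\<close> its value is close to \<open>3 A u\<close>.\<close>

lemma A_gap: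
  assumes U: "\<And>n. U n \<in> X" "\<And>n. A (U n) \<le> 1" and V: "\<And>n. V n \<in> midpoint_hull U n"
    and u: "u \<in> X" and lim: "(\<lambda>n. A (\<lambda>z. V n z - u z)) \<longlonglongrightarrow> 0" and e: "e > 0"
  shows "\<exists>k\<ge>n. A (\<lambda>z. U k z - u z) \<le> 1 - A u + e"
proof -
  have VX: "V n \<in> X" "A (V n) \<le> 1" for n using midpoint_hull_X[OF V U(1)] midpoint_hull_A_le[OF V U] by auto
  obtain M where M: "\<And>n. n \<ge> M \<Longrightarrow> A u - e / 2 \<le> A (V n)" using A_limit(2)[OF VX u lim, of "e/2"] e by auto
  have "eventually (\<lambda>n. A (\<lambda>z. V n z - u z) < e / 2) sequentially" using e by (intro order_tendstoD(2)[OF lim]) auto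
  then obtain M' where M': "\<And>n. n \<ge> M' \<Longrightarrow> A (\<lambda>z. V n z - u z) < e / 2" by (auto simp: eventually_sequentially)
  define m where "m = max n (max M M')"
  define c where "c = A (\<lambda>z. V m z + u z) - A (V m)"
  have "\<exists>k\<ge>m. c \<le> A (\<lambda>z. U k z + u z) - A (U k)"
  proof (rule ccontr)
    assume "\<not> ?thesis"
    then have "A (\<lambda>z. U k z + u z) - A (U k) < c" if "k \<ge> m" for k using that by (meson not_le)
    from midpoint_hull_polar_less[OF V[of m] U(1) u this] show False by (simp add: c_def)
  qed
  then obtain k where k: "k \<ge> m" "c \<le> A (\<lambda>z. U k z + u z) - A (U k)" by blast
  have "c = A (V m) + 2 * A u - A (\<lambda>z. V m z - u z)"
    unfolding c_def using A_parallelogram[OF VX(1)[of m] u] by linarith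
  moreover have "M \<le> m" "M' \<le> m" by (auto simp: m_def)
  ultimately have "c \<ge> 3 * A u - e" using M[of m] M'[of m] by linarith
  then have "A (\<lambda>z. U k z - u z) \<le> 1 - A u + e"
    using A_parallelogram[OF U(1)[of k] u] U(2)[of k] k(2) by linarith
  then show ?thesis using k(1) by (intro exI[of _ k]) (auto simp: m_def)
qed

text \<open>The upper half of the Brezis-Lieb lemma. By \<open>powr_add_le_weighted\<close> the
  excess of \<open>\<bar>U n\<bar>\<close> to the power \<open>q\<close> over the two other terms
  is dominated by a multiple of \<open>\<bar>u\<bar>\<close> to the power \<open>q\<close>, and
  it tends to 0 almost everywhere, so its integral tends to 0.\<close>

lemma brezis_lieb_upper:
  assumes U: "\<And>n. U n \<in> X" and u: "u \<in> X" and lim: "AE z in lborel. (\<lambda>n. U n z) \<longlonglongrightarrow> u z" and t: "0 < t" "t < 1"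
  shows "\<exists>\<epsilon>. \<epsilon> \<longlonglongrightarrow> 0 \<and> (\<forall>n. N (U n) \<le> (1 - t) powr (1 - q) * N (\<lambda>z. U n z - u z) + N u + \<epsilon> n)"
proof -
  have um [measurable]: "u \<in> borel_measurable borel" "\<And>n. U n \<in> borel_measurable borel"
    using X_sqint[OF u] X_sqint[OF U] by (auto simp: sqint_def)
  define a where "a = (1 - t) powr (1 - q)"
  define b where "b = t powr (1 - q)"
  \<comment> \<open>The positive part of the excess, since only an upper bound is claimed.\<close>
  define W where "W n z = max 0 (cmod (U n z) powr q - a * cmod (U n z - u z) powr q - cmod (u z) powr q)" for n z
  have Wm [measurable]: "W n \<in> borel_measurable borel" for n unfolding W_def by measurable
  have iu: "integrable lborel (\<lambda>z. cmod (u z) powr q)" by (rule X_powr_integrable[OF u])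
  have Wb: "\<bar>W n z\<bar> \<le> b * cmod (u z) powr q" for n z
  proof -
    have "cmod (U n z) powr q \<le> (cmod (U n z - u z) + cmod (u z)) powr q"
      using q norm_triangle_ineq[of "U n z - u z" "u z"] by (intro powr_mono2) auto
    also have "\<dots> \<le> a * cmod (U n z - u z) powr q + b * cmod (u z) powr q"
      unfolding a_def b_def using q t by (intro powr_add_le_weighted) auto
    finally have "cmod (U n z) powr q - a * cmod (U n z - u z) powr q - cmod (u z) powr q \<le> b * cmod (u z) powr q"
      by (smt (verit) powr_ge_zero)
    then show ?thesis by (simp add: W_def b_def)
  qed
  have Wi: "integrable lborel (W n)" for n
  proof (rule Bochner_Integration.integrable_bound[OF integrable_mult_right[OF iu, of b]])
    show "AE z in lborel. norm (W n z) \<le> norm (b * cmod (u z) powr q)"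
      unfolding real_norm_def by (intro AE_I2 order_trans[OF Wb abs_ge_self])
  qed measurable
  have "(\<lambda>n. LINT z|lborel. W n z) \<longlonglongrightarrow> (LINT z|(lborel :: (real \<times> real) measure). 0)"
  proof (rule integral_dominated_convergence[where w="\<lambda>z. b * cmod (u z) powr q"])
    show "AE z in lborel. (\<lambda>n. W n z) \<longlonglongrightarrow> 0"
      using lim
    proof eventually_elim
      case (elim z)
      have "(\<lambda>n. cmod (U n z - u z)) \<longlonglongrightarrow> 0" using elim by (simp add: LIM_zero tendsto_norm_zero)
      then have 1: "(\<lambda>n. cmod (U n z - u z) powr q) \<longlonglongrightarrow> 0 powr q"
        using q by (intro tendsto_powr2) auto
      have 2: "(\<lambda>n. cmod (U n z) powr q) \<longlonglongrightarrow> cmod (u z) powr q"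
        using q elim by (intro tendsto_powr2 tendsto_norm) auto
      have "(\<lambda>n. W n z) \<longlonglongrightarrow> max 0 (cmod (u z) powr q - a * (0 powr q) - cmod (u z) powr q)"
        unfolding W_def by (intro tendsto_intros 1 2)
      then show ?case by simp
    qed
    show "integrable lborel (\<lambda>z. b * cmod (u z) powr q)" using iu by simp
    show "AE z in lborel. norm (W n z) \<le> b * cmod (u z) powr q" for n using Wb by simp
  qed measurable
  then have "(\<lambda>n. LINT z|lborel. W n z) \<longlonglongrightarrow> 0" by simp
  moreover have "N (U n) \<le> a * N (\<lambda>z. U n z - u z) + N u + (LINT z|lborel. W n z)" for n
  proof -
    have id: "integrable lborel (\<lambda>z. cmod (U n z - u z) powr q)" by (rule X_powr_integrable[OF X_diff[OF U u]])
    have "N (U n) \<le> (LINT z|lborel. a * cmod (U n z - u z) powr q + cmod (u z) powr q + W n z)"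
      unfolding N_def using id iu Wi X_powr_integrable[OF U] by (intro integral_mono) (auto simp: W_def)
    also have "\<dots> = a * N (\<lambda>z. U n z - u z) + N u + (LINT z|lborel. W n z)"
      unfolding N_def using id iu Wi by simp
    finally show ?thesis .
  qed
  ultimately show ?thesis unfolding a_def by blast
qed

lemma powr_superadditive_strict:
  fixes a r :: real
  assumes "0 < a" "a < 1" "r > 1"
  shows "a powr r + (1 - a) powr r < 1"
proof -
  have "a powr r < a powr 1" using assms by (intro powr_less_mono') auto
  moreover have "(1 - a) powr r < (1 - a) powr 1" using assms by (intro powr_less_mono') auto
  ultimately show ?thesis using assms by simp
qed

text \<open>The limit is nonzero because its average at the origin is at least
  \<open>\<delta>\<close>. Splitting off \<open>u\<close> gives \<open>S \<le> S (1 - A u) powr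
  (q/2) + N u\<close>, and strict superadditivity of \<open>x powr (q/2)\<close> excludes
  \<open>A u < 1\<close>: it does not pay to split the available energy.\<close>

lemma maximizing_sequence_limit:
  assumes U: "\<And>n. U n \<in> X" "\<And>n. A (U n) \<le> 1" "\<And>n. S - 1 / real (Suc n) \<le> N (U n)"
    and d: "\<delta> > 0" "\<And>n. cmod (dyadic_avg k (U n) 0) \<ge> \<delta>"
  shows "\<exists>u\<in>X. A u \<le> 1 \<and> nonzero u \<and> S \<le> N u"
proof -
  obtain r0 where r0: "strict_mono (r0 :: nat \<Rightarrow> nat)" "\<And>k z. convergent (\<lambda>n. dyadic_avg k (U (r0 n)) z)"
    using dyadic_avg_convergent_subsequence[of U, OF U(1) U(2)] by blast
  define U1 where "U1 n = U (r0 n)" for n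
  have U1: "U1 n \<in> X" "A (U1 n) \<le> 1" for n using U by (auto simp: U1_def)
  obtain V u where V: "\<And>n. V n \<in> midpoint_hull U1 n" and u: "u \<in> X" and Vu: "(\<lambda>n. A (\<lambda>z. V n z - u z)) \<longlonglongrightarrow> 0"
    using convex_combinations_converge[of U1, OF U1] by blast
  have VX: "V n \<in> X" "A (V n) \<le> 1" for n using midpoint_hull_X[OF V U1(1)] midpoint_hull_A_le[of _ U1, OF V U1] by auto
  have Au: "A u \<le> 1" by (rule A_limit(1)[OF VX u Vu])
  have dl: "(\<lambda>n. dyadic_avg j (U1 n) z) \<longlonglongrightarrow> dyadic_avg j u z" for j z
    by (rule dyadic_avg_limit[OF U1(1) _ V u Vu]) (use r0(2) in \<open>simp add: U1_def\<close>)
  have nz: "nonzero u"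
    unfolding nonzero_def
  proof
    assume z: "AE z in lborel. u z = 0"
    have "nsq u = 0" using z X_sqint[OF u] by (simp add: nsq_eq_0_iff sqint_def)
    then have "cmod (dyadic_avg k u 0) \<le> sqrt (0 / ((1/2)^k * (1/4)^k))"
      unfolding dyadic_avg_def by (intro cell_avg_bound X_sqint[OF u]) auto
    then have "dyadic_avg k u 0 = 0" by simp
    moreover have "\<delta> \<le> cmod (dyadic_avg k u 0)"
      by (rule LIMSEQ_le_const[OF tendsto_norm[OF dl]]) (use d(2) in \<open>auto simp: U1_def\<close>)
    ultimately show False using d(1) by simp
  qed
  have a: "0 < A u" by (rule A_pos[OF u nz])
  \<comment> \<open>\<open>A_gap\<close> supplies suitable indices arbitrarily far out; choose
    them increasing.\<close>
  have "\<exists>s. \<forall>n. A (\<lambda>z. U1 (s n) z - u z) \<le> 1 - A u + 1 / real (Suc n) \<and> s n < s (Suc n)"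
  proof (intro dependent_nat_choice)
    show "\<exists>k. A (\<lambda>z. U1 k z - u z) \<le> 1 - A u + 1 / real (Suc 0)"
      using A_gap[of U1 V u, OF U1 V u Vu, of 1 0] by auto
    fix m n
    show "\<exists>k. A (\<lambda>z. U1 k z - u z) \<le> 1 - A u + 1 / real (Suc (Suc n)) \<and> m < k"
      using A_gap[of U1 V u, OF U1 V u Vu, of "1 / real (Suc (Suc n))" "Suc m"] by (auto simp: Suc_le_eq simp del: of_nat_Suc)
  qed
  then obtain s where s: "strict_mono (s :: nat \<Rightarrow> nat)" "\<And>n. A (\<lambda>z. U1 (s n) z - u z) \<le> 1 - A u + 1 / real (Suc n)"
    by (auto simp: strict_mono_Suc_iff)
  have "(\<lambda>n. dyadic_avg j (U1 (s n)) z) \<longlonglongrightarrow> dyadic_avg j u z" for j z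
    using LIMSEQ_subseq_LIMSEQ[OF dl s(1)] by (simp add: o_def)
  then obtain r where r: "strict_mono (r :: nat \<Rightarrow> nat)" "AE z in lborel. (\<lambda>n. U1 (s (r n)) z) \<longlonglongrightarrow> u z"
    using AE_convergent_subsequence[of "\<lambda>n. U1 (s n)" u] U1 u Au by blast
  define W where "W n = U1 (s (r n))" for n
  have WX: "W n \<in> X" for n using U1 by (simp add: W_def)
  have inv: "1 / real (Suc (r n)) \<le> 1 / real (Suc n)" for n
    using seq_suble[OF r(1), of n] by (intro divide_left_mono) auto
  have WA: "A (\<lambda>z. W n z - u z) \<le> 1 - A u + 1 / real (Suc n)" for n
    using s(2)[of "r n"] inv[of n] unfolding W_def by linarith
  have WN: "S - 1 / real (Suc n) \<le> N (W n)" for n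
  proof -
    have "n \<le> r0 (s (r n))"
      using seq_suble[OF r(1), of n] seq_suble[OF s(1), of "r n"] seq_suble[OF r0(1), of "s (r n)"] by linarith
    then have "1 / real (Suc (r0 (s (r n)))) \<le> 1 / real (Suc n)" by (intro divide_left_mono) auto
    then show ?thesis using U(3)[of "r0 (s (r n))"] by (simp add: W_def U1_def)
  qed
  have WNle: "N (\<lambda>z. W n z - u z) \<le> S * (1 - A u + 1 / real (Suc n)) powr (q / 2)" for n
  proof -
    have "A (\<lambda>z. W n z - u z) powr (q / 2) \<le> (1 - A u + 1 / real (Suc n)) powr (q / 2)"
      using q WA[of n] A_nonneg[OF X_diff[OF WX u]] by (intro powr_mono2) auto
    then have "S * A (\<lambda>z. W n z - u z) powr (q / 2) \<le> S * (1 - A u + 1 / real (Suc n)) powr (q / 2)"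
      using S_pos by (intro mult_left_mono) auto
    then show ?thesis using N_le[OF X_diff[OF WX u], of n] by linarith
  qed
  have inv0: "(\<lambda>n. 1 / real (Suc n)) \<longlonglongrightarrow> 0" using LIMSEQ_inverse_real_of_nat by (simp add: inverse_eq_divide)
  have key: "S \<le> (1 - t) powr (1 - q) * (S * (1 - A u) powr (q / 2)) + N u" if t: "0 < t" "t < 1" for t
  proof -
    obtain \<epsilon> where \<epsilon>: "\<epsilon> \<longlonglongrightarrow> 0" "\<And>n. N (W n) \<le> (1 - t) powr (1 - q) * N (\<lambda>z. W n z - u z) + N u + \<epsilon> n"
      using brezis_lieb_upper[of W u t, OF WX u _ t] r(2) unfolding W_def by blast
    have le: "S - 1 / real (Suc n) \<le> (1 - t) powr (1 - q) * (S * (1 - A u + 1 / real (Suc n)) powr (q / 2)) + N u + \<epsilon> n" for n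
      using WN[of n] \<epsilon>(2)[of n] mult_left_mono[OF WNle[of n], of "(1 - t) powr (1 - q)"] by (smt (verit) powr_ge_zero)
    have "(\<lambda>n. S - 1 / real (Suc n)) \<longlonglongrightarrow> S - 0" by (intro tendsto_intros inv0)
    moreover have "(\<lambda>n. (1 - t) powr (1 - q) * (S * (1 - A u + 1 / real (Suc n)) powr (q / 2)) + N u + \<epsilon> n)
      \<longlonglongrightarrow> (1 - t) powr (1 - q) * (S * (1 - A u + 0) powr (q / 2)) + N u + 0"
      using q Au by (intro tendsto_intros inv0 \<epsilon>(1) tendsto_powr2) (auto intro!: always_eventually)
    ultimately show ?thesis using LIMSEQ_le[OF _ _ exI[of _ 0]] le by fastforce
  qed
  \<comment> \<open>Let \<open>t\<close> tend to 0 in \<open>key\<close>.\<close>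
  have key0: "S \<le> S * (1 - A u) powr (q / 2) + N u"
  proof -
    have "((\<lambda>t. (1 - t) powr (1 - q) * (S * (1 - A u) powr (q / 2)) + N u) \<longlongrightarrow> (1 - 0) powr (1 - q) * (S * (1 - A u) powr (q / 2)) + N u) (at_right 0)"
      by (intro tendsto_intros) auto
    moreover have "eventually (\<lambda>t. S \<le> (1 - t) powr (1 - q) * (S * (1 - A u) powr (q / 2)) + N u) (at_right 0)"
      using eventually_at_right_less[of 0] eventually_at_right_real[of 0 1] by (auto elim!: eventually_elim2 intro: key)
    ultimately have "S \<le> (1 - 0) powr (1 - q) * (S * (1 - A u) powr (q / 2)) + N u"
      by (intro tendsto_lowerbound) auto
    then show ?thesis by simp
  qed
  have "A u = 1"
  proof (rule ccontr)
    assume "A u \<noteq> 1"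
    then have "A u powr (q / 2) + (1 - A u) powr (q / 2) < 1" using a Au q by (intro powr_superadditive_strict) auto
    then have "S * (A u powr (q / 2) + (1 - A u) powr (q / 2)) < S * 1" using S_pos by (intro mult_strict_left_mono)
    then show False using key0 N_le[OF u] by (simp add: distrib_left)
  qed
  then have "S \<le> N u" using key0 q by simp
  then show ?thesis using u Au nz by blast
qed

text \<open>Members of a maximizing sequence with \<open>N u > S/2\<close> have an average above
  \<open>\<delta>\<close> somewhere, at one common scale; translating that point to the origin
  changes neither \<open>A\<close> nor \<open>N\<close>.\<close>

lemma maximizer: "\<exists>u\<in>X. nonzero u \<and> A u \<le> 1 \<and> S \<le> N u"
proof -
  obtain k \<delta> where kd: "\<delta> > 0" "\<And>u. u \<in> X \<Longrightarrow> A u \<le> 1 \<Longrightarrow> N u > S / 2 \<Longrightarrow> \<exists>z. cmod (dyadic_avg k u z) > \<delta>"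
    using nonvanishing[OF half_gt_zero[OF S_pos]] by blast
  have "\<exists>u. u \<in> X \<and> A u \<le> 1 \<and> S - 1 / real (Suc n) \<le> N u \<and> cmod (dyadic_avg k u 0) \<ge> \<delta>" for n
  proof -
    \<comment> \<open>The bound \<open>S/2\<close> makes \<open>nonvanishing\<close> applicable
      to every member of the sequence.\<close>
    define y where "y = max (S / 2) (S - 1 / real (Suc n))"
    have "y < S" using S_pos by (simp add: y_def)
    then have "\<exists>x\<in>{N u | u. u \<in> X \<and> A u \<le> 1}. y < x"
      unfolding S_def by (intro less_cSupD) (use S_pos X_nontrivial normalize in auto)
    then obtain u where u: "u \<in> X" "A u \<le> 1" "y < N u" by blast
    then obtain z where z: "cmod (dyadic_avg k u z) > \<delta>" using kd(2)[of u] by (auto simp: y_def)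
    have "dyadic_avg k (\<lambda>x. u (x + z)) 0 = dyadic_avg k u z" unfolding dyadic_avg_def cell_avg_translate by simp
    then show ?thesis using u z X_translate[OF u(1), of z] A_translate[OF u(1), of z] N_translate[OF u(1), of z]
      by (intro exI[of _ "\<lambda>x. u (x + z)"]) (auto simp: y_def)
  qed
  then obtain U where "\<And>n. U n \<in> X" "\<And>n. A (U n) \<le> 1" "\<And>n. S - 1 / real (Suc n) \<le> N (U n)" "\<And>n. cmod (dyadic_avg k (U n) 0) \<ge> \<delta>"
    by metis
  from maximizing_sequence_limit[OF this(1-3) kd(1) this(4)] show ?thesis by blast
qed

section \<open>The ground state\<close>

lemma action_eq: "action \<omega> v p u = A u / 2 - N u / q"
  by (simp add: action_def A_def N_def q_def)

lemma nehari_eq: "nehari \<omega> v p u = A u - N u"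
  by (simp add: nehari_def A_def N_def q_def)

text \<open>The last condition says that \<open>Q\<close> is extremal in the embedding inequality
  \<open>N \<le> C \<cdot> A powr (q/2)\<close>: its constant \<open>A Q powr (1 - q/2)\<close>
  is the one for which \<open>N Q = A Q\<close> is the case of equality.\<close>

definition ground_state :: "(real \<times> real \<Rightarrow> complex) \<Rightarrow> bool" where
  "ground_state Q \<longleftrightarrow> Q \<in> X \<and> nonzero Q \<and> A Q > 0 \<and> N Q = A Q \<and> (\<forall>u\<in>X. N u \<le> A Q powr (1 - q / 2) * A u powr (q / 2))"

text \<open>A maximizer has \<open>A u = 1\<close>, since otherwise scaling it up would exceed
  \<open>S\<close>. Multiplication by \<open>c\<close> turns \<open>A u = 1\<close> and \<open>N
  u = S\<close> into \<open>c\<^sup>2\<close> and \<open>c powr q \<cdot> S\<close>, which are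
  equal for \<open>c powr (q - 2) = 1/S\<close>.\<close>

lemma ground_state_exists: "\<exists>Q. ground_state Q"
proof -
  obtain u where u: "u \<in> X" "nonzero u" "A u \<le> 1" "S \<le> N u" using maximizer by blast
  have a: "A u > 0" by (rule A_pos[OF u(1,2)])
  have Au: "A u = 1"
  proof (rule ccontr)
    assume "A u \<noteq> 1"
    then have "A u powr (q / 2) < A u powr 0" using a u(3) q by (intro powr_less_mono') auto
    then have "S * A u powr (q / 2) < S * 1" using S_pos a by (intro mult_strict_left_mono) auto
    then show False using N_le[OF u(1)] u(4) by linarith
  qed
  have Nu: "N u = S" using N_le_S[OF u(1,3)] u(4) by linarith
  define c where "c = S powr (- 1 / (q - 2))"
  have c: "c > 0" using S_pos by (simp add: c_def)
  define Q where "Q z = of_real c * u z" for z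
  have Q: "Q \<in> X" unfolding Q_def[abs_def] by (rule X_cmult[OF u(1)])
  have AQ: "A Q = c\<^sup>2" unfolding Q_def[abs_def] using A_cmult[OF u(1), of "of_real c"] Au by simp
  have cq: "c powr (q - 2) = 1 / S"
  proof -
    have "- 1 / (q - 2) * (q - 2) = - 1" using q by simp
    then show ?thesis unfolding c_def powr_powr using S_pos by (simp add: powr_neg_one)
  qed
  have "N Q = c powr q * S" unfolding Q_def[abs_def] using c by (simp add: N_cmult Nu)
  also have "c powr q = c powr (q - 2) * c\<^sup>2" using c by (intro powr_split_square) simp
  finally have NQ: "N Q = A Q" using cq S_pos AQ by simp
  have "A Q powr (1 - q / 2) = c powr (2 * (1 - q / 2))" unfolding AQ using c by (simp add: powr_powr flip: powr_numeral)
  also have "\<dots> = c powr (- (q - 2))" by (simp add: algebra_simps)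
  also have "\<dots> = S" using cq S_pos by (simp only: powr_minus) simp
  finally have SQ: "A Q powr (1 - q / 2) = S" .
  have "nonzero Q" using u(2) c unfolding nonzero_def Q_def by simp
  then have "ground_state Q" unfolding ground_state_def SQ using Q NQ N_le A_pos[OF Q] by auto
  then show ?thesis by blast
qed

text \<open>If \<open>N u = A u\<close>, extremality of \<open>Q\<close> gives \<open>A Q \<le> A
  u\<close>, and on the Nehari set the action is \<open>(1/2 - 1/q) A\<close>.\<close>

lemma ground_state_min_action:
  assumes g: "ground_state Q"
  shows "action \<omega> v p Q = min_action \<omega> v p"
proof -
  have Q: "Q \<in> X" "nonzero Q" "A Q > 0" "N Q = A Q" and le: "\<And>u. u \<in> X \<Longrightarrow> N u \<le> A Q powr (1 - q / 2) * A u powr (q / 2)"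
    using g by (auto simp: ground_state_def)
  have "action \<omega> v p Q \<le> action \<omega> v p u" if u: "u \<in> X" "nonzero u" "nehari \<omega> v p u = 0" for u
  proof -
    have a: "A u > 0" by (rule A_pos[OF u(1,2)])
    have N: "N u = A u" using u(3) by (simp add: nehari_eq)
    have "A Q \<le> A u"
    proof (rule ccontr)
      assume "\<not> A Q \<le> A u"
      then have "A u powr (q / 2 - 1) < A Q powr (q / 2 - 1)" using a q by (intro powr_less_mono2) auto
      then have "A Q powr (1 - q / 2) * A u powr (q / 2 - 1) < A Q powr (1 - q / 2) * A Q powr (q / 2 - 1)"
        using Q(3) by (intro mult_strict_left_mono) auto
      also have "\<dots> = 1" using Q(3) by (simp flip: powr_add)
      finally have "A Q powr (1 - q / 2) * A u powr (q / 2 - 1) * A u < 1 * A u" using a by (intro mult_strict_right_mono)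
      moreover have "A u powr (q / 2) = A u powr (q / 2 - 1) * A u" using a by (simp add: powr_diff)
      ultimately show False using le[OF u(1)] N by (simp add: mult.assoc)
    qed
    then have "(1 / 2 - 1 / q) * A Q \<le> (1 / 2 - 1 / q) * A u" using q by (intro mult_left_mono) (auto simp: field_simps)
    then show ?thesis unfolding action_eq N Q(4) by (simp add: algebra_simps)
  qed
  moreover have "action \<omega> v p Q \<in> {action \<omega> v p u |u. u \<in> X \<and> nonzero u \<and> nehari \<omega> v p u = 0}"
    using Q by (auto simp: nehari_eq)
  ultimately show ?thesis unfolding min_action_def by (intro cInf_eq_minimum[symmetric]) auto
qed

text \<open>The form is Lipschitz near \<open>Q\<close>. The two-sided bound comes from the
  one-sided \<open>A_add_le\<close> with parameter \<open>t = n\<close>, applied from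
  \<open>Q\<close> to \<open>Q + h\<close> and back.\<close>

lemma A_perturbation:
  assumes Q: "Q \<in> X" and h: "h \<in> X" and c: "A h \<le> c * n\<^sup>2" and n: "0 \<le> n" "n \<le> 1" and c0: "c \<ge> 0"
  shows "\<bar>A (\<lambda>z. Q z + h z) - A Q\<bar> \<le> (2 * A Q + 4 * c) * n"
proof -
  have up: "A (\<lambda>z. f z + g z) \<le> A f + (A f + 2 * c) * n" if f: "f \<in> X" and g: "g \<in> X" "A g \<le> c * n\<^sup>2" for f g
  proof (cases "n = 0")
    \<comment> \<open>For \<open>n = 0\<close> the choice \<open>t = n\<close> is not available;
      \<open>A g = 0\<close> then allows arbitrarily small \<open>t\<close>.\<close>
    case True
    have "A g = 0" using g(2) A_nonneg[OF g(1)] True by simp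
    have "A (\<lambda>z. f z + g z) \<le> A f"
    proof (rule field_le_epsilon)
      fix e :: real assume e: "e > 0"
      define t where "t = e / (1 + A f)"
      have "1 + A f > 0" using A_nonneg[OF f] by simp
      then have t: "t > 0" "t * A f \<le> e" using e A_nonneg[OF f] by (auto simp: t_def divide_le_eq distrib_left mult_left_mono)
      show "A (\<lambda>z. f z + g z) \<le> A f + e" using A_add_le[OF f g(1) t(1)] t(2) \<open>A g = 0\<close> by (simp add: distrib_right)
    qed
    then show ?thesis using True by simp
  next
    case False
    then have n0: "n > 0" using n by simp
    have "(1 + 1/n) * A g \<le> (1 + 1/n) * (c * n\<^sup>2)" using g(2) n0 by (intro mult_left_mono) auto
    also have "\<dots> = c * n\<^sup>2 + c * n" using n0 by (simp add: field_simps power2_eq_square)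
    also have "c * n\<^sup>2 \<le> c * n" using n c0 by (intro mult_left_mono) (auto simp: power2_eq_square mult_left_le)
    finally show ?thesis using A_add_le[OF f g(1) n0] by (simp add: algebra_simps)
  qed
  have X': "(\<lambda>z. Q z + h z) \<in> X" "(\<lambda>z. - h z) \<in> X" using X_add[OF Q h] X_cmult[OF h, of "-1"] by auto
  have "A (\<lambda>z. - h z) \<le> c * n\<^sup>2" using A_cmult[OF h, of "-1"] c by simp
  then have 2: "A Q \<le> A (\<lambda>z. Q z + h z) + (A (\<lambda>z. Q z + h z) + 2 * c) * n" using up[OF X'] by simp
  have 1: "A (\<lambda>z. Q z + h z) \<le> A Q + (A Q + 2 * c) * n" by (rule up[OF Q h c])
  also have "(A Q + 2 * c) * n \<le> (A Q + 2 * c) * 1" using n c0 A_nonneg[OF Q] by (intro mult_left_mono) auto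
  finally have "A (\<lambda>z. Q z + h z) + 2 * c \<le> 2 * A Q + 4 * c" by simp
  then have "(A (\<lambda>z. Q z + h z) + 2 * c) * n \<le> (2 * A Q + 4 * c) * n" using n by (intro mult_right_mono)
  moreover have "(A Q + 2 * c) * n \<le> (2 * A Q + 4 * c) * n" using n c0 A_nonneg[OF Q] by (intro mult_right_mono) auto
  ultimately show ?thesis using 1 2 by linarith
qed

lemma N_midpoint_convex:
  assumes Q: "Q \<in> X" and h: "h \<in> X"
  shows "2 * N Q \<le> N (\<lambda>z. Q z + h z) + N (\<lambda>z. Q z - h z)"
proof -
  note i = X_powr_integrable[OF Q] X_powr_integrable[OF X_add[OF Q h]] X_powr_integrable[OF X_diff[OF Q h]]
  have pt: "2 * cmod (Q z) powr q \<le> cmod (Q z + h z) powr q + cmod (Q z - h z) powr q" for z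
  proof -
    let ?x = "cmod (Q z + h z)" and ?y = "cmod (Q z - h z)"
    have "2 * cmod (Q z) = cmod ((Q z + h z) + (Q z - h z))" by (simp flip: norm_mult_numeral1)
    also have "\<dots> \<le> ?x + ?y" by (rule norm_triangle_ineq)
    finally have "(2 * cmod (Q z)) powr q \<le> (?x + ?y) powr q" using q by (intro powr_mono2) auto
    also have "\<dots> \<le> (1 - 1/2) powr (1 - q) * ?x powr q + (1/2) powr (1 - q) * ?y powr q"
      using q by (intro powr_add_le_weighted) auto
    also have "\<dots> = 2 powr (q - 1) * (?x powr q + ?y powr q)"
      by (simp add: powr_divide powr_diff distrib_left)
    finally have "2 powr (q - 1) * (2 * cmod (Q z) powr q) \<le> 2 powr (q - 1) * (?x powr q + ?y powr q)"
      by (simp add: powr_mult powr_diff)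
    then show ?thesis by simp
  qed
  have "(LINT z|lborel. 2 * cmod (Q z) powr q) \<le> (LINT z|lborel. cmod (Q z + h z) powr q + cmod (Q z - h z) powr q)"
    using i pt by (intro integral_mono) auto
  then show ?thesis unfolding N_def using i by simp
qed

text \<open>The action lies above \<open>f \<circ> A\<close>, touches it at \<open>Q\<close>, and
  \<open>f\<close> is stationary at \<open>A Q\<close>; this gives the lower bound at \<open>Q +
  h\<close> and \<open>Q - h\<close>. The second difference of the action is at most \<open>A
  h\<close>, because \<open>N\<close> is convex; with the lower bound at \<open>Q - h\<close>
  this gives the upper bound at \<open>Q + h\<close>.\<close>

lemma ground_state_is_solution:
  assumes g: "ground_state Q"
  shows "is_solution \<omega> v p Q"
proof -
  have Q: "Q \<in> X" "A Q > 0" "N Q = A Q" and le: "\<And>u. u \<in> X \<Longrightarrow> N u \<le> A Q powr (1 - q / 2) * A u powr (q / 2)"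
    using g by (auto simp: ground_state_def)
  define a where "a = A Q"
  have a: "a > 0" using Q by (simp add: a_def)
  define K where "K = a powr (1 - q / 2)"
  define f where "f s = s / 2 - K / q * s powr (q / 2)" for s
  \<comment> \<open>The constant of \<open>quad_form_le_norm_X\<close>; \<open>L\<close> is the
    resulting Lipschitz constant of \<open>A\<close> at \<open>Q\<close>.\<close>
  define c where "c = 2 + \<omega>"
  have c: "c > 0" using \<omega> by (simp add: c_def)
  define L where "L = 2 * a + 4 * c"
  have L: "L > 0" using a c by (simp add: L_def)
  have fa: "f a = action \<omega> v p Q"
    unfolding f_def K_def action_eq Q(3) a_def[symmetric] using a by (simp flip: powr_add)
  have fle: "f (A u) \<le> action \<omega> v p u" if "u \<in> X" for u
    using divide_right_mono[OF le[OF that], of q] q unfolding f_def K_def action_eq a_def by simp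
  have "(f has_real_derivative 1 / 2 - K / q * (q / 2 * a powr (q / 2 - 1))) (at a)"
    unfolding f_def[abs_def] using a by (auto intro!: derivative_eq_intros)
  also have "1 / 2 - K / q * (q / 2 * a powr (q / 2 - 1)) = 0"
    using a q by (simp add: K_def flip: powr_add)
  finally have "(f has_derivative (\<lambda>x. 0)) (at a)" by (simp add: has_field_derivative_def lambda_zero)
  then have df: "\<exists>d>0. \<forall>s. \<bar>s - a\<bar> < d \<longrightarrow> \<bar>f s - f a\<bar> \<le> e * \<bar>s - a\<bar>" if "e > 0" for e
    using that by (simp add: has_derivative_at_alt)
  show ?thesis
    unfolding is_solution_def
  proof (intro conjI allI impI)
    show "Q \<in> X" by (rule Q)
    fix \<epsilon> :: real assume e: "\<epsilon> > 0"
    define e' where "e' = \<epsilon> / (2 * L)"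
    have e': "e' > 0" "e' * L = \<epsilon> / 2" using e L by (auto simp: e'_def)
    obtain d where d: "d > 0" "\<And>s. \<bar>s - a\<bar> < d \<Longrightarrow> \<bar>f s - f a\<bar> \<le> e' * \<bar>s - a\<bar>" using df[OF e'(1)] by blast
    \<comment> \<open>Respectively: \<open>A\<close> is Lipschitz on the unit ball, \<open>A (Q +
      h)\<close> stays where \<open>f\<close> is flat, and \<open>A h\<close> is at most
      \<open>\<epsilon>/2\<close> times the norm of \<open>h\<close>.\<close>
    define \<delta> where "\<delta> = min 1 (min (d / L) (\<epsilon> / (2 * c)))"
    have "\<bar>action \<omega> v p (\<lambda>z. Q z + h z) - action \<omega> v p Q\<bar> \<le> \<epsilon> * norm_X h" if h: "h \<in> X" "norm_X h < \<delta>" for h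
    proof -
      define n where "n = norm_X h"
      have n: "0 \<le> n" "n \<le> 1" "n * L < d" "c * n \<le> \<epsilon> / 2"
        using h(2) norm_X_nonneg[of h] L c by (auto simp: n_def \<delta>_def less_divide_eq field_simps)
      have Ah: "A h \<le> c * n\<^sup>2" unfolding A_def c_def n_def by (rule quad_form_le_norm_X[OF h(1) v \<omega>])
      have low: "action \<omega> v p Q - \<epsilon> / 2 * n \<le> action \<omega> v p (\<lambda>z. Q z + k z)" if k: "k \<in> X" "A k \<le> c * n\<^sup>2" for k
      proof -
        have b: "\<bar>A (\<lambda>z. Q z + k z) - a\<bar> \<le> L * n"
          unfolding L_def a_def using c by (intro A_perturbation Q k n) auto
        then have "\<bar>A (\<lambda>z. Q z + k z) - a\<bar> < d" using n(3) by (simp add: mult.commute)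
        then have "\<bar>f (A (\<lambda>z. Q z + k z)) - f a\<bar> \<le> e' * \<bar>A (\<lambda>z. Q z + k z) - a\<bar>" by (rule d(2))
        also have "\<dots> \<le> e' * (L * n)" using b e'(1) by (intro mult_left_mono) auto
        also have "\<dots> = \<epsilon> / 2 * n" using e'(2) by (simp add: mult.assoc[symmetric])
        finally show ?thesis using fle[OF X_add[OF Q(1) k(1)]] fa by linarith
      qed
      have mh: "(\<lambda>z. - h z) \<in> X" "A (\<lambda>z. - h z) \<le> c * n\<^sup>2"
        using X_cmult[OF h(1), of "-1"] A_cmult[OF h(1), of "-1"] Ah by auto
      have lo: "action \<omega> v p Q - \<epsilon> / 2 * n \<le> action \<omega> v p (\<lambda>z. Q z + h z)" by (rule low[OF h(1) Ah])
      have lo': "action \<omega> v p Q - \<epsilon> / 2 * n \<le> action \<omega> v p (\<lambda>z. Q z - h z)" using low[OF mh] by simp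
      have "action \<omega> v p (\<lambda>z. Q z + h z) + action \<omega> v p (\<lambda>z. Q z - h z) \<le> 2 * action \<omega> v p Q + A h"
        using A_parallelogram[OF Q(1) h(1)] divide_right_mono[OF N_midpoint_convex[OF Q(1) h(1)], of q] q
        unfolding action_eq by (simp add: add_divide_distrib)
      moreover have "A h \<le> \<epsilon> / 2 * n"
      proof -
        have "c * n\<^sup>2 \<le> \<epsilon> / 2 * n" using mult_right_mono[OF n(4) n(1)] by (simp add: power2_eq_square mult.assoc)
        then show ?thesis using Ah by linarith
      qed
      ultimately have "action \<omega> v p (\<lambda>z. Q z + h z) - action \<omega> v p Q \<le> \<epsilon> * n" using lo' by (simp add: field_simps)
      moreover have "- (\<epsilon> * n) \<le> action \<omega> v p (\<lambda>z. Q z + h z) - action \<omega> v p Q"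
      proof -
        have "0 \<le> \<epsilon> * n" using e n(1) by simp
        then show ?thesis using lo by linarith
      qed
      ultimately show ?thesis unfolding n_def by (simp add: abs_le_iff)
    qed
    moreover have "\<delta> > 0" using d(1) L e c by (simp add: \<delta>_def)
    ultimately show "\<exists>\<delta>>0. \<forall>h\<in>X. norm_X h < \<delta> \<longrightarrow> \<bar>action \<omega> v p (\<lambda>z. Q z + h z) - action \<omega> v p Q\<bar> \<le> \<epsilon> * norm_X h"
      by blast
  qed
qed

end

theorem theorem1p4:
  fixes \<omega> v p :: real
  assumes "\<omega> > 0" and "\<bar>v\<bar> < 1" and "1 < p" and "p < 5"
  shows "\<exists>Q. Q \<in> X \<and> nonzero Q \<and> is_solution \<omega> v p Q \<and> action \<omega> v p Q = min_action \<omega> v p"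
proof -
  interpret nls \<omega> v p by unfold_locales (rule assms)+
  obtain Q where Q: "ground_state Q" using ground_state_exists by blast
  then show ?thesis
    using ground_state_is_solution[OF Q] ground_state_min_action[OF Q] unfolding ground_state_def by blast
qed

end
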